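(* For every $d\ge 1$, there is an $\Omega\left(\frac{1}{\sqrt{d}}\right)$-approximation algorithm for $d$-dimensional knapsack that runs in time $(d\cdot\log W)^{O(d^2)}+n^{O(1)}$, where $n$ is the encoding size of the input instance and $W=\max_{j\in[d]}B_j$ is its maximum budget.
   Context: $d$-dimensional knapsack: an instance $\mathcal{I}=(I,p,c,B)$ consists of a finite set of items $I$, a profit function $p: I\to\mathbb{N}$, a cost function $c: I\to \mathbb{N}^d$, and a budget $B\in\mathbb{N}^d$ (here $0\in\mathbb{N}$). A solution is a subset $S\subseteq I$ with $c_j(S):=\sum_{i\in S}c_j(i)\le B_j$ for all $j\in[d]=\{1,\dots,d\}$; its profit is $p(S)=\sum_{i\in S}p(i)$, to be maximized. $\mathrm{OPT}(\mathcal{I})$ is the maximum profit of a solution. An $\alpha$-approximation algorithm returns, on every instance, a solution of profit at least $\alpha\cdot \mathrm{OPT}(\mathcal{I})$. The constants hidden in $\Omega(\cdot)$ and $O(\cdot)$ are absolute (independent of $d$ and of the instance). *)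

theory Defs
  imports Complex_Main "HOL-Library.Log_Nat"
begin


text \<open>Items are named by natural numbers. Only the values of \<open>profit\<close> and \<open>cost\<close> at
  items, and of \<open>cost\<close> and \<open>budget\<close> at dimensions in \<open>{1..d}\<close>, are ever used;
  \<open>cost I i j\<close> is $c_j(i)$.\<close>

record knapsack =
  items :: "nat set"
  profit :: "nat \<Rightarrow> nat"
  cost :: "nat \<Rightarrow> nat \<Rightarrow> nat"
  budget :: "nat \<Rightarrow> nat"

definition total_profit :: "knapsack \<Rightarrow> nat set \<Rightarrow> nat" where
  "total_profit I S = (\<Sum>i\<in>S. profit I i)"

definition total_cost :: "knapsack \<Rightarrow> nat \<Rightarrow> nat set \<Rightarrow> nat" where
  "total_cost I j S = (\<Sum>i\<in>S. cost I i j)"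

definition solution :: "nat \<Rightarrow> knapsack \<Rightarrow> nat set \<Rightarrow> bool" where
  "solution d I S \<longleftrightarrow> S \<subseteq> items I \<and> (\<forall>j\<in>{1..d}. total_cost I j S \<le> budget I j)"

definition OPT :: "nat \<Rightarrow> knapsack \<Rightarrow> nat" where
  "OPT d I = Max {total_profit I S | S. solution d I S}"

definition max_budget :: "nat \<Rightarrow> knapsack \<Rightarrow> nat" where
  "max_budget d I = Max (budget I ` {1..d})"

text \<open>The size of a number is the number of its binary digits plus one for a separator.\<close>

definition size_nat :: "nat \<Rightarrow> nat" where
  "size_nat x = floorlog 2 x + 1"

definition encode :: "nat \<Rightarrow> knapsack \<Rightarrow> nat list" where
  "encode d I = [d, card (items I)] @ map (budget I) [1..<d+1] @
     concat (map (\<lambda>i. [i, profit I i] @ map (cost I i) [1..<d+1]) (sorted_list_of_set (items I)))"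

definition encoding_size :: "nat \<Rightarrow> knapsack \<Rightarrow> nat" where
  "encoding_size d I = (\<Sum>x\<leftarrow>encode d I. size_nat x)"



text \<open>Programs are while programs over finitely many arrays of natural numbers (a memory
  maps an array name and an index to a number), i.e. random access machines with structured
  control flow. Every elementary operation is charged the total size of the numbers and
  addresses it handles (the logarithmic cost criterion of Cook and Reckhow), so running times
  are polynomially related to those of multitape Turing machines, multiplication and division
  included.\<close>

type_synonym memory = "nat \<Rightarrow> nat \<Rightarrow> nat"

datatype expr =
    Const nat
  | Read nat expr
  | Add expr expr
  | Sub expr expr
  | Mul expr expr
  | Div expr expr

fun eval_expr :: "expr \<Rightarrow> memory \<Rightarrow> nat" where
  "eval_expr (Const k) s = k"
| "eval_expr (Read a e) s = s a (eval_expr e s)"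
| "eval_expr (Add e f) s = eval_expr e s + eval_expr f s"
| "eval_expr (Sub e f) s = eval_expr e s - eval_expr f s"
| "eval_expr (Mul e f) s = eval_expr e s * eval_expr f s"
| "eval_expr (Div e f) s = eval_expr e s div eval_expr f s"

fun time_expr :: "expr \<Rightarrow> memory \<Rightarrow> nat" where
  "time_expr (Const k) s = size_nat k"
| "time_expr (Read a e) s =
     time_expr e s + size_nat (eval_expr e s) + size_nat (s a (eval_expr e s))"
| "time_expr (Add e f) s =
     time_expr e s + time_expr f s + size_nat (eval_expr e s) + size_nat (eval_expr f s)"
| "time_expr (Sub e f) s =
     time_expr e s + time_expr f s + size_nat (eval_expr e s) + size_nat (eval_expr f s)"
| "time_expr (Mul e f) s =
     time_expr e s + time_expr f s + size_nat (eval_expr e s) + size_nat (eval_expr f s)"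
| "time_expr (Div e f) s =
     time_expr e s + time_expr f s + size_nat (eval_expr e s) + size_nat (eval_expr f s)"

text \<open>\<open>Write a e f\<close> stores the value of \<open>f\<close> in array \<open>a\<close> at the index given by \<open>e\<close>.
  A condition holds if its value is nonzero.\<close>

datatype program =
    Skip
  | Write nat expr expr
  | Seq program program
  | If expr program program
  | While expr program

text \<open>\<open>exec P s t s'\<close>: started in memory \<open>s\<close>, the program \<open>P\<close> halts after time \<open>t\<close> in
  memory \<open>s'\<close>.\<close>

inductive exec :: "program \<Rightarrow> memory \<Rightarrow> nat \<Rightarrow> memory \<Rightarrow> bool" where
  Skip: "exec Skip s 1 s"
| Write: "exec (Write a e f) s
     (time_expr e s + time_expr f s + size_nat (eval_expr e s) + size_nat (eval_expr f s))
     (s(a := (s a)(eval_expr e s := eval_expr f s)))"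
| Seq: "exec P s t s' \<Longrightarrow> exec Q s' u s'' \<Longrightarrow> exec (Seq P Q) s (t + u) s''"
| IfTrue: "eval_expr e s \<noteq> 0 \<Longrightarrow> exec P s t s' \<Longrightarrow>
     exec (If e P Q) s (time_expr e s + size_nat (eval_expr e s) + t) s'"
| IfFalse: "eval_expr e s = 0 \<Longrightarrow> exec Q s t s' \<Longrightarrow>
     exec (If e P Q) s (time_expr e s + size_nat (eval_expr e s) + t) s'"
| WhileFalse: "eval_expr e s = 0 \<Longrightarrow>
     exec (While e P) s (time_expr e s + size_nat (eval_expr e s)) s"
| WhileTrue: "eval_expr e s \<noteq> 0 \<Longrightarrow> exec P s t s' \<Longrightarrow> exec (While e P) s' u s'' \<Longrightarrow>
     exec (While e P) s (time_expr e s + size_nat (eval_expr e s) + t + u) s''"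

inductive_cases exec_SkipE: "exec Skip s t s'"
  and exec_WriteE: "exec (Write a e f) s t s'"
  and exec_SeqE: "exec (Seq P Q) s t s'"
  and exec_IfE: "exec (If e P Q) s t s'"
  and exec_WhileE: "exec (While e P) s t s'"

lemma exec_deterministic:
  "exec P s t s' \<Longrightarrow> exec P s u s'' \<Longrightarrow> t = u \<and> s' = s''"
proof (induction arbitrary: u s'' rule: exec.induct)
  case (Skip s)
  then show ?case by (auto elim: exec_SkipE)
next
  case (Write a e f s)
  then show ?case by (auto elim: exec_WriteE)
next
  case (Seq P s t s' Q u s'' v r)
  from Seq.prems show ?case
  proof (rule exec_SeqE)
    fix t1 s1 u1
    assume "v = t1 + u1" "exec P s t1 s1" "exec Q s1 u1 r"
    with Seq.IH(1)[of t1 s1] Seq.IH(2)[of u1 r] show ?thesis by simp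
  qed
next
  case (IfTrue e s P t s' Q)
  from IfTrue.prems show ?case
    by (rule exec_IfE) (simp_all add: IfTrue.hyps IfTrue.IH)
next
  case (IfFalse e s Q t s' P)
  from IfFalse.prems show ?case
    by (rule exec_IfE) (simp_all add: IfFalse.hyps IfFalse.IH)
next
  case (WhileFalse e s P)
  from WhileFalse.prems show ?case
    by (rule exec_WhileE) (simp_all add: WhileFalse.hyps)
next
  case (WhileTrue e s P t s' u s'' v r)
  from WhileTrue.prems show ?case
  proof (rule exec_WhileE)
    assume "eval_expr e s = 0"
    with WhileTrue.hyps show ?thesis by simp
  next
    fix t1 s1 u1
    assume "v = time_expr e s + size_nat (eval_expr e s) + t1 + u1"
      "exec P s t1 s1" "exec (While e P) s1 u1 r"
    with WhileTrue.IH(1)[of t1 s1] WhileTrue.IH(2)[of u1 r] show ?thesis by simp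
  qed
qed

text \<open>The input is the content of array 0, all other cells being 0. The output is the set of
  items listed in the cells \<open>1, \<dots>, k\<close> of array 1, where \<open>k\<close> is the content of its cell 0.\<close>

definition input_memory :: "nat \<Rightarrow> knapsack \<Rightarrow> memory" where
  "input_memory d I = (\<lambda>a k. if a = 0 \<and> k < length (encode d I) then encode d I ! k else 0)"

definition output_items :: "memory \<Rightarrow> nat set" where
  "output_items s = s 1 ` {1..s 1 0}"

definition approximation_algorithm :: "nat \<Rightarrow> real \<Rightarrow> program \<Rightarrow> bool" where
  "approximation_algorithm d \<alpha> P \<longleftrightarrow> (\<forall>I. finite (items I) \<longrightarrow>
     (\<exists>t s. exec P (input_memory d I) t s \<and> solution d I (output_items s) \<and>
        real (total_profit I (output_items s)) \<ge> \<alpha> * real (OPT d I)))"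

definition runs_in_time :: "nat \<Rightarrow> program \<Rightarrow> (knapsack \<Rightarrow> real) \<Rightarrow> bool" where
  "runs_in_time d P T \<longleftrightarrow> (\<forall>I. finite (items I) \<longrightarrow>
     (\<exists>t s. exec P (input_memory d I) t s \<and> real t \<le> T I))"

end

theory Submission
  imports Defs
begin

text \<open>Fix an optimal solution and call an item small if it uses at most a quarter of every
  budget.

  Small items: take them greedily by profit per price, where dimension \<open>j\<close> has price 1 until a
  quarter of its budget is used up and price \<open>s \<approx> \<surd>d\<close> afterwards. Comparing with
  the prices at the moment when some dimension is three quarters full gives an \<open>O(s)\<close>-approximation.

  Big items: there are at most \<open>3d\<close> of them. Rounding the cost of each of them up to a
  grid of \<open>O(d log W)\<close> values, such that both the cost and the remaining budget change by a
  factor of at most \<open>1 \<plusminus> 1/(6d+1)\<close>, can violate the budget of a dimension only if the two items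
  that are most expensive in it are both present. So the conflict graph has at most \<open>d\<close> edges and is
  \<open>O(s)\<close>-colourable, and some colour class remains feasible after rounding and has an
  \<open>\<Omega>(1/s)\<close> fraction of the profit. All roundings of all classes are enumerated, which takes
  \<open>(d log W)^O(d^2)\<close> rounds; for every guess, items below the guessed costs are picked by profit.

  If all budgets are at most 1, the enumeration is too expensive, and the problem is set packing: items
  with more than \<open>s\<close> unit costs are handled by the most profitable item, the others by the
  density greedy algorithm.\<close>

section \<open>Greedy algorithms and their guarantees\<close>

text \<open>For W = 1 the term in d log W is 0, so only polynomial time is left; this forces the
  separate treatment of budgets at most 1.

  The price s balances two costs. At price 1 the d dimensions charge an optimal solution up to d
  units, a unit being one full budget. A dimension that gets three quarters full has paid about s/4
  units, because the load beyond one half was bought at price s. The ratio of the two is of order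
  d/s, and the dimensions at price s lose a factor of order s, so s is chosen near the square root
  of d.

  Guessed costs must dominate the true ones and still add up to at most the budget. An error of x/q
  is harmless as long as a more expensive item is left out, since that item leaves a gap. For the
  most expensive item x itself an error relative to the remaining budget b - x is needed, hence the
  second rounding. If the second most expensive item is missing, the gap pays for the other items
  too; only when both are present may the budget break.

  A guess names thresholds, not items: 3d slots times d dimensions are 3d^2 digits, each with O(d
  log W) values, and no factor depends on the number of items.\<close>

definition select :: "(nat \<Rightarrow> nat) \<Rightarrow> nat set \<Rightarrow> (nat \<Rightarrow> nat) \<Rightarrow> nat set \<Rightarrow> nat set \<Rightarrow> bool" where
  "select p V w C C' \<longleftrightarrow>
     (\<exists>b\<in>V. p b > 0 \<and> (\<forall>i\<in>V. p i * w b \<le> p b * w i) \<and> C' = insert b C) \<or>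
     ((\<forall>i\<in>V. p i = 0) \<and> C' = C)"

text \<open>A relation, because ties are left open; every guarantee below holds for all runs. The
  candidate set may depend on the round, as guessed thresholds change from slot to slot, and a round
  without profitable candidates changes nothing, so a run can always last exactly \<open>m\<close>
  rounds. Densities are compared by cross products, which makes weight 0 an infinite
  density.\<close>

inductive greedy :: "(nat \<Rightarrow> nat) \<Rightarrow> (nat \<Rightarrow> nat set \<Rightarrow> nat set) \<Rightarrow> (nat set \<Rightarrow> nat \<Rightarrow> nat)
    \<Rightarrow> nat \<Rightarrow> nat set \<Rightarrow> bool" for p V w where
  greedy_0: "greedy p V w 0 {}"
| greedy_Suc: "greedy p V w k C \<Longrightarrow> select p (V k C) (w C) C C' \<Longrightarrow> greedy p V w (Suc k) C'"

lemma greedy_pick_induct [consumes 1, case_names 0 stuck pick]: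
  assumes "greedy p V w k C"
    and "Q 0 {}"
    and "\<And>k C. greedy p V w k C \<Longrightarrow> Q k C \<Longrightarrow> \<forall>i\<in>V k C. p i = 0 \<Longrightarrow> Q (Suc k) C"
    and "\<And>k C b. greedy p V w k C \<Longrightarrow> Q k C \<Longrightarrow> b \<in> V k C \<Longrightarrow> p b > 0 \<Longrightarrow>
           \<forall>i\<in>V k C. p i * w C b \<le> p b * w C i \<Longrightarrow> Q (Suc k) (insert b C)"
  shows "Q k C"
  using assms(1)
proof induction
  case greedy_0
  show ?case by (fact assms(2))
next
  case (greedy_Suc k C C')
  then show ?case using assms(3,4)[of k C] unfolding select_def by auto
qed

lemma greedy_pick:
  assumes "greedy p V w k C" "b \<in> V k C" "p b > 0" "\<forall>i\<in>V k C. p i * w C b \<le> p b * w C i"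
  shows "greedy p V w (Suc k) (insert b C)"
  using assms(1) by (rule greedy_Suc) (use assms(2-4) in \<open>auto simp: select_def\<close>)

lemma ex_maximizer:
  fixes x :: "nat \<Rightarrow> nat"
  assumes "finite H" "H \<noteq> {}"
  shows "\<exists>e\<in>H. \<forall>i\<in>H. x i \<le> x e"
proof -
  have "Max (x ` H) \<in> x ` H" using assms by (intro Max_in) auto
  then obtain e where "e \<in> H" "x e = Max (x ` H)" by auto
  then show ?thesis using assms(1) by (intro bexI[of _ e]) auto
qed

lemma sum_diff_le:
  fixes f :: "nat \<Rightarrow> nat"
  assumes "finite S" "finite C"
  shows "sum f S \<le> sum f (S - C) + sum f C"
proof -
  have "sum f S = sum f (S - C) + sum f (S \<inter> C)"
    using assms by (metis Int_Diff_Un Int_Diff_disjoint finite_Int finite_Diff sum.union_disjoint add.commute)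
  also have "sum f (S \<inter> C) \<le> sum f C" using assms by (intro sum_mono2) auto
  finally show ?thesis by simp
qed

section \<open>Packing instances on rows: loads, candidates and scaled weights\<close>

locale packing =
  fixes d m :: nat and p :: "nat \<Rightarrow> nat" and c :: "nat \<Rightarrow> nat \<Rightarrow> nat" and B :: "nat \<Rightarrow> nat"
begin

definition load :: "nat set \<Rightarrow> nat \<Rightarrow> nat" where
  "load C j = (\<Sum>i\<in>C. c i j)"

definition feasible :: "nat set \<Rightarrow> bool" where
  "feasible C \<longleftrightarrow> C \<subseteq> {..<m} \<and> (\<forall>j\<in>{1..d}. load C j \<le> B j)"

text \<open>One filter serves all greedy runs: \<open>u\<close> is a quarter of the budget, the
  whole budget or a guessed threshold, and \<open>Q\<close> limits the number of unit costs in the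
  set packing case.\<close>

definition cand :: "(nat \<Rightarrow> nat) \<Rightarrow> (nat \<Rightarrow> bool) \<Rightarrow> nat set \<Rightarrow> nat set" where
  "cand u Q C = {i\<in>{..<m}. i \<notin> C \<and> Q i \<and> (\<forall>j\<in>{1..d}. c i j \<le> u j \<and> load C j + c i j \<le> B j)}"

text \<open>A common multiple of the nonzero budgets, so that costs relative to budgets can be
  compared in integers.\<close>

definition scale :: nat where
  "scale = (\<Prod>j\<in>{1..d}. if B j = 0 then 1 else B j)"

text \<open>For nonzero budgets \<open>scale div B j\<close> is exactly \<open>scale / B j\<close>; a zero budget
  contributes 0, as \<open>cand\<close> contains only items without cost in that dimension.\<close>

definition weight :: "nat \<Rightarrow> nat set \<Rightarrow> nat \<Rightarrow> nat" where
  "weight s C i = (\<Sum>j\<in>{1..d}. (if 4 * load C j > B j then s else 1) * (c i j * (scale div B j)))"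

lemma feasible_finite: "feasible C \<Longrightarrow> finite C"
  unfolding feasible_def using finite_subset by blast

lemma load_insert: "finite C \<Longrightarrow> b \<notin> C \<Longrightarrow> load (insert b C) j = load C j + c b j"
  unfolding load_def by simp

lemma feasible_subset: "feasible S \<Longrightarrow> T \<subseteq> S \<Longrightarrow> feasible T"
  unfolding feasible_def load_def
  by (meson finite_lessThan finite_subset order_trans sum_mono2 zero_le)

lemma greedy_feasible:
  assumes "greedy p V w k C" "\<And>k C. V k C \<subseteq> cand (u k) Q C"
  shows "feasible C"
  using assms(1)
proof (induction rule: greedy_pick_induct)
  case 0
  then show ?case by (simp add: feasible_def load_def)
next
  case (stuck k C)
  then show ?case by simp
next
  case (pick k C b)
  then have b: "b \<in> cand (u k) Q C" using assms(2) by blast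
  then show ?case using pick feasible_finite[of C] load_insert[of C b]
    by (auto simp: feasible_def cand_def)
qed

text \<open>A round that picks nothing leaves \<open>C\<close> unchanged and, since the filter does
  not depend on the round, also \<open>V C\<close>; so no later round can pick either.\<close>

lemma greedy_card:
  assumes "greedy p (\<lambda>_. V) w k C" "\<And>C. V C \<subseteq> cand u Q C"
  shows "card C = k \<or> (\<forall>i\<in>V C. p i = 0)"
  using assms(1)
proof (induction rule: greedy_pick_induct)
  case (pick k C b)
  then have "finite C" using greedy_feasible[OF pick.hyps(1)] assms(2) feasible_finite by metis
  moreover have "b \<notin> C" using pick assms(2) by (auto simp: cand_def)
  ultimately show ?case using pick by auto
qed auto

text \<open>A profitable candidate left over would mean that all \<open>m\<close> rounds picked a
  new item, but then all rows are chosen and no candidate exists.\<close>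

lemma greedy_exhausted:
  assumes "greedy p (\<lambda>_. V) w m C" "\<And>C. V C \<subseteq> cand u Q C" "i \<in> V C"
  shows "p i = 0"
proof (rule ccontr)
  assume "p i \<noteq> 0"
  then have "card C = m" using greedy_card[of V w m C, OF assms(1,2)] assms(3) by auto
  moreover have "C \<subseteq> {..<m}" using greedy_feasible[OF assms(1,2)] by (simp add: feasible_def)
  ultimately have "C = {..<m}" using card_subset_eq[of "{..<m}" C] by simp
  then show False using assms(2,3) by (auto simp: cand_def)
qed

lemma scale_pos: "scale > 0"
  unfolding scale_def by (rule prod_pos) auto

lemma scale_div: "j \<in> {1..d} \<Longrightarrow> B j > 0 \<Longrightarrow> B j * (scale div B j) = scale"
proof -
  assume j: "j \<in> {1..d}" "B j > 0"
  have "(if B j = 0 then 1 else B j) dvd scale"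
    unfolding scale_def using j(1) by (intro dvd_prodI) auto
  then show ?thesis using j(2) by simp
qed

lemma scaled_le:
  assumes "j \<in> {1..d}" "a * x \<le> b * B j"
  shows "a * (x * (scale div B j)) \<le> b * scale"
proof (cases "B j = 0")
  case False
  have "a * x * (scale div B j) \<le> b * B j * (scale div B j)"
    using assms(2) by (rule mult_right_mono) simp
  then show ?thesis using scale_div[OF assms(1)] False by (simp add: mult.assoc)
qed simp

lemma scaled_ge:
  assumes "j \<in> {1..d}" "b * B j \<le> a * x" "B j > 0"
  shows "b * scale \<le> a * (x * (scale div B j))"
proof -
  have "b * B j * (scale div B j) \<le> a * x * (scale div B j)"
    using assms(2) by (rule mult_right_mono) simp
  then show ?thesis using scale_div[OF assms(1,3)] by (simp add: mult.assoc)
qed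

lemma weight_mono:
  assumes "C \<subseteq> C'" "finite C'" "s \<ge> 1"
  shows "weight s C i \<le> weight s C' i"
  unfolding weight_def
proof (rule sum_mono)
  fix j assume "j \<in> {1..d}"
  have "load C j \<le> load C' j"
    unfolding load_def using assms by (intro sum_mono2) auto
  then show "(if B j < 4 * load C j then s else 1) * (c i j * (scale div B j))
      \<le> (if B j < 4 * load C' j then s else 1) * (c i j * (scale div B j))"
    using assms(3) by (intro mult_right_mono) auto
qed

lemma weight_ge:
  assumes "s \<ge> 1"
  shows "(\<Sum>j\<in>{1..d}. c i j * (scale div B j)) \<le> weight s C i"
  unfolding weight_def using assms by (intro sum_mono) auto

lemma weight_ge_component:
  assumes "j \<in> {1..d}" "4 * load C j > B j"
  shows "s * (c i j * (scale div B j)) \<le> weight s C i"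
  unfolding weight_def
  using member_le_sum[OF assms(1), of "\<lambda>j. (if 4 * load C j > B j then s else 1) * (c i j * (scale div B j))"]
    assms(2) by simp

text \<open>Let \<open>\<omega>\<close> be the total weight paid, each item weighed at the prices of
  its own round. Once some dimension is more than three quarters full, \<open>S\<close> weighs at
  most \<open>16 * s * \<omega>\<close> at the current prices, and comparing densities bounds the
  profit of \<open>S - C\<close> by \<open>16 * s\<close> times that of \<open>C\<close>. The extra
  1 pays for items of \<open>S\<close> in \<open>C\<close>.\<close>

lemma greedy_small_items:
  assumes s: "s \<ge> 1" "d \<le> 3 * (s * s)"
    and gr: "greedy p (\<lambda>_. cand (\<lambda>j. B j div 4) (\<lambda>_. True)) (weight s) m C"
    and S: "feasible S" "\<And>i j. i \<in> S \<Longrightarrow> j \<in> {1..d} \<Longrightarrow> 4 * c i j \<le> B j"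
  shows "sum p S \<le> (16 * s + 1) * sum p C"
proof -
  let ?V = "\<lambda>_::nat. cand (\<lambda>j. B j div 4) (\<lambda>_. True)"
  let ?sl = "\<lambda>C j. load C j * (scale div B j)"
  define el where "el i \<longleftrightarrow> i < m \<and> (\<forall>j\<in>{1..d}. 4 * c i j \<le> B j)" for i
  \<comment> \<open>The conjuncts say: no remaining small item is denser than the average purchase;
    all prices are at least 1; and load in excess of half a budget was bought at price
    \<open>s\<close>.\<close>
  define inv where "inv C \<omega> \<longleftrightarrow>
      (\<forall>i. el i \<and> i \<notin> C \<longrightarrow> p i * \<omega> \<le> sum p C * weight s C i) \<and>
      (\<Sum>j\<in>{1..d}. ?sl C j) \<le> \<omega> \<and> (\<forall>j\<in>{1..d}. 2 * s * ?sl C j \<le> 2 * \<omega> + s * scale)" for C \<omega>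
  \<comment> \<open>As long as no dimension is above three quarters, every small item still fits, so
    each choice is compared with all of them.\<close>
  define low where "low C \<longleftrightarrow> (\<forall>j\<in>{1..d}. 4 * load C j \<le> 3 * B j)" for C
  have finS: "finite S" using S(1) feasible_finite by blast
  have elO: "el i" if "i \<in> S" for i
    using S that unfolding el_def feasible_def by auto
  have low_cand: "i \<in> ?V k C" if "low C" "el i" "i \<notin> C" for i C k
    using that unfolding low_def el_def cand_def by fastforce
  have bound: "sum p S \<le> (16 * s + 1) * sum p C"
    if inv: "inv C \<omega>" and nl: "\<not> low C" and feas: "feasible C" for C \<omega>
  proof -
    have finC: "finite C" using feas feasible_finite by blast
    obtain j where j: "j \<in> {1..d}" "4 * load C j > 3 * B j"
      using nl unfolding low_def by auto
    then have Bj: "B j > 0" using feas unfolding feasible_def by fastforce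
    have inv_j: "2 * s * ?sl C j \<le> 2 * \<omega> + s * scale" using inv j unfolding inv_def by blast
    have "3 * scale \<le> 4 * ?sl C j"
      using scaled_ge[of j 3 4 "load C j"] j Bj by simp
    then have "s * (3 * scale) \<le> s * (4 * ?sl C j)" by (rule mult_left_mono) simp
    then have 1: "3 * (s * scale) \<le> 4 * (s * ?sl C j)" by (simp add: mult.left_commute)
    have "2 * (s * ?sl C j) \<le> 2 * \<omega> + s * scale" using inv_j by (simp add: mult.assoc)
    \<comment> \<open>Three quarters of \<open>scale\<close> exceed the free half by a quarter, and
      this excess was charged at price \<open>s\<close>.\<close>
    then have 2: "s * scale \<le> 4 * \<omega>" using 1 by linarith
    have "s * scale > 0" using s scale_pos by simp
    then have 3: "\<omega> > 0" using 2 by linarith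
    have w_sum: "(\<Sum>i\<in>S. weight s C i) \<le> (16 * s) * \<omega>"
    proof -
      let ?y = "\<lambda>j. if 4 * load C j > B j then s else 1"
      have "(\<Sum>i\<in>S. weight s C i) = (\<Sum>j\<in>{1..d}. \<Sum>i\<in>S. ?y j * (c i j * (scale div B j)))"
        unfolding weight_def by (rule sum.swap)
      also have "\<dots> = (\<Sum>j\<in>{1..d}. ?y j * ?sl S j)"
        unfolding load_def by (simp add: sum_distrib_left sum_distrib_right)
      \<comment> \<open>At price 1 the solution \<open>S\<close> pays at most \<open>scale\<close>
        in a dimension. At price \<open>s\<close> the dimension is more than a quarter full, so the
        load of \<open>S\<close> is at most four times that of \<open>C\<close>.\<close>
      also have "\<dots> \<le> (\<Sum>j\<in>{1..d}. scale + 4 * s * ?sl C j)"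
      proof (rule sum_mono)
        fix j assume j: "j \<in> {1..d}"
        have le: "?sl S j \<le> scale"
          using scaled_le[OF j, of 1 "load S j" 1] S(1) j by (simp add: feasible_def)
        show "?y j * ?sl S j \<le> scale + 4 * s * ?sl C j"
        proof (cases "4 * load C j > B j")
          case True
          then have "B j > 0" using feas j unfolding feasible_def by fastforce
          then have "scale \<le> 4 * ?sl C j" using scaled_ge[OF j, of 1 4 "load C j"] True by simp
          then have "?sl S j \<le> 4 * ?sl C j" using le by linarith
          then have "s * ?sl S j \<le> s * (4 * ?sl C j)" by (rule mult_left_mono) simp
          also have "\<dots> = 4 * s * ?sl C j" by (simp only: ac_simps)
          also have "\<dots> \<le> scale + \<dots>" by simp
          finally show ?thesis using True by simp
        next
          case False
          then show ?thesis using le by simp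
        qed
      qed
      also have "\<dots> = d * scale + 4 * s * (\<Sum>j\<in>{1..d}. ?sl C j)"
        by (simp add: sum.distrib sum_distrib_left)
      also have "\<dots> \<le> d * scale + 4 * s * \<omega>"
        using inv unfolding inv_def by (intro add_left_mono mult_left_mono) auto
      \<comment> \<open>Here the size of \<open>s\<close> enters: the base charge of all
        \<open>d\<close> dimensions becomes a multiple of what the one full dimension has
        paid.\<close>
      also have "d * scale \<le> 3 * s * (s * scale)"
        using mult_right_mono[OF s(2), of scale] by (simp add: ac_simps)
      also have "\<dots> \<le> 3 * s * (4 * \<omega>)" using 2 by (rule mult_left_mono) simp
      finally show ?thesis by (simp add: algebra_simps)
    qed
    have "sum p (S - C) * \<omega> = (\<Sum>i\<in>S - C. p i * \<omega>)" by (simp add: sum_distrib_right)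
    also have "\<dots> \<le> (\<Sum>i\<in>S - C. sum p C * weight s C i)"
      using inv elO unfolding inv_def by (intro sum_mono) auto
    also have "\<dots> \<le> (\<Sum>i\<in>S. sum p C * weight s C i)"
      using finS by (intro sum_mono2) auto
    also have "\<dots> = sum p C * (\<Sum>i\<in>S. weight s C i)" by (simp add: sum_distrib_left)
    also have "\<dots> \<le> sum p C * ((16 * s) * \<omega>)" using w_sum by (rule mult_left_mono) simp
    finally have "sum p (S - C) * \<omega> \<le> (16 * s * sum p C) * \<omega>" by (simp add: ac_simps)
    then have "sum p (S - C) \<le> 16 * s * sum p C" using 3 by simp
    moreover have "sum p S \<le> sum p (S - C) + sum p C"
      using sum_diff_le[OF finS finC] .
    ultimately show ?thesis by (simp add: algebra_simps)
  qed
  have gf: "feasible C" if "greedy p (\<lambda>_. cand (\<lambda>j. B j div 4) (\<lambda>_. True)) (weight s) k C" for k C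
    using greedy_feasible[OF that, of "\<lambda>_ j. B j div 4"] by blast
  \<comment> \<open>The second alternative is permanent, because the profit of \<open>C\<close> only
    grows; it is entered at the first pick that makes some dimension more than three quarters
    full.\<close>
  have "(low C \<and> (\<exists>\<omega>. inv C \<omega>)) \<or> sum p S \<le> (16 * s + 1) * sum p C"
    using gr
  proof (induction rule: greedy_pick_induct)
    case 0
    have "inv {} 0" unfolding inv_def by (simp add: load_def)
    then show ?case by (auto simp: low_def load_def)
  next
    case (stuck k C)
    then show ?case by simp
  next
    case (pick k C b)
    have feas: "feasible C" using gf pick.hyps(1) .
    then have finC: "finite C" using feasible_finite by blast
    have feas': "feasible (insert b C)" using gf[OF greedy_pick[OF pick.hyps]] .
    have bC: "b \<notin> C" using pick.hyps(2) by (simp add: cand_def)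
    have sp: "sum p (insert b C) = sum p C + p b" using finC bC by simp
    show ?case
    proof (cases "sum p S \<le> (16 * s + 1) * sum p C")
      case True
      moreover have "(16 * s + 1) * sum p C \<le> (16 * s + 1) * sum p (insert b C)"
        unfolding sp by (rule mult_left_mono) simp_all
      ultimately show ?thesis by linarith
    next
      case False
      then obtain \<omega> where low: "low C" and inv: "inv C \<omega>" using pick.IH by blast
      define \<omega>' where "\<omega>' = \<omega> + weight s C b"
      have "inv (insert b C) \<omega>'"
        unfolding inv_def
      proof (intro conjI allI impI ballI)
        fix i assume i: "el i \<and> i \<notin> insert b C"
        have "p i * \<omega>' = p i * \<omega> + p i * weight s C b" by (simp add: \<omega>'_def algebra_simps)
        also have "\<dots> \<le> sum p C * weight s C i + p b * weight s C i"
          using i inv pick.hyps(4) low_cand[OF low, of i] unfolding inv_def by (intro add_mono) auto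
        also have "\<dots> = sum p (insert b C) * weight s C i" by (simp add: sp algebra_simps)
        also have "\<dots> \<le> sum p (insert b C) * weight s (insert b C) i"
          using weight_mono[of C "insert b C"] finC s(1) by (intro mult_left_mono) auto
        finally show "p i * \<omega>' \<le> sum p (insert b C) * weight s (insert b C) i" .
      next
        have "(\<Sum>j\<in>{1..d}. ?sl (insert b C) j) =
            (\<Sum>j\<in>{1..d}. ?sl C j) + (\<Sum>j\<in>{1..d}. c b j * (scale div B j))"
          by (simp add: load_insert[OF finC bC] algebra_simps sum.distrib)
        also have "\<dots> \<le> \<omega>'"
          unfolding \<omega>'_def using inv weight_ge[OF s(1)] unfolding inv_def by (intro add_mono) auto
        finally show "(\<Sum>j\<in>{1..d}. ?sl (insert b C) j) \<le> \<omega>'" .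
      next
        fix j assume j: "j \<in> {1..d}"
        have l: "load (insert b C) j = load C j + c b j" using load_insert[OF finC bC] .
        show "2 * s * ?sl (insert b C) j \<le> 2 * \<omega>' + s * scale"
        proof (cases "4 * load C j > B j")
          case True
          have "2 * s * ?sl (insert b C) j = 2 * s * ?sl C j + 2 * (s * (c b j * (scale div B j)))"
            by (simp add: l algebra_simps)
          also have "\<dots> \<le> (2 * \<omega> + s * scale) + 2 * weight s C b"
            using inv j weight_ge_component[OF j True] unfolding inv_def
            by (intro add_mono mult_left_mono) auto
          finally show ?thesis by (simp add: \<omega>'_def)
        next
          case False
          \<comment> \<open>From at most a quarter a small item leads to at most a half; this is the
            origin of the summand \<open>s * scale\<close> in the invariant.\<close>
          have "c b j \<le> B j div 4" using pick.hyps(2) j by (simp add: cand_def)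
          then have "4 * c b j \<le> B j" by linarith
          then have "2 * load (insert b C) j \<le> 1 * B j" using False l by simp
          then have "2 * ?sl (insert b C) j \<le> scale" using scaled_le[OF j] by fastforce
          then have "s * (2 * ?sl (insert b C) j) \<le> s * scale" by (rule mult_left_mono) simp
          moreover have "2 * s * ?sl (insert b C) j = s * (2 * ?sl (insert b C) j)"
            by (simp only: ac_simps)
          ultimately show ?thesis by linarith
        qed
      qed
      then show ?thesis using bound feas' by blast
    qed
  qed
  then show ?thesis
  proof (elim disjE conjE exE)
    \<comment> \<open>No dimension ever got nearly full, so all small items remain candidates and
      exhaustion leaves only those of profit 0.\<close>
    assume low: "low C"
    have "p i = 0" if "i \<in> S - C" for i
      using greedy_exhausted[OF gr order_refl] low_cand[OF low elO] that by blast
    then have "sum p (S - C) = 0" by simp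
    moreover have "sum p S \<le> sum p (S - C) + sum p C"
      using sum_diff_le[OF finS] gf[OF gr] feasible_finite by blast
    ultimately show ?thesis by (simp add: algebra_simps)
  qed
qed


text \<open>A dual fitting argument: \<open>z\<close> prices the dimensions so that every item
  blocked by \<open>C\<close> is worth at most the price of the dimensions it uses, at total price
  at most \<open>t\<close> times the profit of \<open>C\<close>. As \<open>S\<close> uses each
  dimension at most once, its items outside \<open>C\<close> are worth at most the total
  price.\<close>

lemma greedy_set_packing:
  assumes B: "\<And>j. j \<in> {1..d} \<Longrightarrow> B j \<le> 1"
    and gr: "greedy p (\<lambda>_. cand B (\<lambda>i. (\<Sum>j\<in>{1..d}. c i j) \<le> t)) (weight s) m C"
    and S: "feasible S" "\<And>i. i \<in> S \<Longrightarrow> (\<Sum>j\<in>{1..d}. c i j) \<le> t"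
  shows "sum p S \<le> (t + 1) * sum p C"
proof -
  let ?n = "\<lambda>i. \<Sum>j\<in>{1..d}. c i j"
  let ?V = "\<lambda>_::nat. cand B (\<lambda>i. ?n i \<le> t)"
  define fits where "fits C i \<longleftrightarrow> (\<forall>j\<in>{1..d}. load C j + c i j \<le> B j)" for C i
  define inv where "inv C z \<longleftrightarrow> (\<forall>j\<in>{1..d}. z j \<ge> 0) \<and> (\<Sum>j\<in>{1..d}. z j) \<le> real t * real (sum p C) \<and>
      (\<forall>i<m. ?n i \<le> t \<and> i \<notin> C \<and> (\<forall>j\<in>{1..d}. c i j \<le> B j) \<longrightarrow>
         fits C i \<or> real (p i) \<le> (\<Sum>j\<in>{1..d}. z j * real (c i j)))" for C z
  have gf: "feasible C" if "greedy p ?V (weight s) k C" for k C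
    using greedy_feasible[OF that, of "\<lambda>_. B"] by blast
  have scale1: "scale = 1" unfolding scale_def
    using B by (intro prod.neutral) (metis One_nat_def le_Suc_eq le_zero_eq)
  \<comment> \<open>A fitting item has cost only in empty dimensions of budget 1, so all relevant
    prices are 1 and density means profit per unit cost.\<close>
  have weight_eq: "weight s C i = ?n i" if "fits C i" for C i
    unfolding weight_def
  proof (rule sum.cong[OF refl])
    fix j assume j: "j \<in> {1..d}"
    show "(if B j < 4 * load C j then s else 1) * (c i j * (scale div B j)) = c i j"
    proof (cases "c i j = 0")
      case False
      have "load C j + c i j \<le> B j" using that j by (simp add: fits_def)
      moreover have "B j \<le> 1" using B j by simp
      ultimately have "load C j = 0" "B j = 1" using False by linarith+
      then show ?thesis by (simp add: scale1)
    qed simp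
  qed
  have "\<exists>z. inv C z" using gr
  proof (induction rule: greedy_pick_induct)
    case 0
    have "inv {} (\<lambda>_. 0)" by (simp add: inv_def fits_def load_def)
    then show ?case by blast
  next
    case (stuck k C)
    then show ?case by simp
  next
    case (pick k C b)
    obtain z where z: "inv C z" using pick.IH by blast
    have finC: "finite C" using gf[OF pick.hyps(1)] feasible_finite by blast
    have bC: "b \<notin> C" using pick.hyps(2) by (simp add: cand_def)
    have l: "load (insert b C) j = load C j + c b j" for j using load_insert[OF finC bC] .
    have sp: "sum p (insert b C) = sum p C + p b" using finC bC by simp
    \<comment> \<open>Every dimension used by \<open>b\<close> is raised by the largest profit that
      an item with at most \<open>t\<close> units can have when it is no denser than
      \<open>b\<close>. For an item without any cost the quotient is 0 by convention, and nothing
      gets blocked.\<close>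
    define e where "e j = real (c b j) * (real t * real (p b) / real (?n b))" for j
    have e0: "e j \<ge> 0" for j by (simp add: e_def sum_nonneg)
    have fb: "fits C b" using pick.hyps(2) by (simp add: cand_def fits_def)
    have "(\<Sum>j\<in>{1..d}. e j) = real (?n b) * (real t * real (p b) / real (?n b))"
      unfolding e_def sum_distrib_right[symmetric] by simp
    also have "\<dots> \<le> real t * real (p b)" by simp
    finally have e_sum: "(\<Sum>j\<in>{1..d}. e j) \<le> real t * real (p b)" .
    have "inv (insert b C) (\<lambda>j. z j + e j)"
      unfolding inv_def
    proof (intro conjI allI impI ballI)
      show "0 \<le> z j + e j" if "j \<in> {1..d}" for j using z e0 that by (simp add: inv_def)
      show "(\<Sum>j\<in>{1..d}. z j + e j) \<le> real t * real (sum p (insert b C))"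
        using z e_sum by (simp add: inv_def sp sum.distrib algebra_simps)
    next
      fix i assume i: "i < m" "?n i \<le> t \<and> i \<notin> insert b C \<and> (\<forall>j\<in>{1..d}. c i j \<le> B j)"
      have mono: "(\<Sum>j\<in>{1..d}. z j * real (c i j)) \<le> (\<Sum>j\<in>{1..d}. (z j + e j) * real (c i j))"
        using e0 by (intro sum_mono mult_right_mono) auto
      show "fits (insert b C) i \<or> real (p i) \<le> (\<Sum>j\<in>{1..d}. (z j + e j) * real (c i j))"
      proof (cases "fits C i \<and> \<not> fits (insert b C) i")
        case True
        then obtain j where j: "j \<in> {1..d}" "load C j + c b j + c i j > B j"
          by (auto simp: fits_def l not_le)
        have "load C j + c i j \<le> B j" "load C j + c b j \<le> B j"
          using True fb j(1) by (auto simp: fits_def)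
        \<comment> \<open>Since \<open>b\<close> and \<open>i\<close> fit separately but not
          together, both use the single unit of dimension \<open>j\<close>.\<close>
        then have cj: "c b j = 1" "c i j = 1"
          using j(2) B[OF j(1)] by linarith+
        have n: "?n b > 0" using cj(1) j(1) by (metis finite_atLeastAtMost less_numeral_extra(1) sum_eq_0_iff gr0I)
        have "i \<in> ?V k C" using i True by (simp add: cand_def fits_def)
        then have "p i * ?n b \<le> p b * ?n i" using pick.hyps(4) weight_eq fb True by metis
        also have "\<dots> \<le> p b * t" using i by simp
        finally have "real (p i) * real (?n b) \<le> real (p b) * real t"
          by (metis of_nat_le_iff of_nat_mult)
        then have "real (p i) \<le> real (p b) * real t / real (?n b)"
          using n by (subst pos_le_divide_eq) (simp_all only: of_nat_0_less_iff)
        also have "\<dots> = e j" by (simp only: e_def cj of_nat_1 mult_1 mult.commute)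
        also have "e j \<le> (z j + e j) * real (c i j)" using z j by (simp add: cj inv_def)
        also have "\<dots> \<le> (\<Sum>j\<in>{1..d}. (z j + e j) * real (c i j))"
          using z e0 j(1) by (intro member_le_sum) (auto simp: inv_def)
        finally show ?thesis by blast
      next
        case False
        then show ?thesis using z i mono by (force simp: inv_def)
      qed
    qed
    then show ?case by blast
  qed
  then obtain z where z: "inv C z" by blast
  have finC: "finite C" using gf[OF gr] feasible_finite by blast
  have finS: "finite S" using S feasible_finite by blast
  have key: "real (p i) \<le> (\<Sum>j\<in>{1..d}. z j * real (c i j))" if i: "i \<in> S - C" for i
  proof -
    have im: "i < m" using i S by (auto simp: feasible_def)
    have cB: "\<forall>j\<in>{1..d}. c i j \<le> B j"
      using feasible_subset[OF S(1), of "{i}"] i by (simp add: feasible_def load_def)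
    show ?thesis
    proof (cases "fits C i")
      case True
      then have "i \<in> ?V 0 C" using i S im cB by (simp add: cand_def fits_def)
      then have "p i = 0" using greedy_exhausted[OF gr order_refl] by simp
      then show ?thesis using z by (auto simp: inv_def intro!: sum_nonneg)
    next
      case False
      then show ?thesis using z im cB S i by (auto simp: inv_def)
    qed
  qed
  have "real (sum p (S - C)) \<le> (\<Sum>i\<in>S - C. \<Sum>j\<in>{1..d}. z j * real (c i j))"
    unfolding of_nat_sum using key by (rule sum_mono)
  also have "\<dots> = (\<Sum>j\<in>{1..d}. \<Sum>i\<in>S - C. z j * real (c i j))" by (rule sum.swap)
  also have "\<dots> = (\<Sum>j\<in>{1..d}. z j * real (load (S - C) j))"
    by (simp add: load_def sum_distrib_left)
  also have "\<dots> \<le> (\<Sum>j\<in>{1..d}. z j * 1)"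
  proof (intro sum_mono mult_left_mono)
    fix j assume j: "j \<in> {1..d}"
    have "load (S - C) j \<le> B j"
      using feasible_subset[OF S(1), of "S - C"] j by (auto simp: feasible_def)
    then show "real (load (S - C) j) \<le> 1" using B[OF j] by simp
    show "0 \<le> z j" using z j by (simp add: inv_def)
  qed
  also have "\<dots> \<le> real t * real (sum p C)" using z by (simp add: inv_def)
  finally have "sum p (S - C) \<le> t * sum p C" by (metis of_nat_le_iff of_nat_mult)
  then show ?thesis using sum_diff_le[OF finS finC, of p] by (simp add: algebra_simps)
qed

text \<open>If the item intended for slot \<open>k\<close> is not available when slot \<open>k\<close> is processed, it has
  been picked before; otherwise an item of at least its profit is picked. Hence the factor 2.\<close>

lemma greedy_guessed:
  assumes gr: "greedy p (\<lambda>k. cand (u k) (\<lambda>_. True)) (\<lambda>_ _. 1) m C"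
    and xs: "distinct xs" "set xs \<subseteq> {..<m}"
    and u: "\<And>k j. k < length xs \<Longrightarrow> j \<in> {1..d} \<Longrightarrow> c (xs ! k) j \<le> u k j"
      "\<And>j. j \<in> {1..d} \<Longrightarrow> (\<Sum>k<length xs. u k j) \<le> B j"
  shows "sum p (set xs) \<le> 2 * sum p C"
proof -
  let ?V = "\<lambda>k. cand (u k) (\<lambda>_. True)"
  have gf: "feasible C" if "greedy p ?V (\<lambda>_ _. 1) k C" for k C
    using greedy_feasible[OF that, of u] by blast
  \<comment> \<open>The load bound is needed only while intended items remain; the later rounds can
    only add profit.\<close>
  define inv where "inv k C \<longleftrightarrow>
      (k \<le> length xs \<longrightarrow> (\<forall>j\<in>{1..d}. load C j \<le> (\<Sum>k<k. u k j))) \<and>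
      sum p (set (take k xs) - C) \<le> sum p C" for k C
  \<comment> \<open>The thresholds of the processed slots dominate the load and all thresholds
    together respect the budget, so the intended item of slot \<open>k\<close> still fits unless it
    has been chosen already.\<close>
  have next_cand: "xs ! k \<in> ?V k C" if "inv k C" "k < length xs" "xs ! k \<notin> C" for k C
  proof -
    have "c (xs ! k) j \<le> u k j \<and> load C j + c (xs ! k) j \<le> B j" if j: "j \<in> {1..d}" for j
    proof -
      have "load C j \<le> (\<Sum>k<k. u k j)" using \<open>inv k C\<close> \<open>k < length xs\<close> j by (simp add: inv_def)
      moreover have "c (xs ! k) j \<le> u k j" using u(1) \<open>k < length xs\<close> j .
      moreover have "(\<Sum>k<Suc k. u k j) \<le> (\<Sum>k<length xs. u k j)"
        using \<open>k < length xs\<close> by (intro sum_mono2) auto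
      ultimately show ?thesis using u(2)[OF j] by simp
    qed
    moreover have "xs ! k < m" using that(2) xs(2) nth_mem by fastforce
    ultimately show ?thesis using that(3) by (simp add: cand_def)
  qed
  have sum_insert_le: "sum p (insert x A) \<le> p x + sum p A" if "finite A" for x A
    using that by (cases "x \<in> A") (auto simp: insert_absorb)
  have sum_take: "sum p (set (take (Suc k) xs) - C') \<le> e + sum p (set (take k xs) - C)"
    if "C \<subseteq> C'" "\<And>i. i = xs ! k \<Longrightarrow> k < length xs \<Longrightarrow> i \<notin> C \<Longrightarrow> p i \<le> e" for k C C' e
  proof (cases "k < length xs \<and> xs ! k \<notin> C")
    case True
    then have "sum p (set (take (Suc k) xs) - C') \<le> sum p (insert (xs ! k) (set (take k xs) - C))"
      using that(1) by (intro sum_mono2) (auto simp: take_Suc_conv_app_nth)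
    also have "\<dots> \<le> p (xs ! k) + sum p (set (take k xs) - C)" by (rule sum_insert_le) simp
    also have "\<dots> \<le> e + sum p (set (take k xs) - C)" using that(2) True by simp
    finally show ?thesis .
  next
    case False
    then have "set (take (Suc k) xs) - C' \<subseteq> set (take k xs) - C"
      using that(1) by (cases "k < length xs") (auto simp: take_Suc_conv_app_nth)
    then have "sum p (set (take (Suc k) xs) - C') \<le> sum p (set (take k xs) - C)"
      by (intro sum_mono2) auto
    then show ?thesis by simp
  qed
  have "inv m C" using gr
  proof (induction rule: greedy_pick_induct)
    case 0
    then show ?case by (simp add: inv_def load_def)
  next
    case (stuck k C)
    have "sum p (set (take (Suc k) xs) - C) \<le> 0 + sum p (set (take k xs) - C)"
      using next_cand[OF stuck.IH] stuck.hyps by (intro sum_take) auto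
    then show ?case using stuck.IH by (auto simp: inv_def intro: add_increasing2)
  next
    case (pick k C b)
    have finC: "finite C" using gf[OF pick.hyps(1)] feasible_finite by blast
    have bC: "b \<notin> C" using pick.hyps(2) by (simp add: cand_def)
    have "sum p (set (take (Suc k) xs) - insert b C) \<le> p b + sum p (set (take k xs) - C)"
      using next_cand[OF pick.IH] pick.hyps(4) by (intro sum_take) auto
    then have "sum p (set (take (Suc k) xs) - insert b C) \<le> sum p (insert b C)"
      using pick.IH finC bC by (simp add: inv_def)
    moreover have "load (insert b C) j \<le> (\<Sum>k<Suc k. u k j)" if "Suc k \<le> length xs" "j \<in> {1..d}" for j
    proof -
      have "load C j \<le> (\<Sum>k<k. u k j)" using pick.IH that by (simp add: inv_def)
      moreover have "c b j \<le> u k j" using pick.hyps(2) that by (simp add: cand_def)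
      ultimately show ?thesis by (simp add: load_insert[OF finC bC])
    qed
    ultimately show ?case by (simp add: inv_def)
  qed
  then have inv: "sum p (set (take m xs) - C) \<le> sum p C" by (simp add: inv_def)
  have finC: "finite C" using gf[OF gr] feasible_finite by blast
  \<comment> \<open>There are at least as many rounds as intended items, so \<open>take m xs\<close>
    is the whole list.\<close>
  have "length xs \<le> m" using xs card_mono[of "{..<m}" "set xs"] by (simp add: distinct_card)
  then have "sum p (set xs - C) \<le> sum p C" using inv by simp
  then show ?thesis using sum_diff_le[of "set xs" C p] finC by simp
qed

text \<open>Only the pair of the two most expensive items is an obstacle to the slack needed for
  rounding: excluding one of them leaves a gap comparable to all remaining costs.\<close>

lemma rounding_pair:
  fixes x u :: "nat \<Rightarrow> nat"
  assumes H: "finite H" "card H \<le> M" "sum x H \<le> b" "H \<noteq> {}" and q: "2 * M + 1 \<le> q"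
    and u: "\<And>i. i \<in> H \<Longrightarrow> x i \<le> u i" "\<And>i. i \<in> H \<Longrightarrow> q * (u i - x i) \<le> x i"
      "\<And>i. i \<in> H \<Longrightarrow> q * (u i - x i) \<le> b - x i"
  obtains e f where "e \<in> H" "f \<in> H"
    "\<And>K. K \<subseteq> H \<Longrightarrow> e = f \<or> e \<notin> K \<or> f \<notin> K \<Longrightarrow> sum u K \<le> b"
proof -
  have q0: "q > 0" using q by simp
  have qu: "q * sum u K \<le> q * sum x K + sum x K" if "K \<subseteq> H" for K
  proof -
    have "q * u i \<le> q * x i + x i" if "i \<in> K" for i
    proof -
      have i: "i \<in> H" using that \<open>K \<subseteq> H\<close> by blast
      have "q * u i = q * x i + q * (u i - x i)"
        using u(1)[OF i] by (simp flip: distrib_left)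
      then show ?thesis using u(2)[OF i] by simp
    qed
    then have "(\<Sum>i\<in>K. q * u i) \<le> (\<Sum>i\<in>K. q * x i + x i)" by (rule sum_mono)
    then show ?thesis by (simp add: sum_distrib_left sum.distrib)
  qed
  have split: "x e + sum x K \<le> b" if "e \<in> H" "K \<subseteq> H" "e \<notin> K" for e K
  proof -
    have "sum x (insert e K) \<le> sum x H" using that H by (intro sum_mono2) auto
    moreover have "finite K" using that H finite_subset by blast
    ultimately show ?thesis using that H by simp
  qed
  have le_mult: "sum x K \<le> M * x e" if "K \<subseteq> H" "\<And>i. i \<in> K \<Longrightarrow> x i \<le> x e" for K e
  proof -
    have "sum x K \<le> card K * x e" using sum_bounded_above[of K x "x e"] that by simp
    also have "\<dots> \<le> M * x e" using card_mono[OF H(1) that(1)] H(2) by (intro mult_right_mono) auto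
    finally show ?thesis .
  qed
  obtain e where e: "e \<in> H" "\<And>i. i \<in> H \<Longrightarrow> x i \<le> x e"
    using ex_maximizer[OF H(1,4), of x] by blast
  \<comment> \<open>Leaving out the most expensive item frees \<open>x e\<close>, and the rounding
    errors of the others sum to at most \<open>M * x e / q\<close>.\<close>
  have no_e: "sum u K \<le> b" if K: "K \<subseteq> H" "e \<notin> K" for K
  proof -
    have 1: "x e + sum x K \<le> b" by (rule split[OF e(1) K])
    have "sum x K \<le> M * x e" by (rule le_mult) (use e K in auto)
    also have "\<dots> \<le> q * x e" using q by (intro mult_right_mono) auto
    finally have "q * sum u K \<le> q * sum x K + q * x e" using qu[OF K(1)] by linarith
    also have "\<dots> = q * (x e + sum x K)" by (simp add: algebra_simps)
    also have "\<dots> \<le> q * b" using 1 by (rule mult_left_mono) simp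
    finally show ?thesis using q0 by simp
  qed
  \<comment> \<open>If \<open>e\<close> is present, its error is measured against its remaining
    budget, the other errors against their costs. The assumption says that the slack left by the
    exact costs covers both.\<close>
  have with_e: "sum u K \<le> b" if K: "K \<subseteq> H" "e \<in> K"
    and y: "2 * sum x (K - {e}) \<le> (q - 1) * (b - x e - sum x (K - {e}))" for K
  proof -
    let ?y = "sum x (K - {e})"
    have finK: "finite K" using K H finite_subset by blast
    have r: "x e + ?y \<le> b" by (rule split) (use e K in auto)
    define r where "r = b - x e - ?y"
    have b: "b = x e + ?y + r" using r by (simp add: r_def)
    have "q * u e = q * x e + q * (u e - x e)"
      using u(1)[OF e(1)] by (simp flip: distrib_left)
    then have 1: "q * u e \<le> q * x e + (?y + r)" using u(3)[OF e(1)] b by simp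
    have "q * sum u K = q * u e + q * sum u (K - {e})"
      using finK K by (simp add: sum.remove[of K e] algebra_simps)
    also have "\<dots> \<le> q * x e + (?y + r) + (q * ?y + ?y)"
      using 1 qu[of "K - {e}"] K by (intro add_mono) auto
    also have "\<dots> = q * x e + q * ?y + (r + 2 * ?y)" by simp
    also have "\<dots> \<le> q * x e + q * ?y + (r + (q - 1) * r)"
      using y by (simp add: r_def)
    also have "r + (q - 1) * r = q * r" using q0 by (cases q) auto
    also have "q * x e + q * ?y + q * r = q * b" by (simp add: b algebra_simps)
    finally show ?thesis using q0 by simp
  qed
  show thesis
  proof (cases "H = {e}")
    case True
    have le: "sum u K \<le> b" if K: "K \<subseteq> H" for K
    proof (cases "e \<in> K")
      case t: True
      then have "K = {e}" using True K by blast
      then show ?thesis using with_e[of K] K t by simp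
    qed (use no_e K in blast)
    show ?thesis by (rule that[OF e(1) e(1)]) (rule le)
  next
    case False
    then have "H - {e} \<noteq> {}" using e by blast
    then obtain f where f: "f \<in> H - {e}" "\<And>i. i \<in> H - {e} \<Longrightarrow> x i \<le> x f"
      using ex_maximizer[of "H - {e}" x] H(1) by blast
    have le: "sum u K \<le> b" if K: "K \<subseteq> H" "e = f \<or> e \<notin> K \<or> f \<notin> K" for K
    proof (cases "e \<in> K")
      case True
      let ?y = "sum x (K - {e})"
      have fK: "f \<notin> insert e (K - {e})" using K f True by auto
      have "finite K" using K H finite_subset by blast
      then have "sum x (insert e (K - {e})) = x e + ?y" by (simp add: sum.insert_remove)
      then have "x f + (x e + ?y) \<le> b"
        using split[of f "insert e (K - {e})"] f fK e K by auto
      \<comment> \<open>The missing \<open>f\<close> leaves slack at least \<open>x f\<close>, while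
        each of the at most \<open>M\<close> items other than \<open>e\<close> costs at most
        \<open>x f\<close>; this is where \<open>q\<close> has to be at least
        \<open>2 * M + 1\<close>.\<close>
      then have "x f \<le> b - x e - ?y" by linarith
      then have "M * x f \<le> M * (b - x e - ?y)" by (rule mult_left_mono) simp
      moreover have "?y \<le> M * x f" by (rule le_mult) (use K(1) f(2) in auto)
      ultimately have "2 * ?y \<le> 2 * M * (b - x e - ?y)" by linarith
      also have "\<dots> \<le> (q - 1) * (b - x e - ?y)" using q by (intro mult_right_mono) auto
      finally show ?thesis using with_e[OF K(1) True] by blast
    qed (use no_e K in blast)
    have "f \<in> H" using f(1) by blast
    then show ?thesis by (rule that[OF e(1)]) (rule le)
  qed
qed

end

section \<open>Grids of geometrically spaced numbers and the coding of guesses by digits\<close>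

fun grid :: "nat \<Rightarrow> nat \<Rightarrow> nat" where
  "grid q 0 = 0"
| "grid q (Suc k) = grid q k + 1 + grid q k div q"

lemma grid_ge: "k \<le> grid q k"
  by (induction k) auto

lemma grid_strict_mono: "strict_mono (grid q)"
  by (simp add: strict_mono_Suc_iff)

text \<open>Neighbouring points differ by \<open>1 + grid q k div q\<close>. The 1 keeps the points
  distinct while they are below \<open>q\<close>, and a number strictly above the lower point misses
  the upper one by at most a fraction \<open>1/q\<close> of the lower one.\<close>

lemma grid_above:
  assumes "x \<le> grid q n" "q > 0"
  obtains k where "k \<le> n" "x \<le> grid q k" "q * (grid q k - x) \<le> x"
proof -
  define k where "k = (LEAST k. x \<le> grid q k)"
  have k: "x \<le> grid q k" unfolding k_def using assms(1) by (rule LeastI)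
  have kn: "k \<le> n" unfolding k_def using assms(1) by (rule Least_le)
  have "q * (grid q k - x) \<le> x"
  proof (cases k)
    case (Suc i)
    then have "grid q i < x" using not_less_Least[of i "\<lambda>k. x \<le> grid q k"] k_def by simp
    then have 1: "grid q k - x \<le> grid q i div q" "grid q i \<le> x" using Suc by simp_all
    have "q * (grid q k - x) \<le> q * (grid q i div q)" using 1 by (intro mult_left_mono) auto
    also have "\<dots> \<le> grid q i" by simp
    finally show ?thesis using 1 by simp
  qed simp
  then show ?thesis using that k kn by blast
qed

lemma grid_below:
  assumes "y \<le> grid q n" "q > 0"
  obtains k where "k \<le> n" "grid q k \<le> y" "q * (y - grid q k) \<le> y"
proof -
  have "\<exists>k\<le>n. grid q k \<le> y \<and> q * (y - grid q k) \<le> y"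
    using assms(1)
  proof (induction n)
    case (Suc n)
    show ?case
    proof (cases "y \<le> grid q n")
      case True
      then show ?thesis using Suc by (meson le_SucI)
    next
      case False
      show ?thesis
      proof (cases "y = grid q (Suc n)")
        case True
        then show ?thesis by (intro exI[of _ "Suc n"]) simp
      next
        case neq: False
        then have "y - grid q n \<le> grid q n div q" using Suc.prems by simp
        then have "q * (y - grid q n) \<le> q * (grid q n div q)" by (rule mult_left_mono) simp
        also have "\<dots> \<le> grid q n" by simp
        finally show ?thesis using False by (intro exI[of _ n]) simp
      qed
    qed
  qed simp
  then show ?thesis using that by blast
qed

text \<open>The first \<open>n\<close> digits stand for rounding down the remaining budget, the next \<open>n\<close>
  ones for rounding up the cost. Digit 0 is no restriction.\<close>

definition threshold :: "nat \<Rightarrow> nat \<Rightarrow> nat \<Rightarrow> nat \<Rightarrow> nat" where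
  "threshold q n b \<delta> = (if \<delta> < n then b - grid q \<delta> else grid q (\<delta> - n))"

text \<open>The smaller of the two roundings inherits both error bounds. The
  \<open>2 * Suc n\<close> digits are the grid indices from 0 to \<open>n\<close>, once for each
  kind of rounding.\<close>

lemma threshold_exists:
  assumes "x \<le> b" "b \<le> grid q n" "q > 0"
  obtains \<delta> where "\<delta> < 2 * Suc n" "x \<le> threshold q (Suc n) b \<delta>"
    "q * (threshold q (Suc n) b \<delta> - x) \<le> x" "q * (threshold q (Suc n) b \<delta> - x) \<le> b - x"
proof -
  obtain k where k: "k \<le> n" "x \<le> grid q k" "q * (grid q k - x) \<le> x"
    using grid_above[of x q n] assms by (metis le_trans)
  obtain l where l: "l \<le> n" "grid q l \<le> b - x" "q * (b - x - grid q l) \<le> b - x"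
    using grid_below[of "b - x" q n] assms by (metis diff_le_self le_trans)
  have eq: "b - grid q l - x = b - x - grid q l" by simp
  show ?thesis
  proof (cases "grid q k \<le> b - grid q l")
    case True
    then have "q * (grid q k - x) \<le> q * (b - x - grid q l)" by (intro mult_left_mono) auto
    then have "q * (grid q k - x) \<le> b - x" using l(3) by linarith
    then show ?thesis using that[of "Suc n + k"] k by (simp add: threshold_def)
  next
    case False
    then have "q * (b - x - grid q l) \<le> q * (grid q k - x)" by (intro mult_left_mono) auto
    then have "q * (b - x - grid q l) \<le> x" using k(3) by linarith
    moreover have "x \<le> b - grid q l" using l(2) assms(1) by linarith
    ultimately show ?thesis using that[of l] l eq by (simp add: threshold_def del: diff_diff_left)
  qed
qed

text \<open>Turns the enumeration of whole tables of guesses into a loop over a single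
  counter.\<close>

lemma digits_exist:
  assumes "\<And>i. i < k \<Longrightarrow> f i < E"
  obtains N :: nat where "N < E ^ k" "\<And>i. i < k \<Longrightarrow> N div E ^ i mod E = f i"
proof -
  have "\<exists>N<E ^ k. \<forall>i<k. N div E ^ i mod E = f i"
    using assms
  proof (induction k arbitrary: f)
    case (Suc k)
    obtain N where N: "N < E ^ k" "\<forall>i<k. N div E ^ i mod E = f (Suc i)"
      using Suc.IH[of "\<lambda>i. f (Suc i)"] Suc.prems by auto
    have f0: "f 0 < E" using Suc.prems by simp
    have d: "(f 0 + E * N) div E ^ Suc i = N div E ^ i" for i
      using f0 by (simp add: div_mult2_eq)
    have "f 0 + E * N < E * Suc N" using f0 by simp
    also have "\<dots> \<le> E * E ^ k" using N by (intro mult_left_mono) auto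
    finally have "f 0 + E * N < E ^ Suc k" by simp
    moreover have "(f 0 + E * N) div E ^ i mod E = f i" if "i < Suc k" for i
      using that d N f0 by (cases i) auto
    ultimately show ?case by blast
  qed simp
  then show ?thesis using that by blast
qed

section \<open>Guessing the big items\<close>

text \<open>In a proper colouring with the least number of colours every two colour classes are
  joined by an edge, since they could be merged otherwise. So \<open>k\<close> colours need at least
  \<open>k * (k - 1) / 2\<close> edges.\<close>

lemma colouring_few_edges:
  fixes e f :: "nat \<Rightarrow> nat"
  assumes "finite H" "finite J"
  obtains col :: "nat \<Rightarrow> nat" and k where "\<And>i. i \<in> H \<Longrightarrow> col i < k"
    "\<And>j. j \<in> J \<Longrightarrow> e j \<in> H \<Longrightarrow> f j \<in> H \<Longrightarrow> e j \<noteq> f j \<Longrightarrow> col (e j) \<noteq> col (f j)"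
    "k * (k - 1) \<le> 2 * card J"
proof -
  define P where "P k col \<longleftrightarrow> (\<forall>i\<in>H. col i < k) \<and>
      (\<forall>j\<in>J. e j \<in> H \<longrightarrow> f j \<in> H \<longrightarrow> e j \<noteq> f j \<longrightarrow> col (e j) \<noteq> col (f j))"
    for k :: nat and col :: "nat \<Rightarrow> nat"
  \<comment> \<open>Giving each element its own colour shows that a proper colouring exists at
    all.\<close>
  have "P (Suc (Max (insert 0 H))) id"
    using assms(1) by (auto simp: P_def less_Suc_eq_le)
  then have ex: "\<exists>k col. P k col" by blast
  define k where "k = (LEAST k. \<exists>col. P k col)"
  obtain col where col: "P k col" using LeastI_ex[OF ex] k_def by auto
  have least: "\<not> P k' col'" if "k' < k" for k' col'
    using not_less_Least[of k' "\<lambda>k. \<exists>col. P k col"] that k_def by blast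
  define E where "E = (\<lambda>j. {col (e j), col (f j)}) ` J"
  have "\<exists>j\<in>J. {col (e j), col (f j)} = {a, b}" if ab: "a < b" "b < k" for a b
  proof (rule ccontr)
    assume no: "\<not> (\<exists>j\<in>J. {col (e j), col (f j)} = {a, b})"
    \<comment> \<open>Colour \<open>b\<close> is merged into \<open>a\<close>, and the last colour
      moves into the gap \<open>b\<close>; for \<open>b = k - 1\<close> only the merging
      happens.\<close>
    define col' where "col' i = (if col i = b then a else if col i = k - 1 then b else col i)" for i
    have "P (k - 1) col'"
      unfolding P_def
    proof (intro conjI ballI impI)
      fix i assume "i \<in> H"
      then have "col i < k" using col by (simp add: P_def)
      then show "col' i < k - 1" using ab by (auto simp: col'_def)
    next
      fix j assume j: "j \<in> J" "e j \<in> H" "f j \<in> H" "e j \<noteq> f j"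
      then have ne: "col (e j) \<noteq> col (f j)" using col by (auto simp: P_def)
      have "{col (e j), col (f j)} \<noteq> {a, b}" using no j(1) by blast
      then have "\<not> (col (e j) = a \<and> col (f j) = b)" "\<not> (col (e j) = b \<and> col (f j) = a)" by auto
      then show "col' (e j) \<noteq> col' (f j)"
        using ne ab unfolding col'_def by (auto split: if_splits)
    qed
    then show False using least ab by (metis diff_less less_nat_zero_code not_gr_zero zero_less_one)
  qed
  then have "(\<lambda>(a, b). {a, b}) ` {(a, b). a < b \<and> b < k} \<subseteq> E"
    unfolding E_def by (auto simp: image_iff) metis
  then have "card ((\<lambda>(a, b). {a, b}) ` {(a, b). a < b \<and> b < k}) \<le> card E"
    using assms(2) by (intro card_mono) (auto simp: E_def)
  also have "card E \<le> card J" unfolding E_def using assms(2) by (rule card_image_le)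
  also have "card ((\<lambda>(a, b). {a, b}) ` {(a, b). a < b \<and> b < k}) = card {(a, b). a < b \<and> b < k}"
    by (intro card_image) (auto simp: inj_on_def doubleton_eq_iff)
  also have "{(a, b). a < b \<and> b < k} = (\<Union>b\<in>{..<k}. (\<lambda>a. (a, b)) ` {..<b})" by auto
  also have "card \<dots> = (\<Sum>b<k. card ((\<lambda>a. (a, b)) ` {..<b}))"
    by (intro card_UN_disjoint) auto
  also have "\<dots> = (\<Sum>b<k. b)" by (intro sum.cong) (auto simp: card_image inj_on_def)
  finally have "2 * (\<Sum>b<k. b) \<le> 2 * card J" by simp
  moreover have "2 * (\<Sum>b<k. b) = k * (k - 1)"
  proof (induction k)
    case (Suc k)
    then show ?case by (cases k) auto
  qed simp
  ultimately show ?thesis using that[of col k] col by (simp add: P_def)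
qed

lemma heaviest_colour_class:
  fixes p :: "nat \<Rightarrow> nat"
  assumes "finite H" "\<And>i. i \<in> H \<Longrightarrow> col i < (k :: nat)"
  obtains a where "sum p H \<le> k * sum p {i \<in> H. col i = a}"
proof (cases "k = 0")
  case True
  then have "H = {}" using assms(2) by auto
  then show ?thesis using that by simp
next
  case False
  have "finite {..<k}" "{..<k} \<noteq> {}" using False by auto
  then obtain a where a: "\<forall>b<k. sum p {i \<in> H. col i = b} \<le> sum p {i \<in> H. col i = a}"
    using ex_maximizer[of "{..<k}" "\<lambda>b. sum p {i \<in> H. col i = b}"] by auto
  have "sum p H = (\<Sum>b<k. sum p {i \<in> H. col i = b})"
    using assms by (intro sum.group[symmetric]) auto
  also have "\<dots> \<le> (\<Sum>b<k. sum p {i \<in> H. col i = a})" using a by (intro sum_mono) auto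
  finally show ?thesis using that by simp
qed

context packing begin

text \<open>Four items above a quarter would overfill a dimension. Counting with
  \<open>Suc (B j)\<close> instead of \<open>B j\<close> keeps the inequality strict and the divisor
  positive even for budget 0.\<close>

lemma big_items_card:
  assumes "feasible S"
  shows "card {i\<in>S. \<exists>j\<in>{1..d}. 4 * c i j > B j} \<le> 3 * d"
proof -
  have finS: "finite S" using assms feasible_finite by blast
  have "card {i\<in>S. 4 * c i j > B j} \<le> 3" if j: "j \<in> {1..d}" for j
  proof -
    let ?T = "{i\<in>S. 4 * c i j > B j}"
    have "card ?T * Suc (B j) \<le> (\<Sum>i\<in>?T. 4 * c i j)"
      using sum_bounded_below[of ?T "Suc (B j)" "\<lambda>i. 4 * c i j"] by auto
    also have "\<dots> \<le> (\<Sum>i\<in>S. 4 * c i j)" using finS by (intro sum_mono2) auto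
    also have "\<dots> = 4 * load S j" by (simp add: load_def sum_distrib_left)
    also have "\<dots> \<le> 4 * B j" using assms j by (simp add: feasible_def)
    finally have "card ?T * Suc (B j) < 4 * Suc (B j)" by simp
    then have "card ?T < 4" by (simp only: mult_less_cancel2)
    then show ?thesis by simp
  qed
  then have "(\<Sum>j\<in>{1..d}. card {i\<in>S. 4 * c i j > B j}) \<le> (\<Sum>j\<in>{1..d}. 3)" by (rule sum_mono)
  moreover have "{i\<in>S. \<exists>j\<in>{1..d}. 4 * c i j > B j} = (\<Union>j\<in>{1..d}. {i\<in>S. 4 * c i j > B j})" by auto
  ultimately show ?thesis
    using card_UN_le[of "{1..d}" "\<lambda>j. {i\<in>S. 4 * c i j > B j}"] by simp
qed

text \<open>Slot \<open>k\<close> and dimension \<open>j\<close> own digit number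
  \<open>k * d + (j - 1)\<close> of \<open>N\<close>, so the program can consume the digits round by
  round, in each round by increasing dimension.\<close>

definition guess :: "nat \<Rightarrow> nat \<Rightarrow> nat \<Rightarrow> nat \<Rightarrow> nat \<Rightarrow> nat" where
  "guess q n N k j = threshold q n (B j) (N div (2 * n) ^ (k * d + (j - 1)) mod (2 * n))"

text \<open>Each dimension contributes at most one conflicting pair. A colour class contains no such
  pair, so its rounded costs fit, and the guess that spells out these costs recovers half of its
  profit: \<open>8 * s\<close> is 2 times the number \<open>4 * s\<close> of colours.\<close>

lemma greedy_big_items:
  assumes H: "feasible H" "card H \<le> 3 * d"
    and W: "\<And>j. j \<in> {1..d} \<Longrightarrow> B j \<le> grid q n" and q: "q = 6 * d + 1"
    and s: "s \<ge> 1" "d < (s + 1) * (s + 1)"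
  obtains N where "N < (2 * Suc n) ^ (3 * d * d)"
    "\<And>C. greedy p (\<lambda>k. cand (guess q (Suc n) N k) (\<lambda>_. True)) (\<lambda>_ _. 1) m C \<Longrightarrow>
       sum p H \<le> 8 * s * sum p C"
proof -
  let ?E = "2 * Suc n"
  have finH: "finite H" using H feasible_finite by blast
  have q0: "q > 0" using q by simp
  have cB: "c i j \<le> B j" if "i \<in> H" "j \<in> {1..d}" for i j
    using feasible_subset[OF H(1), of "{i}"] that by (simp add: feasible_def load_def)
  have "\<exists>\<delta>. \<delta> < ?E \<and> c i j \<le> threshold q (Suc n) (B j) \<delta> \<and>
      q * (threshold q (Suc n) (B j) \<delta> - c i j) \<le> c i j \<and>
      q * (threshold q (Suc n) (B j) \<delta> - c i j) \<le> B j - c i j"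
    if "i \<in> H" "j \<in> {1..d}" for i j
    using threshold_exists[OF cB[OF that] W[OF that(2)] q0] by metis
  then obtain \<delta> where \<delta>: "\<And>i j. i \<in> H \<Longrightarrow> j \<in> {1..d} \<Longrightarrow> \<delta> i j < ?E \<and>
      c i j \<le> threshold q (Suc n) (B j) (\<delta> i j) \<and>
      q * (threshold q (Suc n) (B j) (\<delta> i j) - c i j) \<le> c i j \<and>
      q * (threshold q (Suc n) (B j) (\<delta> i j) - c i j) \<le> B j - c i j"
    by metis
  define u where "u i j = threshold q (Suc n) (B j) (\<delta> i j)" for i j
  \<comment> \<open>Pairs not inside \<open>H\<close> are allowed for the empty \<open>H\<close>,
    which has no most expensive item.\<close>
  have "\<exists>e f. \<forall>K. K \<subseteq> H \<longrightarrow> (e = f \<or> \<not> (e \<in> H \<and> f \<in> H) \<or> e \<notin> K \<or> f \<notin> K) \<longrightarrow>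
      (\<Sum>i\<in>K. u i j) \<le> B j" if j: "j \<in> {1..d}" for j
  proof (cases "H = {}")
    case False
    have \<delta>': "c i j \<le> u i j" "q * (u i j - c i j) \<le> c i j" "q * (u i j - c i j) \<le> B j - c i j"
      if "i \<in> H" for i
      using \<delta>[OF that j] by (simp_all add: u_def)
    have le: "sum (\<lambda>i. c i j) H \<le> B j" using H j by (simp add: feasible_def load_def)
    have q': "2 * (3 * d) + 1 \<le> q" using q by simp
    show ?thesis
    proof (rule rounding_pair[OF finH H(2) le False q' \<delta>'])
      fix e f
      assume "\<And>K. K \<subseteq> H \<Longrightarrow> e = f \<or> e \<notin> K \<or> f \<notin> K \<Longrightarrow> (\<Sum>i\<in>K. u i j) \<le> B j"
        and "e \<in> H" "f \<in> H"
      then show ?thesis by (intro exI[of _ e] exI[of _ f]) simp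
    qed
  qed auto
  then obtain e f where ef: "\<And>j K. j \<in> {1..d} \<Longrightarrow> K \<subseteq> H \<Longrightarrow>
      e j = f j \<or> \<not> (e j \<in> H \<and> f j \<in> H) \<or> e j \<notin> K \<or> f j \<notin> K \<Longrightarrow> (\<Sum>i\<in>K. u i j) \<le> B j"
    by metis
  obtain col :: "nat \<Rightarrow> nat" and k where col: "\<And>i. i \<in> H \<Longrightarrow> col i < k"
    "\<And>j. j \<in> {1..d} \<Longrightarrow> e j \<in> H \<Longrightarrow> f j \<in> H \<Longrightarrow> e j \<noteq> f j \<Longrightarrow> col (e j) \<noteq> col (f j)"
    "k * (k - 1) \<le> 2 * card {1..d}"
    using colouring_few_edges[OF finH finite_atLeastAtMost, of 1 d e f] by blast
  \<comment> \<open>With at most \<open>d\<close> edges, \<open>k * (k - 1)\<close> is at most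
    \<open>2 * d < 2 * (s + 1) * (s + 1)\<close>; the cap \<open>4 * s\<close> is generous enough to
    hold from \<open>s = 1\<close> on.\<close>
  have k: "k \<le> 4 * s"
  proof (rule ccontr)
    assume "\<not> k \<le> 4 * s"
    then have "(4 * s + 1) * (4 * s) \<le> k * (k - 1)" by (intro mult_mono) auto
    also have "\<dots> \<le> 2 * d" using col(3) by simp
    also have "\<dots> < 2 * ((s + 1) * (s + 1))" using s(2) by simp
    finally have "16 * (s * s) < 2 * (s * s) + 2" by (simp add: algebra_simps)
    moreover have "1 \<le> s * s" using s(1) by (metis mult_le_mono nat_mult_1)
    ultimately show False by linarith
  qed
  obtain a where a: "sum p H \<le> k * sum p {i \<in> H. col i = a}"
    by (rule heaviest_colour_class[OF finH, of col k p]) (use col(1) in auto)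
  define K where "K = {i \<in> H. col i = a}"
  have K: "K \<subseteq> H" "finite K" using finH by (auto simp: K_def)
  have uK: "(\<Sum>i\<in>K. u i j) \<le> B j" if "j \<in> {1..d}" for j
    using ef[OF that K(1)] col(2)[OF that] by (auto simp: K_def)
  obtain xs where xs: "set xs = K" "distinct xs" using K(2) finite_distinct_list by blast
  have len: "length xs \<le> 3 * d"
    using H(2) card_mono[OF finH K(1)] xs by (simp add: distinct_card[symmetric])
  \<comment> \<open>Slots beyond the colour class get digit 0, which restricts nothing.\<close>
  define f where "f r = (if r div d < length xs then \<delta> (xs ! (r div d)) (Suc (r mod d)) else 0)" for r
  have "f r < ?E" if "r < 3 * d * d" for r
  proof (cases "r div d < length xs")
    case True
    then have "xs ! (r div d) \<in> H" using xs(1) K(1) nth_mem by blast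
    moreover have "d > 0" using that by (cases d) auto
    then have "Suc (r mod d) \<in> {1..d}" by (simp add: Suc_leI)
    ultimately show ?thesis using \<delta> True by (simp add: f_def)
  qed (simp add: f_def)
  then obtain N where N: "N < ?E ^ (3 * d * d)" "\<And>r. r < 3 * d * d \<Longrightarrow> N div ?E ^ r mod ?E = f r"
    using digits_exist[of "3 * d * d" f ?E] by blast
  have g: "guess q (Suc n) N l j = u (xs ! l) j" if "l < length xs" "j \<in> {1..d}" for l j
  proof -
    have d: "d > 0" "j - 1 < d" "j \<ge> 1" using that(2) by auto
    have "l * d + (j - 1) < Suc l * d" using d by simp
    also have "\<dots> \<le> 3 * d * d" using that(1) len by (intro mult_right_mono) auto
    finally have "N div ?E ^ (l * d + (j - 1)) mod ?E = f (l * d + (j - 1))" using N(2) by blast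
    also have "\<dots> = \<delta> (xs ! l) j"
    proof -
      obtain j' where "j = Suc j'" using d(3) by (cases j) auto
      then show ?thesis using that d by (simp add: f_def)
    qed
    finally show ?thesis by (simp add: guess_def u_def)
  qed
  have "sum p H \<le> 8 * s * sum p C"
    if gr: "greedy p (\<lambda>k. cand (guess q (Suc n) N k) (\<lambda>_. True)) (\<lambda>_ _. 1) m C" for C
  proof -
    have "sum p (set xs) \<le> 2 * sum p C"
    proof (rule greedy_guessed[OF gr xs(2)])
      show "set xs \<subseteq> {..<m}" using xs(1) K(1) H(1) by (auto simp: feasible_def)
      show "c (xs ! l) j \<le> guess q (Suc n) N l j" if "l < length xs" "j \<in> {1..d}" for l j
      proof -
        have "xs ! l \<in> H" using that(1) xs(1) K(1) nth_mem by blast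
        then show ?thesis using g[OF that] \<delta> that(2) by (simp add: u_def)
      qed
      show "(\<Sum>l<length xs. guess q (Suc n) N l j) \<le> B j" if j: "j \<in> {1..d}" for j
      proof -
        have "(\<Sum>l<length xs. guess q (Suc n) N l j) = (\<Sum>l<length xs. u (xs ! l) j)"
          using g j by (intro sum.cong) auto
        also have "\<dots> = (\<Sum>i\<in>K. u i j)"
          using sum.reindex_bij_betw[OF bij_betw_nth[OF xs(2) refl refl], of "\<lambda>i. u i j"] xs(1) by simp
        finally show ?thesis using uK[OF j] by simp
      qed
    qed
    then have "sum p H \<le> k * (2 * sum p C)"
      using a xs(1) by (metis K_def le_trans mult_le_mono2)
    also have "\<dots> \<le> (4 * s) * (2 * sum p C)" using k by (rule mult_right_mono) simp
    finally show ?thesis by simp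
  qed
  then show ?thesis using that N(1) by blast
qed

text \<open>The 25 is \<open>16 * s + 1 <= 17 * s\<close> for the small items plus
  \<open>8 * s\<close> for the big ones; both parts are compared with the same best profit.\<close>

lemma approximation_large_budgets:
  assumes S: "feasible S"
    and W: "\<And>j. j \<in> {1..d} \<Longrightarrow> B j \<le> grid q n" and q: "q = 6 * d + 1"
    and s: "s \<ge> 1" "d < (s + 1) * (s + 1)"
    and density: "greedy p (\<lambda>_. cand (\<lambda>j. B j div 4) (\<lambda>_. True)) (weight s) m C" "sum p C \<le> best"
    and guesses: "\<And>N. N < (2 * Suc n) ^ (3 * d * d) \<Longrightarrow>
      \<exists>C. greedy p (\<lambda>k. cand (guess q (Suc n) N k) (\<lambda>_. True)) (\<lambda>_ _. 1) m C \<and> sum p C \<le> best"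
  shows "sum p S \<le> 25 * s * best"
proof -
  let ?H = "{i\<in>S. \<exists>j\<in>{1..d}. 4 * c i j > B j}"
  have finS: "finite S" using S feasible_finite by blast
  have ss: "1 \<le> s * s" "s \<le> s * s" using s(1) by (auto intro: Suc_leI)
  have "(s + 1) * (s + 1) = s * s + 2 * s + 1" by simp
  then have "d \<le> 3 * (s * s)" using s(2) ss by linarith
  then have 1: "sum p (S - ?H) \<le> (16 * s + 1) * sum p C"
    using S by (intro greedy_small_items[OF s(1) _ density(1)] feasible_subset[OF S]) (auto simp: not_less)
  have "(16 * s + 1) * sum p C \<le> (16 * s + 1) * best" using density(2) by (rule mult_left_mono) simp
  moreover have "(16 * s + 1) * best \<le> 17 * s * best" using s(1) by (intro mult_right_mono) auto
  moreover have "sum p ?H \<le> 8 * s * best"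
  proof -
    have fH: "feasible ?H" by (rule feasible_subset[OF S]) auto
    obtain N where N: "N < (2 * Suc n) ^ (3 * d * d)"
      "\<And>C. greedy p (\<lambda>k. cand (guess q (Suc n) N k) (\<lambda>_. True)) (\<lambda>_ _. 1) m C \<Longrightarrow>
         sum p ?H \<le> 8 * s * sum p C"
      using greedy_big_items[OF fH big_items_card[OF S] W q s] by blast
    obtain C' where "sum p ?H \<le> 8 * s * sum p C'" "sum p C' \<le> best"
      using guesses[OF N(1)] N(2) by blast
    then show ?thesis by (meson le_trans mult_le_mono2)
  qed
  moreover have "sum p S = sum p (S - ?H) + sum p ?H"
    using finS by (intro sum.subset_diff) auto
  ultimately show ?thesis using 1 by linarith
qed

text \<open>With budgets 0 and 1 at most \<open>s\<close> disjoint items can have more than \<open>s\<close> unit costs.\<close>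

lemma approximation_unit_budgets:
  assumes S: "feasible S" and B: "\<And>j. j \<in> {1..d} \<Longrightarrow> B j \<le> 1"
    and s: "s \<ge> 1" "d < (s + 1) * (s + 1)"
    and density: "greedy p (\<lambda>_. cand B (\<lambda>i. (\<Sum>j\<in>{1..d}. c i j) \<le> s)) (weight s) m C" "sum p C \<le> best"
    and guesses: "greedy p (\<lambda>k. cand (guess q n 0 k) (\<lambda>_. True)) (\<lambda>_ _. 1) m C'" "sum p C' \<le> best"
    and n: "n > 0"
  shows "sum p S \<le> 25 * s * best"
proof -
  let ?n = "\<lambda>i. \<Sum>j\<in>{1..d}. c i j"
  let ?H = "{i\<in>S. ?n i > s}"
  have finS: "finite S" using S feasible_finite by blast
  have 1: "sum p (S - ?H) \<le> (s + 1) * sum p C"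
    by (intro greedy_set_packing[OF B density(1)] feasible_subset[OF S]) auto
  have "(s + 1) * sum p C \<le> (s + 1) * best" using density(2) by (rule mult_left_mono) simp
  moreover have "(s + 1) * best \<le> 2 * s * best" using s(1) by (intro mult_right_mono) auto
  moreover have "sum p ?H \<le> s * (2 * best)"
  proof -
    have "card ?H * (s + 1) \<le> (\<Sum>i\<in>?H. ?n i)"
      using sum_bounded_below[of ?H "s + 1" ?n] by auto
    also have "\<dots> \<le> (\<Sum>i\<in>S. ?n i)" using finS by (intro sum_mono2) auto
    also have "\<dots> = (\<Sum>j\<in>{1..d}. load S j)" unfolding load_def by (rule sum.swap)
    also have "\<dots> \<le> (\<Sum>j\<in>{1..d}. 1)"
      using S B by (intro sum_mono) (meson feasible_def order_trans)
    finally have "card ?H * (s + 1) < (s + 1) * (s + 1)" using s(2) by simp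
    then have "card ?H \<le> s" by (simp only: mult_less_cancel2) simp
    \<comment> \<open>In guess 0 all digits vanish, so the thresholds are the full budgets and the
      run applies to the one-element list \<open>[i]\<close>.\<close>
    moreover have "p i \<le> 2 * best" if i: "i \<in> ?H" for i
    proof -
      have fi: "feasible {i}" by (rule feasible_subset[OF S]) (use i in auto)
      have "sum p (set [i]) \<le> 2 * sum p C'"
        using guesses(1) by (rule greedy_guessed)
          (use fi n in \<open>auto simp: guess_def threshold_def feasible_def load_def\<close>)
      then show ?thesis using guesses(2) by simp
    qed
    then have "sum p ?H \<le> card ?H * (2 * best)" using sum_bounded_above[of ?H p "2 * best"] by simp
    ultimately show ?thesis by (meson le_trans mult_le_mono1)
  qed
  moreover have "sum p S = sum p (S - ?H) + sum p ?H"
    using finS by (intro sum.subset_diff) auto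
  ultimately have "sum p S \<le> 2 * s * best + s * (2 * best)" using 1 by linarith
  also have "\<dots> = 4 * s * best" by simp
  also have "\<dots> \<le> 25 * s * best" by (intro mult_right_mono) auto
  finally show ?thesis .
qed

end

section \<open>Counting the steps of programs\<close>

text \<open>Length of the value in units of \<open>\<beta>\<close> bits, when memory cells and
  constants have at most \<open>\<beta>\<close> bits; reading a cell brings the length back to one
  unit.\<close>

fun width :: "expr \<Rightarrow> nat" where
  "width (Const k) = 1"
| "width (Read a e) = 1"
| "width (Add e f) = width e + width f"
| "width (Sub e f) = width e + width f"
| "width (Mul e f) = width e + width f"
| "width (Div e f) = width e + width f"

text \<open>Bounds evaluation time plus the size of the value, in units of \<open>\<beta>\<close>.
  Including the size makes the induction go through, and this sum is what conditions and assignments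
  are charged.\<close>

fun expr_cost :: "expr \<Rightarrow> nat" where
  "expr_cost (Const k) = 4"
| "expr_cost (Read a e) = expr_cost e + 4"
| "expr_cost (Add e f) = expr_cost e + expr_cost f + width e + width f + 1"
| "expr_cost (Sub e f) = expr_cost e + expr_cost f + width e + width f + 1"
| "expr_cost (Mul e f) = expr_cost e + expr_cost f + width e + width f + 1"
| "expr_cost (Div e f) = expr_cost e + expr_cost f + width e + width f + 1"

fun consts_below :: "nat \<Rightarrow> expr \<Rightarrow> bool" where
  "consts_below b (Const k) \<longleftrightarrow> k < b"
| "consts_below b (Read a e) \<longleftrightarrow> consts_below b e"
| "consts_below b (Add e f) \<longleftrightarrow> consts_below b e \<and> consts_below b f"
| "consts_below b (Sub e f) \<longleftrightarrow> consts_below b e \<and> consts_below b f"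
| "consts_below b (Mul e f) \<longleftrightarrow> consts_below b e \<and> consts_below b f"
| "consts_below b (Div e f) \<longleftrightarrow> consts_below b e \<and> consts_below b f"

fun prog_ok :: "nat \<Rightarrow> nat \<Rightarrow> program \<Rightarrow> bool" where
  "prog_ok b \<kappa> Skip \<longleftrightarrow> True"
| "prog_ok b \<kappa> (Write a e f) \<longleftrightarrow>
     expr_cost e + expr_cost f \<le> \<kappa> \<and> consts_below b e \<and> consts_below b f"
| "prog_ok b \<kappa> (Seq P Q) \<longleftrightarrow> prog_ok b \<kappa> P \<and> prog_ok b \<kappa> Q"
| "prog_ok b \<kappa> (If e P Q) \<longleftrightarrow> expr_cost e \<le> \<kappa> \<and> consts_below b e \<and> prog_ok b \<kappa> P \<and> prog_ok b \<kappa> Q"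
| "prog_ok b \<kappa> (While e P) \<longleftrightarrow> expr_cost e \<le> \<kappa> \<and> consts_below b e \<and> prog_ok b \<kappa> P"

definition bounded :: "nat \<Rightarrow> memory \<Rightarrow> bool" where
  "bounded b s \<longleftrightarrow> (\<forall>a k. s a k < b)"

lemma width_pos: "width e \<ge> 1"
  by (induction e) auto

lemma pow_add_le:
  assumes "x < (2::nat) ^ a" "y < 2 ^ b" "a \<ge> 1" "b \<ge> 1"
  shows "x + y < 2 ^ (a + b)"
proof -
  have "2 ^ a * 1 \<le> (2::nat) ^ a * 2 ^ (b - 1)" "2 ^ b * 1 \<le> (2::nat) ^ b * 2 ^ (a - 1)"
    by (intro mult_left_mono; simp)+
  moreover have "(2::nat) ^ a * 2 ^ (b - 1) + 2 ^ b * 2 ^ (a - 1) = 2 ^ (a + b)"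
    using assms(3,4) by (cases a; cases b) (auto simp: power_add)
  ultimately show ?thesis using assms(1,2) by linarith
qed

lemma eval_bound:
  assumes "bounded (2 ^ \<beta>) s" "consts_below (2 ^ \<beta>) e" "\<beta> \<ge> 1"
  shows "eval_expr e s < 2 ^ (\<beta> * width e)"
  using assms(2)
proof (induction e)
  case (Add e f)
  then show ?case
    using pow_add_le[of _ "\<beta> * width e" _ "\<beta> * width f"] width_pos[of e] width_pos[of f] assms(3)
    by (simp add: distrib_left)
next
  case (Sub e f)
  have "(2::nat) ^ (\<beta> * width e) \<le> 2 ^ (\<beta> * width (Sub e f))" by (intro power_increasing) auto
  moreover have "eval_expr (Sub e f) s \<le> eval_expr e s" by simp
  moreover have "eval_expr e s < 2 ^ (\<beta> * width e)" using Sub by simp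
  ultimately show ?case by linarith
next
  case (Mul e f)
  then show ?case by (simp add: distrib_left power_add mult_strict_mono)
next
  case (Div e f)
  have "(2::nat) ^ (\<beta> * width e) \<le> 2 ^ (\<beta> * width (Div e f))" by (intro power_increasing) auto
  moreover have "eval_expr (Div e f) s \<le> eval_expr e s" by simp
  moreover have "eval_expr e s < 2 ^ (\<beta> * width e)" using Div by simp
  ultimately show ?case by linarith
qed (use assms(1) in \<open>auto simp: bounded_def\<close>)

lemma size_nat_le: "x < 2 ^ n \<Longrightarrow> size_nat x \<le> n + 1"
  unfolding size_nat_def using floorlog_leI[of x 2 n] by simp

lemma time_bound:
  assumes "bounded (2 ^ \<beta>) s" "consts_below (2 ^ \<beta>) e" "\<beta> \<ge> 1"
  shows "time_expr e s + size_nat (eval_expr e s) \<le> expr_cost e * \<beta>"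
proof -
  have size: "size_nat (eval_expr e s) \<le> (width e + 1) * \<beta>" if "consts_below (2 ^ \<beta>) e" for e
    using size_nat_le[OF eval_bound[OF assms(1) that assms(3)]] assms(3) by (simp add: algebra_simps)
  show ?thesis using assms(2)
  proof (induction e)
    case (Const k)
    then show ?case using size[of "Const k"] by simp
  next
    case (Read a e)
    then show ?case using size[of "Read a e"] by (simp add: algebra_simps)
  next
    case (Add e f)
    then show ?case using size[of "Add e f"] by (simp add: algebra_simps)
  next
    case (Sub e f)
    then show ?case using size[of "Sub e f"] by (simp add: algebra_simps)
  next
    case (Mul e f)
    then show ?case using size[of "Mul e f"] by (simp add: algebra_simps)
  next
    case (Div e f)
    then show ?case using size[of "Div e f"] by (simp add: algebra_simps)
  qed
qed

lemma time_bound_le: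
  assumes "bounded (2 ^ \<beta>) s" "consts_below (2 ^ \<beta>) e" "\<beta> \<ge> 1" "expr_cost e \<le> \<kappa>"
  shows "time_expr e s + size_nat (eval_expr e s) \<le> \<kappa> * \<beta>"
  using time_bound[OF assms(1-3)] mult_right_mono[OF assms(4), of \<beta>] by linarith

text \<open>Unit-cost execution in which all stored values stay below \<open>b\<close>. For \<open>b = 2 ^ \<beta>\<close> each
  unit costs \<open>O(\<beta>)\<close> in the logarithmic cost model.\<close>

inductive steps :: "nat \<Rightarrow> program \<Rightarrow> memory \<Rightarrow> nat \<Rightarrow> memory \<Rightarrow> bool" for b where
  steps_Skip: "steps b Skip s 1 s"
| steps_Write: "eval_expr f s < b \<Longrightarrow>
     steps b (Write a e f) s 1 (s(a := (s a)(eval_expr e s := eval_expr f s)))"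
| steps_Seq: "steps b P s n s' \<Longrightarrow> steps b Q s' n' s'' \<Longrightarrow> steps b (Seq P Q) s (n + n') s''"
| steps_IfTrue: "eval_expr e s \<noteq> 0 \<Longrightarrow> steps b P s n s' \<Longrightarrow> steps b (If e P Q) s (1 + n) s'"
| steps_IfFalse: "eval_expr e s = 0 \<Longrightarrow> steps b Q s n s' \<Longrightarrow> steps b (If e P Q) s (1 + n) s'"
| steps_WhileFalse: "eval_expr e s = 0 \<Longrightarrow> steps b (While e P) s 1 s"
| steps_WhileTrue: "eval_expr e s \<noteq> 0 \<Longrightarrow> steps b P s n s' \<Longrightarrow> steps b (While e P) s' n' s'' \<Longrightarrow>
     steps b (While e P) s (1 + n + n') s''"

inductive_cases steps_SkipE: "steps b Skip s n s'"
  and steps_WriteE: "steps b (Write a e f) s n s'"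
  and steps_SeqE: "steps b (Seq P Q) s n s'"
  and steps_IfE: "steps b (If e P Q) s n s'"

text \<open>Only stored values have to stay below \<open>2 ^ \<beta>\<close>; intermediate results
  may be longer, but \<open>width\<close> bounds them by the shape of the fixed expressions.\<close>

lemma steps_exec:
  assumes "steps (2 ^ \<beta>) P s n s'" "bounded (2 ^ \<beta>) s" "prog_ok (2 ^ \<beta>) \<kappa> P" "\<beta> \<ge> 1" "\<kappa> \<ge> 1"
  shows "bounded (2 ^ \<beta>) s' \<and> (\<exists>t. exec P s t s' \<and> t \<le> n * (\<kappa> * \<beta>))"
  using assms(1-3)
proof (induction rule: steps.induct)
  case (steps_Skip s)
  then show ?case using exec.Skip[of s] assms(4,5) by force
next
  case (steps_Write f s a e)
  have "expr_cost e * \<beta> + expr_cost f * \<beta> \<le> \<kappa> * \<beta>"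
    using steps_Write by (simp flip: distrib_right)
  then have "time_expr e s + time_expr f s + size_nat (eval_expr e s) + size_nat (eval_expr f s) \<le> 1 * (\<kappa> * \<beta>)"
    using time_bound[of \<beta> s e] time_bound[of \<beta> s f] steps_Write assms(4) by simp
  moreover have "bounded (2 ^ \<beta>) (s(a := (s a)(eval_expr e s := eval_expr f s)))"
    using steps_Write by (simp add: bounded_def)
  ultimately show ?case using exec.Write[of a e f s] by blast
next
  case (steps_Seq P s n s' Q n' s'')
  then obtain t u where tu: "exec P s t s'" "t \<le> n * (\<kappa> * \<beta>)" "exec Q s' u s''" "u \<le> n' * (\<kappa> * \<beta>)"
    by auto
  have "t + u \<le> (n + n') * (\<kappa> * \<beta>)" using tu by (simp add: distrib_right)
  then show ?case using exec.Seq[OF tu(1,3)] steps_Seq by auto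
next
  case (steps_IfTrue e s P n s' Q)
  then obtain t where t: "exec P s t s'" "t \<le> n * (\<kappa> * \<beta>)" by auto
  have "time_expr e s + size_nat (eval_expr e s) + t \<le> (1 + n) * (\<kappa> * \<beta>)"
    using time_bound_le[of \<beta> s e \<kappa>] steps_IfTrue assms(4) t(2) by (simp add: distrib_right)
  then show ?case using exec.IfTrue[OF steps_IfTrue.hyps(1) t(1), of Q] steps_IfTrue by auto
next
  case (steps_IfFalse e s Q n s' P)
  then obtain t where t: "exec Q s t s'" "t \<le> n * (\<kappa> * \<beta>)" by auto
  have "time_expr e s + size_nat (eval_expr e s) + t \<le> (1 + n) * (\<kappa> * \<beta>)"
    using time_bound_le[of \<beta> s e \<kappa>] steps_IfFalse assms(4) t(2) by (simp add: distrib_right)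
  then show ?case using exec.IfFalse[OF steps_IfFalse.hyps(1) t(1), of P] steps_IfFalse by auto
next
  case (steps_WhileFalse e s P)
  have "time_expr e s + size_nat (eval_expr e s) \<le> 1 * (\<kappa> * \<beta>)"
    using time_bound_le[of \<beta> s e \<kappa>] steps_WhileFalse assms(4) by simp
  then show ?case using exec.WhileFalse[OF steps_WhileFalse.hyps(1), of P] steps_WhileFalse by auto
next
  case (steps_WhileTrue e s P n s' n' s'')
  then obtain t u where tu: "exec P s t s'" "t \<le> n * (\<kappa> * \<beta>)"
    "exec (While e P) s' u s''" "u \<le> n' * (\<kappa> * \<beta>)"
    by auto
  have "time_expr e s + size_nat (eval_expr e s) + t + u \<le> (1 + n + n') * (\<kappa> * \<beta>)"
    using time_bound_le[of \<beta> s e \<kappa>] steps_WhileTrue assms(4) tu by (simp add: distrib_right)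
  then show ?case using exec.WhileTrue[OF steps_WhileTrue.hyps(1) tu(1,3)] steps_WhileTrue by auto
qed

text \<open>Recorded per array, not per cell. Each register is cell 0 of an array of its own, so
  what a program leaves untouched can be read off its syntax.\<close>

fun writes :: "program \<Rightarrow> nat set" where
  "writes Skip = {}"
| "writes (Write a e f) = {a}"
| "writes (Seq P Q) = writes P \<union> writes Q"
| "writes (If e P Q) = writes P \<union> writes Q"
| "writes (While e P) = writes P"

lemma steps_frame: "steps b P s n s' \<Longrightarrow> a \<notin> writes P \<Longrightarrow> s' a = s a"
  by (induction rule: steps.induct) auto

section \<open>A calculus for total correctness with step bounds and built-in frame
  conditions\<close>

definition runs :: "nat \<Rightarrow> program \<Rightarrow> memory \<Rightarrow> nat \<Rightarrow> (memory \<Rightarrow> bool) \<Rightarrow> bool" where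
  "runs b P s n Q \<longleftrightarrow> (\<exists>k s'. steps b P s k s' \<and> k \<le> n \<and> Q s')"

lemma runs_weaken:
  assumes "runs b P s n Q" "n \<le> n'"
    and "\<And>s'. Q s' \<Longrightarrow> (\<And>a. a \<notin> writes P \<Longrightarrow> s' a = s a) \<Longrightarrow> Q' s'"
  shows "runs b P s n' Q'"
proof -
  obtain k s' where k: "steps b P s k s'" "k \<le> n" "Q s'" using assms(1) by (auto simp: runs_def)
  have "Q' s'" using assms(3)[OF k(3)] steps_frame[OF k(1)] by blast
  moreover have "k \<le> n'" using k(2) assms(2) by simp
  ultimately show ?thesis using k(1) by (auto simp: runs_def)
qed

lemma runs_Skip [simp]: "runs b Skip s n Q \<longleftrightarrow> 1 \<le> n \<and> Q s"
  unfolding runs_def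
  by (auto elim!: steps_SkipE intro: exI[of _ 1] exI[of _ s] steps.steps_Skip[of b s, simplified])

lemma runs_Write [simp]: "runs b (Write a e f) s n Q \<longleftrightarrow>
    1 \<le> n \<and> eval_expr f s < b \<and> Q (s(a := (s a)(eval_expr e s := eval_expr f s)))"
proof
  assume "runs b (Write a e f) s n Q"
  then show "1 \<le> n \<and> eval_expr f s < b \<and> Q (s(a := (s a)(eval_expr e s := eval_expr f s)))"
    by (auto elim!: steps_WriteE simp: runs_def)
next
  assume a: "1 \<le> n \<and> eval_expr f s < b \<and> Q (s(a := (s a)(eval_expr e s := eval_expr f s)))"
  then show "runs b (Write a e f) s n Q" unfolding runs_def
    using steps.steps_Write[of f s b a e] by blast
qed

lemma runs_If [simp]: "runs b (If e P Q) s n R \<longleftrightarrow>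
    1 \<le> n \<and> (if eval_expr e s \<noteq> 0 then runs b P s (n - 1) R else runs b Q s (n - 1) R)"
proof
  assume "runs b (If e P Q) s n R"
  then obtain k s' where "steps b (If e P Q) s k s'" "k \<le> n" "R s'" by (auto simp: runs_def)
  then show "1 \<le> n \<and> (if eval_expr e s \<noteq> 0 then runs b P s (n - 1) R else runs b Q s (n - 1) R)"
    by (auto elim!: steps_IfE simp: runs_def intro!: exI)
next
  assume a: "1 \<le> n \<and> (if eval_expr e s \<noteq> 0 then runs b P s (n - 1) R else runs b Q s (n - 1) R)"
  show "runs b (If e P Q) s n R"
  proof (cases "eval_expr e s = 0")
    case True
    then obtain k s' where "steps b Q s k s'" "k \<le> n - 1" "R s'" using a by (auto simp: runs_def)
    then show ?thesis using steps_IfFalse[OF True] a unfolding runs_def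
      by (intro exI[of _ "1 + k"] exI[of _ s']) auto
  next
    case False
    then obtain k s' where "steps b P s k s'" "k \<le> n - 1" "R s'" using a by (auto simp: runs_def)
    then show ?thesis using steps_IfTrue[OF False] a unfolding runs_def
      by (intro exI[of _ "1 + k"] exI[of _ s']) auto
  qed
qed

lemma runs_Seq:
  assumes "runs b P s n R" "\<And>s'. R s' \<Longrightarrow> (\<And>a. a \<notin> writes P \<Longrightarrow> s' a = s a) \<Longrightarrow> runs b Q s' n' Q'"
    and "n + n' \<le> l"
  shows "runs b (Seq P Q) s l Q'"
proof -
  obtain k s' where k: "steps b P s k s'" "k \<le> n" "R s'" using assms(1) by (auto simp: runs_def)
  have "runs b Q s' n' Q'" using assms(2)[OF k(3)] steps_frame[OF k(1)] by blast
  then obtain k' s'' where k': "steps b Q s' k' s''" "k' \<le> n'" "Q' s''" by (auto simp: runs_def)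
  show ?thesis unfolding runs_def
    using steps_Seq[OF k(1) k'(1)] k k' assms(3) by (intro exI[of _ "k + k'"] exI[of _ s'']) auto
qed

lemma runs_Seq_Write [simp]: "runs b (Seq (Write a e f) P) s n Q \<longleftrightarrow>
    1 \<le> n \<and> eval_expr f s < b \<and> runs b P (s(a := (s a)(eval_expr e s := eval_expr f s))) (n - 1) Q"
proof
  assume "runs b (Seq (Write a e f) P) s n Q"
  then obtain k s' where "steps b (Seq (Write a e f) P) s k s'" "k \<le> n" "Q s'" by (auto simp: runs_def)
  then show "1 \<le> n \<and> eval_expr f s < b \<and>
      runs b P (s(a := (s a)(eval_expr e s := eval_expr f s))) (n - 1) Q"
    by (auto elim!: steps_SeqE steps_WriteE simp: runs_def intro!: exI)
next
  assume "1 \<le> n \<and> eval_expr f s < b \<and> runs b P (s(a := (s a)(eval_expr e s := eval_expr f s))) (n - 1) Q"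
  then show "runs b (Seq (Write a e f) P) s n Q"
    by (intro runs_Seq[where n = 1 and n' = "n - 1"
          and R = "\<lambda>s'. s' = s(a := (s a)(eval_expr e s := eval_expr f s))"]) auto
qed

text \<open>Pushes the continuation into both branches, which saves stating what the branches have
  in common.\<close>

lemma runs_Seq_If:
  assumes "1 \<le> n" "eval_expr e s \<noteq> 0 \<Longrightarrow> runs b (Seq P R) s (n - 1) Q'"
    "eval_expr e s = 0 \<Longrightarrow> runs b (Seq Q R) s (n - 1) Q'"
  shows "runs b (Seq (If e P Q) R) s n Q'"
proof -
  have conv: "\<exists>k k' s' s''. steps b S s k s' \<and> steps b R s' k' s'' \<and> k + k' \<le> n - 1 \<and> Q' s''"
    if "runs b (Seq S R) s (n - 1) Q'" for S
    using that unfolding runs_def by (blast elim: steps_SeqE)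
  show ?thesis
  proof (cases "eval_expr e s = 0")
    case True
    then obtain k k' s' s'' where "steps b Q s k s'" "steps b R s' k' s''" "k + k' \<le> n - 1" "Q' s''"
      using conv assms(3) by blast
    then show ?thesis using steps_Seq[OF steps_IfFalse[OF True]] assms(1) unfolding runs_def
      by (intro exI[of _ "1 + k + k'"] exI[of _ s'']) auto
  next
    case False
    then obtain k k' s' s'' where "steps b P s k s'" "steps b R s' k' s''" "k + k' \<le> n - 1" "Q' s''"
      using conv assms(2) by blast
    then show ?thesis using steps_Seq[OF steps_IfTrue[OF False]] assms(1) unfolding runs_def
      by (intro exI[of _ "1 + k + k'"] exI[of _ s'']) auto
  qed
qed

lemma runs_While:
  assumes "I l s" "l \<le> N"
    and body: "\<And>i s'. l \<le> i \<Longrightarrow> i < N \<Longrightarrow> I i s' \<Longrightarrow> (\<And>a. a \<notin> writes P \<Longrightarrow> s' a = s a) \<Longrightarrow>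
      eval_expr e s' \<noteq> 0 \<and> runs b P s' T (I (Suc i))"
    and exit: "\<And>s'. I N s' \<Longrightarrow> (\<And>a. a \<notin> writes P \<Longrightarrow> s' a = s a) \<Longrightarrow> eval_expr e s' = 0 \<and> Q s'"
    and n: "(N - l) * (T + 1) + 1 \<le> n"
  shows "runs b (While e P) s n Q"
proof -
  have "runs b (While e P) s' ((N - i) * (T + 1) + 1) Q"
    if "I i s'" "l \<le> i" "i \<le> N" "\<And>a. a \<notin> writes P \<Longrightarrow> s' a = s a" for i s'
    using that
  proof (induction "N - i" arbitrary: i s')
    case 0
    then have "i = N" by simp
    then have "eval_expr e s' = 0" "Q s'" using exit[of s'] 0 by auto
    then show ?case using steps_WhileFalse[of e s' b P] unfolding runs_def by force
  next
    case (Suc l)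
    then have i: "i < N" by simp
    have e: "eval_expr e s' \<noteq> 0" and r: "runs b P s' T (I (Suc i))"
      using body[OF Suc.prems(2) i Suc.prems(1,4)] by auto
    obtain k s1 where k: "steps b P s' k s1" "k \<le> T" "I (Suc i) s1" using r by (auto simp: runs_def)
    have fr: "s1 a = s a" if "a \<notin> writes P" for a
      using steps_frame[OF k(1) that] Suc.prems(4)[OF that] by simp
    have "runs b (While e P) s1 ((N - Suc i) * (T + 1) + 1) Q"
      using Suc.hyps(1)[of "Suc i" s1] Suc.hyps(2) k(3) Suc.prems(2) i fr by simp
    then obtain k' s2 where k': "steps b (While e P) s1 k' s2" "k' \<le> (N - Suc i) * (T + 1) + 1" "Q s2"
      by (auto simp: runs_def)
    have "N - i = Suc (N - Suc i)" using i by simp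
    then have "1 + k + k' \<le> (N - i) * (T + 1) + 1" using k(2) k'(2) by simp
    then show ?case using steps_WhileTrue[OF e k(1) k'(1)] k'(3) unfolding runs_def by blast
  qed
  from this[OF assms(1) order_refl assms(2)] show ?thesis
    by (rule runs_weaken) (use n in auto)
qed

abbreviation Var :: "nat \<Rightarrow> expr" where "Var v \<equiv> Read v (Const 0)"
abbreviation Set_var :: "nat \<Rightarrow> expr \<Rightarrow> program" (infix "::=" 62) where "v ::= e \<equiv> Write v (Const 0) e"
notation Seq (infixr ";;" 61)

text \<open>The counter starts from its current content, so programs reset it beforehand, and the
  bound is evaluated anew before each pass.\<close>

definition For :: "nat \<Rightarrow> expr \<Rightarrow> program \<Rightarrow> program" where
  "For v e P = While (Sub e (Var v)) (P ;; v ::= Add (Var v) (Const 1))"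

lemma writes_For [simp]: "writes (For v e P) = insert v (writes P)"
  by (auto simp: For_def)

lemma prog_ok_For [simp]: "prog_ok b \<kappa> (For v e P) \<longleftrightarrow>
    expr_cost (Sub e (Var v)) \<le> \<kappa> \<and> consts_below b e \<and> 1 < b \<and> prog_ok b \<kappa> P \<and> 19 \<le> \<kappa>"
  by (auto simp: For_def)

text \<open>The body has to provide the invariant for the memory in which the counter is already
  advanced. In \<open>T + 2\<close> the test and the increment are counted.\<close>

lemma runs_For:
  assumes "I (s v 0) s" "s v 0 \<le> N" "N < b" "v \<notin> writes P"
    and body: "\<And>i s'. s v 0 \<le> i \<Longrightarrow> i < N \<Longrightarrow> s' v 0 = i \<Longrightarrow> I i s' \<Longrightarrow>
      (\<And>a. a \<notin> insert v (writes P) \<Longrightarrow> s' a = s a) \<Longrightarrow>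
      runs b P s' T (\<lambda>s''. I (Suc i) (s''(v := (s'' v)(0 := Suc i))))"
    and eval: "\<And>i s'. i \<le> N \<Longrightarrow> I i s' \<Longrightarrow> (\<And>a. a \<notin> insert v (writes P) \<Longrightarrow> s' a = s a) \<Longrightarrow>
      eval_expr e s' = N"
    and Q: "\<And>s'. s' v 0 = N \<Longrightarrow> I N s' \<Longrightarrow> (\<And>a. a \<notin> insert v (writes P) \<Longrightarrow> s' a = s a) \<Longrightarrow> Q s'"
    and n: "(N - s v 0) * (T + 2) + 1 \<le> n"
  shows "runs b (For v e P) s n Q"
  unfolding For_def
proof (rule runs_While[where I = "\<lambda>i s'. s' v 0 = i \<and> I i s'" and T = "T + 1"])
  show "s v 0 = s v 0 \<and> I (s v 0) s" "s v 0 \<le> N" using assms by auto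
  show "(N - s v 0) * (T + 1 + 1) + 1 \<le> n" using n by simp
next
  fix i s'
  assume i: "s v 0 \<le> i" "i < N" "s' v 0 = i \<and> I i s'"
    and fr: "\<And>a. a \<notin> writes (P ;; v ::= Add (Var v) (Const 1)) \<Longrightarrow> s' a = s a"
  have fr': "s' a = s a" if "a \<notin> insert v (writes P)" for a using fr that by simp
  have e: "eval_expr e s' = N" using eval[of i s'] i fr' by auto
  have "runs b (P ;; v ::= Add (Var v) (Const 1)) s' (T + 1) (\<lambda>s''. s'' v 0 = Suc i \<and> I (Suc i) s'')"
  proof (rule runs_Seq[OF body[of i s'], where n' = 1])
    fix s'' assume s'': "I (Suc i) (s''(v := (s'' v)(0 := Suc i)))"
      "\<And>a. a \<notin> writes P \<Longrightarrow> s'' a = s' a"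
    then have "s'' v 0 = i" using assms(4) i(3) by simp
    then show "runs b (v ::= Add (Var v) (Const 1)) s'' 1 (\<lambda>s''. s'' v 0 = Suc i \<and> I (Suc i) s'')"
      using s''(1) i(2) assms(3) by simp
  qed (use i fr' in auto)
  then show "eval_expr (Sub e (Var v)) s' \<noteq> 0 \<and>
      runs b (P ;; v ::= Add (Var v) (Const 1)) s' (T + 1) (\<lambda>s''. s'' v 0 = Suc i \<and> I (Suc i) s'')"
    using e i by simp
next
  fix s'
  assume i: "s' v 0 = N \<and> I N s'"
    and fr: "\<And>a. a \<notin> writes (P ;; v ::= Add (Var v) (Const 1)) \<Longrightarrow> s' a = s a"
  have fr': "s' a = s a" if "a \<notin> insert v (writes P)" for a using fr that by simp
  show "eval_expr (Sub e (Var v)) s' = 0 \<and> Q s'"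
    using eval[of N s'] i fr' Q[of s'] by auto
qed

section \<open>The program\<close>

abbreviation (input) input_arr :: nat where "input_arr \<equiv> 0"
abbreviation (input) output_arr :: nat where "output_arr \<equiv> 1"
abbreviation (input) top_reg :: nat where "top_reg \<equiv> 2"
abbreviation (input) scale_reg :: nat where "scale_reg \<equiv> 3"
abbreviation (input) dim_reg :: nat where "dim_reg \<equiv> 4"
abbreviation (input) grid_arr :: nat where "grid_arr \<equiv> 5"
abbreviation (input) levels_reg :: nat where "levels_reg \<equiv> 6"
abbreviation (input) base_reg :: nat where "base_reg \<equiv> 7"
abbreviation (input) guesses_reg :: nat where "guesses_reg \<equiv> 8"
abbreviation (input) exponent_reg :: nat where "exponent_reg \<equiv> 9"
abbreviation (input) guess_reg :: nat where "guess_reg \<equiv> 10"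
abbreviation (input) digits_reg :: nat where "digits_reg \<equiv> 11"
abbreviation (input) density_reg :: nat where "density_reg \<equiv> 12"
abbreviation (input) chosen_arr :: nat where "chosen_arr \<equiv> 13"
abbreviation (input) load_arr :: nat where "load_arr \<equiv> 14"
abbreviation (input) profit_reg :: nat where "profit_reg \<equiv> 15"
abbreviation (input) round_reg :: nat where "round_reg \<equiv> 16"
abbreviation (input) threshold_arr :: nat where "threshold_arr \<equiv> 17"
abbreviation (input) pick_profit_reg :: nat where "pick_profit_reg \<equiv> 18"
abbreviation (input) pick_weight_reg :: nat where "pick_weight_reg \<equiv> 19"
abbreviation (input) pick_reg :: nat where "pick_reg \<equiv> 20"
abbreviation (input) row_reg :: nat where "row_reg \<equiv> 21"
abbreviation (input) fits_reg :: nat where "fits_reg \<equiv> 22"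
abbreviation (input) weight_reg :: nat where "weight_reg \<equiv> 23"
abbreviation (input) volume_reg :: nat where "volume_reg \<equiv> 24"
abbreviation (input) best_reg :: nat where "best_reg \<equiv> 25"
abbreviation (input) cost_reg :: nat where "cost_reg \<equiv> 26"
abbreviation (input) digit_reg :: nat where "digit_reg \<equiv> 27"

text \<open>The header (dimension, item count, budgets) and each item row (name, profit, costs) both
  occupy \<open>d + 2\<close> cells.\<close>

definition row_cell :: "nat \<Rightarrow> nat \<Rightarrow> nat \<Rightarrow> nat" where
  "row_cell d r k = k + (d + 2 + r * (d + 2))"

definition at_row :: "nat \<Rightarrow> expr \<Rightarrow> expr \<Rightarrow> expr" where
  "at_row d e f = Read input_arr (Add f (Add (Const (d + 2)) (Mul e (Const (d + 2)))))"

lemma eval_at_row [simp]: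
  "eval_expr (at_row d e f) s = s 0 (row_cell d (eval_expr e s) (eval_expr f s))"
  by (simp add: at_row_def row_cell_def)

definition ident_at :: "nat \<Rightarrow> expr \<Rightarrow> expr" where
  "ident_at d e = at_row d e (Const 0)"

definition profit_at :: "nat \<Rightarrow> expr \<Rightarrow> expr" where
  "profit_at d e = at_row d e (Const 1)"

definition cost_at :: "nat \<Rightarrow> expr \<Rightarrow> expr" where
  "cost_at d e = at_row d e (Add (Var dim_reg) (Const 1))"

definition budget_at :: expr where
  "budget_at = Read input_arr (Add (Var dim_reg) (Const 1))"

lemma eval_at [simp]:
  "eval_expr (ident_at d e) s = s 0 (row_cell d (eval_expr e s) 0)"
  "eval_expr (profit_at d e) s = s 0 (row_cell d (eval_expr e s) 1)"
  "eval_expr (cost_at d e) s = s 0 (row_cell d (eval_expr e s) (s 4 0 + 1))"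
  "eval_expr budget_at s = s 0 (s 4 0 + 1)"
  by (simp_all add: ident_at_def profit_at_def cost_at_def budget_at_def)

abbreviation (input) count_expr :: expr where "count_expr \<equiv> Read input_arr (Const 1)"

text \<open>Attempt number \<open>N\<close> is the density greedy algorithm if \<open>N\<close> is the content of
  \<open>guesses_reg\<close>. Otherwise the digits of \<open>N\<close> in the base \<open>base_reg\<close> are the guessed thresholds,
  ordered by rounds and then by dimensions.\<close>

definition thresholds_prog :: "nat \<Rightarrow> program" where
  "thresholds_prog d =
     (dim_reg ::= Const 1 ;;
      For dim_reg (Const (d + 1))
       (If (Var density_reg)
         (If (Sub (Var top_reg) (Const 1))
           (Write threshold_arr (Var dim_reg) (Div budget_at (Const 4)))
           (Write threshold_arr (Var dim_reg) budget_at))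
         (digit_reg ::= Sub (Var digits_reg) (Mul (Div (Var digits_reg) (Var base_reg)) (Var base_reg)) ;;
          digits_reg ::= Div (Var digits_reg) (Var base_reg) ;;
          If (Sub (Var levels_reg) (Var digit_reg))
           (Write threshold_arr (Var dim_reg) (Sub budget_at (Read grid_arr (Var digit_reg))))
           (Write threshold_arr (Var dim_reg) (Read grid_arr (Sub (Var digit_reg) (Var levels_reg)))))))"

text \<open>Conditions are computed with truncated subtraction: \<open>Sub a b\<close> is 0 exactly
  if \<open>a\<close> is at most \<open>b\<close>, a sum is 0 if all such tests succeed, and
  \<open>Sub (Const 1)\<close> followed by a product accumulates the conjunction.\<close>

definition item_prog :: "nat \<Rightarrow> nat \<Rightarrow> program" where
  "item_prog d s =
     (fits_reg ::= Sub (Const 1) (Read chosen_arr (Var row_reg)) ;;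
      weight_reg ::= Const 0 ;;
      volume_reg ::= Const 0 ;;
      dim_reg ::= Const 1 ;;
      For dim_reg (Const (d + 1))
       (cost_reg ::= cost_at d (Var row_reg) ;;
        fits_reg ::= Mul (Var fits_reg) (Sub (Const 1)
          (Add (Sub (Var cost_reg) (Read threshold_arr (Var dim_reg)))
               (Sub (Add (Read load_arr (Var dim_reg)) (Var cost_reg)) budget_at))) ;;
        volume_reg ::= Add (Var volume_reg) (Var cost_reg) ;;
        If (Sub (Mul (Const 4) (Read load_arr (Var dim_reg))) budget_at)
         (weight_reg ::= Add (Var weight_reg) (Mul (Const s) (Mul (Var cost_reg) (Div (Var scale_reg) budget_at))))
         (weight_reg ::= Add (Var weight_reg) (Mul (Var cost_reg) (Div (Var scale_reg) budget_at)))) ;;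
      If (Var density_reg)
       (If (Sub (Var top_reg) (Const 1)) Skip
         (fits_reg ::= Mul (Var fits_reg) (Sub (Const 1) (Sub (Var volume_reg) (Const s)))))
       (weight_reg ::= Const 1) ;;
      If (Mul (Var fits_reg)
            (Sub (Mul (profit_at d (Var row_reg)) (Var pick_weight_reg)) (Mul (Var pick_profit_reg) (Var weight_reg))))
       (pick_profit_reg ::= profit_at d (Var row_reg) ;;
        pick_weight_reg ::= Var weight_reg ;;
        pick_reg ::= Var row_reg)
       Skip)"

text \<open>Starting with profit 0 and weight 1 makes sure that only items of positive profit are
  picked, for which comparing cross products is transitive even if weights are 0.\<close>

definition scan_prog :: "nat \<Rightarrow> nat \<Rightarrow> program" where
  "scan_prog d s =
     (pick_profit_reg ::= Const 0 ;;
      pick_weight_reg ::= Const 1 ;;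
      row_reg ::= Const 0 ;;
      For row_reg count_expr (item_prog d s))"

definition add_prog :: "nat \<Rightarrow> program" where
  "add_prog d =
     If (Var pick_profit_reg)
      (Write chosen_arr (Var pick_reg) (Const 1) ;;
       profit_reg ::= Add (Var profit_reg) (Var pick_profit_reg) ;;
       dim_reg ::= Const 1 ;;
       For dim_reg (Const (d + 1))
        (Write load_arr (Var dim_reg) (Add (Read load_arr (Var dim_reg)) (cost_at d (Var pick_reg)))))
      Skip"

definition attempt_prog :: "nat \<Rightarrow> nat \<Rightarrow> program" where
  "attempt_prog d s =
     (digits_reg ::= Var guess_reg ;;
      density_reg ::= Sub (Add (Var guess_reg) (Const 1)) (Var guesses_reg) ;;
      row_reg ::= Const 0 ;;
      For row_reg count_expr (Write chosen_arr (Var row_reg) (Const 0)) ;;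
      dim_reg ::= Const 1 ;;
      For dim_reg (Const (d + 1)) (Write load_arr (Var dim_reg) (Const 0)) ;;
      profit_reg ::= Const 0 ;;
      round_reg ::= Const 0 ;;
      For round_reg count_expr (thresholds_prog d ;; scan_prog d s ;; add_prog d))"

definition record_prog :: "nat \<Rightarrow> program" where
  "record_prog d =
     If (Sub (Var profit_reg) (Var best_reg))
      (best_reg ::= Var profit_reg ;;
       output_arr ::= Const 0 ;;
       row_reg ::= Const 0 ;;
       For row_reg count_expr
        (If (Read chosen_arr (Var row_reg))
          (output_arr ::= Add (Var output_arr) (Const 1) ;;
           Write output_arr (Var output_arr) (ident_at d (Var row_reg)))
          Skip))
      Skip"

definition init_prog :: "nat \<Rightarrow> program" where
  "init_prog d =
     (top_reg ::= Const 0 ;;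
      scale_reg ::= Const 1 ;;
      dim_reg ::= Const 1 ;;
      For dim_reg (Const (d + 1))
       (If budget_at
         (scale_reg ::= Mul (Var scale_reg) budget_at ;;
          If (Sub budget_at (Var top_reg)) (top_reg ::= budget_at) Skip)
         Skip))"

text \<open>After the loop \<open>levels_reg\<close> is raised from the last grid index to the
  number of grid points; the base is twice that number, as a digit also selects one of the two
  roundings.\<close>

definition grid_prog :: "nat \<Rightarrow> program" where
  "grid_prog d =
     (levels_reg ::= Const 0 ;;
      grid_arr ::= Const 0 ;;
      While (Sub (Var top_reg) (Read grid_arr (Var levels_reg)))
       (Write grid_arr (Add (Var levels_reg) (Const 1))
          (Add (Add (Read grid_arr (Var levels_reg)) (Const 1))
            (Div (Read grid_arr (Var levels_reg)) (Const (6 * d + 1)))) ;;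
        levels_reg ::= Add (Var levels_reg) (Const 1)) ;;
      levels_reg ::= Add (Var levels_reg) (Const 1) ;;
      base_reg ::= Mul (Const 2) (Var levels_reg))"

definition guesses_prog :: "nat \<Rightarrow> program" where
  "guesses_prog d =
     (guesses_reg ::= Const 1 ;;
      exponent_reg ::= Const 0 ;;
      If (Sub (Var top_reg) (Const 1))
       (For exponent_reg (Const (3 * d * d)) (guesses_reg ::= Mul (Var guesses_reg) (Var base_reg)))
       Skip)"

definition knapsack_prog :: "nat \<Rightarrow> nat \<Rightarrow> program" where
  "knapsack_prog d s =
     (init_prog d ;; grid_prog d ;; guesses_prog d ;;
      best_reg ::= Const 0 ;;
      guess_reg ::= Const 0 ;;
      For guess_reg (Add (Var guesses_reg) (Const 1)) (attempt_prog d s ;; record_prog d))"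

lemma expr_cost_at [simp]:
  "expr_cost (ident_at d e) = expr_cost e + 3 * width e + 25" "width (ident_at d e) = 1"
  "expr_cost (profit_at d e) = expr_cost e + 3 * width e + 25" "width (profit_at d e) = 1"
  "expr_cost (cost_at d e) = expr_cost e + 3 * width e + 37" "width (cost_at d e) = 1"
  "expr_cost budget_at = 19" "width budget_at = 1"
  by (simp_all add: ident_at_def profit_at_def cost_at_def budget_at_def at_row_def)

lemma consts_at [simp]:
  "consts_below b (ident_at d e) \<longleftrightarrow> consts_below b e \<and> d + 2 < b"
  "consts_below b (profit_at d e) \<longleftrightarrow> consts_below b e \<and> d + 2 < b"
  "consts_below b (cost_at d e) \<longleftrightarrow> consts_below b e \<and> d + 2 < b"
  "consts_below b budget_at \<longleftrightarrow> 1 < b"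
  by (auto simp: ident_at_def profit_at_def cost_at_def budget_at_def at_row_def)

text \<open>The shape of all expressions is independent of \<open>d\<close> and \<open>s\<close>,
  which enter only through constants, so an absolute number such as 500 bounds every expression
  cost.\<close>

lemma knapsack_prog_ok:
  assumes "d + 6 < b" "s < b" "6 * d + 1 < b" "3 * d * d < b"
  shows "prog_ok b 500 (knapsack_prog d s)"
  using assms
  by (simp add: knapsack_prog_def init_prog_def grid_prog_def guesses_prog_def attempt_prog_def
      record_prog_def thresholds_prog_def scan_prog_def item_prog_def add_prog_def)

section \<open>The numerical parameters that the program computes\<close>

context packing begin

definition top_budget :: nat where "top_budget = Max (B ` {1..d})"
definition levels :: nat where "levels = (LEAST k. top_budget \<le> grid (6 * d + 1) k)"
text \<open>With all budgets at most 1 only guess 0 is tried, the one without restrictions.\<close>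

definition guesses :: nat where
  "guesses = (if top_budget \<le> 1 then 1 else (2 * Suc levels) ^ (3 * d * d))"

lemma budget_le_top: "j \<in> {1..d} \<Longrightarrow> B j \<le> top_budget"
  unfolding top_budget_def by (intro Max_ge) auto

lemma top_le_grid: "top_budget \<le> grid (6 * d + 1) levels"
  unfolding levels_def by (rule LeastI[of _ top_budget]) (rule grid_ge)

lemma grid_less_top: "k < levels \<Longrightarrow> grid (6 * d + 1) k < top_budget"
  unfolding levels_def using not_less_Least[of k] by fastforce

end

text \<open>Rows of the input array are linked to a packing instance. \<open>\<nu>\<close> bounds
  the bits of the basic quantities, \<open>\<beta>\<close> those of stored values. A weight sums up
  to \<open>d\<close> products of three \<open>\<nu>\<close>-bit numbers, whence
  \<open>4 * \<nu>\<close>; the counters for guesses and digits have to fit as well.\<close>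

locale machine = packing d m p c B for d m p c B +
  fixes s \<nu> \<beta> :: nat and A :: "nat \<Rightarrow> nat" and ident :: "nat \<Rightarrow> nat"
  assumes d_pos: "d \<ge> 1"
    and A_count: "A 1 = m"
    and A_budget: "j \<in> {1..d} \<Longrightarrow> A (j + 1) = B j"
    and A_ident: "r < m \<Longrightarrow> A (row_cell d r 0) = ident r"
    and A_profit: "r < m \<Longrightarrow> A (row_cell d r 1) = p r"
    and A_cost: "r < m \<Longrightarrow> j \<in> {1..d} \<Longrightarrow> A (row_cell d r (j + 1)) = c r j"
    and A_less: "A k < 2 ^ \<nu>"
    and small: "6 * d + 6 < 2 ^ \<nu>" "s < 2 ^ \<nu>" "m < 2 ^ \<nu>" "scale < 2 ^ \<nu>"
    and large: "4 * \<nu> + 4 \<le> \<beta>" "guesses + 1 < 2 ^ \<beta>" "2 * Suc levels < 2 ^ \<beta>"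
begin

abbreviation "q \<equiv> 6 * d + 1"
abbreviation "W \<equiv> top_budget"
definition base :: nat where "base = 2 * Suc levels"

definition env :: "memory \<Rightarrow> bool" where
  "env \<sigma> \<longleftrightarrow> \<sigma> 0 = A \<and> \<sigma> 2 0 = W \<and> \<sigma> 3 0 = scale \<and> (\<forall>k\<le>levels. \<sigma> 5 k = grid q k) \<and>
     \<sigma> 6 0 = Suc levels \<and> \<sigma> 7 0 = base \<and> \<sigma> 8 0 = guesses"

lemma env_frame:
  assumes "env \<sigma>" "\<And>a. a \<in> {0, 2, 3, 5, 6, 7, 8} \<Longrightarrow> \<tau> a = \<sigma> a"
  shows "env \<tau>"
  using assms unfolding env_def by simp

lemma base_pos: "base > 0"
  by (simp add: base_def)

lemma pow_less: "(x::nat) < 2 ^ (k * \<nu>) \<Longrightarrow> k \<le> 4 \<Longrightarrow> x < 2 ^ \<beta>"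
proof -
  assume "x < 2 ^ (k * \<nu>)" "k \<le> 4"
  moreover from this have "k * \<nu> \<le> \<beta>" using large(1) mult_right_mono[of k 4 \<nu>] by linarith
  then have "(2::nat) ^ (k * \<nu>) \<le> 2 ^ \<beta>" by (intro power_increasing) auto
  ultimately show ?thesis by linarith
qed

lemma pow_less1: "(x::nat) < 2 ^ \<nu> \<Longrightarrow> x < 2 ^ \<beta>"
  using pow_less[of x 1] by simp

lemma cell_less [simp]: "A k < 2 ^ \<beta>"
  using A_less pow_less1 by blast

lemma const_less [simp]: "Suc d < 2 ^ \<beta>" "Suc 0 < 2 ^ \<beta>" "m < 2 ^ \<beta>" "(0::nat) < 2 ^ \<beta>"
  using small pow_less1[of "6 * d + 6"] pow_less1[of m] by auto

lemma cost_less: "r < m \<Longrightarrow> j \<in> {1..d} \<Longrightarrow> c r j < 2 ^ \<nu>"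
  using A_cost A_less by metis

lemma budget_less: "j \<in> {1..d} \<Longrightarrow> B j < 2 ^ \<nu>"
  using A_budget A_less by metis

lemma profit_less: "r < m \<Longrightarrow> p r < 2 ^ \<nu>"
  using A_profit A_less by metis

lemma top_budget_less: "W < 2 ^ \<nu>"
proof -
  have "W \<in> B ` {1..d}" unfolding top_budget_def using d_pos by (intro Max_in) auto
  then show ?thesis using budget_less by auto
qed

text \<open>The last grid point may exceed \<open>W\<close>, but its predecessor is below
  \<open>W\<close> and one step at most doubles a number and adds 1.\<close>

lemma grid_less: "k \<le> levels \<Longrightarrow> grid q k < 2 ^ \<beta>"
proof (cases k)
  case (Suc i)
  assume "k \<le> levels"
  then have "grid q i < W" using grid_less_top Suc by simp
  moreover have "grid q i div q \<le> grid q i" by simp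
  moreover have "grid q k = grid q i + 1 + grid q i div q" by (simp only: Suc grid.simps)
  ultimately have "grid q k < 2 * 2 ^ \<nu>" using top_budget_less by linarith
  also have "\<dots> = 2 ^ (Suc \<nu>)" by simp
  also have "\<dots> \<le> 2 ^ \<beta>" using large by (intro power_increasing) auto
  finally show ?thesis .
qed simp

section \<open>Verification of one attempt\<close>

lemma runs_thresholds:
  assumes env: "env \<sigma>" and D: "\<sigma> 12 0 = (if D then 1 else 0)" and X: "\<not> D \<Longrightarrow> \<sigma> 11 0 = X" "X < 2 ^ \<beta>"
    and u: "\<And>j. j \<in> {1..d} \<Longrightarrow> u j =
      (if D then if W > 1 then B j div 4 else B j
       else threshold q (Suc levels) (B j) (X div base ^ (j - 1) mod base))"
  shows "runs (2 ^ \<beta>) (thresholds_prog d) \<sigma> (7 * d + 2)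
     (\<lambda>\<sigma>'. (\<forall>j\<in>{1..d}. \<sigma>' 17 j = u j) \<and> (\<not> D \<longrightarrow> \<sigma>' 11 0 = X div base ^ d))"
  unfolding thresholds_prog_def runs_Seq_Write
proof (intro conjI, simp, simp,
    rule runs_For[where T = 5 and N = "d + 1" and I = "\<lambda>i \<sigma>'. (\<forall>j\<in>{1..<i}. \<sigma>' 17 j = u j) \<and>
      (\<not> D \<longrightarrow> \<sigma>' 11 0 = X div base ^ (i - 1))"], goal_cases)
  case (5 i \<sigma>')
  have i: "i \<in> {1..d}" "1 \<le> i" using 5 by auto
  have fr: "\<sigma>' a = \<sigma> a" if "a \<notin> {4, 11, 17, 27}" for a using 5(5)[of a] that by simp
  have [simp]: "\<sigma>' 0 = A" "\<sigma>' 2 0 = W" "\<sigma>' 6 0 = Suc levels" "\<sigma>' 7 0 = base"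
    "\<sigma>' 12 0 = (if D then 1 else 0)" "\<sigma>' 4 0 = i"
    using env fr D 5 by (auto simp: env_def)
  have g: "\<And>k. k \<le> levels \<Longrightarrow> \<sigma>' 5 k = grid q k" using env fr by (auto simp: env_def)
  have Ai: "A (Suc i) = B i" using A_budget[OF i(1)] by simp
  have Bi: "B i < 2 ^ \<beta>" using budget_less[OF i(1)] pow_less1 by blast
  have div4: "B i div 4 < 2 ^ \<beta>" using Bi by (meson div_le_dividend le_less_trans)
  \<comment> \<open>Separates the cell written in this pass from the cells covered by the invariant
    so far.\<close>
  have S: "(\<forall>j\<in>{Suc 0..<Suc i}. (if j = i then v else f j) = u j) \<longleftrightarrow>
      v = u i \<and> (\<forall>j\<in>{Suc 0..<i}. f j = u j)" for v and f :: "nat \<Rightarrow> nat"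
    using i(2) by (auto simp: less_Suc_eq)
  show ?case
  proof (cases D)
    case True
    then show ?thesis
      using 5(4) u[OF i(1)] Ai Bi div4 by (cases "W > 1") (simp_all add: S)
  next
    case False
    define Y where "Y = X div base ^ (i - 1)"
    have Y: "\<sigma>' 11 0 = Y" using 5(4) False by (simp add: Y_def)
    have YX: "Y \<le> X" by (simp add: Y_def)
    have dg: "Y - Y div base * base = Y mod base" by (rule minus_div_mult_eq_mod)
    have Yd: "Y div base = X div base ^ i"
      unfolding Y_def using i(2) by (cases i) (simp_all add: power_Suc2 div_mult2_eq del: power_Suc)
    have lt: "Y mod base < 2 * Suc levels" using mod_less_divisor[OF base_pos, of Y] base_def by linarith
    have ui: "u i = threshold q (Suc levels) (B i) (Y mod base)"
      using u[OF i(1)] False by (simp add: Y_def)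
    have l1: "Y mod base < 2 ^ \<beta>" "Y div base < 2 ^ \<beta>"
      using YX X(2) by (meson mod_less_eq_dividend div_le_dividend le_less_trans)+
    show ?thesis
    proof (cases "Y mod base < Suc levels")
      case True
      then have "\<sigma>' 5 (Y mod base) = grid q (Y mod base)" by (intro g) simp
      moreover have "u i = B i - grid q (Y mod base)" using ui True by (simp add: threshold_def)
      moreover have "B i - grid q (Y mod base) < 2 ^ \<beta>" using Bi by simp
      ultimately show ?thesis
        using True False 5(4) Y Ai dg l1 Yd by (simp add: S del: grid.simps)
    next
      case ge: False
      have gl: "Y mod base - Suc levels \<le> levels" using lt by simp
      have "\<sigma>' 5 (Y mod base - Suc levels) = grid q (Y mod base - Suc levels)" by (rule g[OF gl])
      moreover have "u i = grid q (Y mod base - Suc levels)" using ui ge by (simp add: threshold_def)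
      moreover have "grid q (Y mod base - Suc levels) < 2 ^ \<beta>" by (rule grid_less[OF gl])
      ultimately show ?thesis
        using ge False 5(4) Y Ai dg l1 Yd by (simp add: S del: grid.simps)
    qed
  qed
qed (use d_pos X in auto)


definition admissible :: "bool \<Rightarrow> nat \<Rightarrow> bool" where
  "admissible D r \<longleftrightarrow> D \<and> \<not> W > 1 \<longrightarrow> (\<Sum>j\<in>{1..d}. c r j) \<le> s"

definition score :: "bool \<Rightarrow> nat set \<Rightarrow> nat \<Rightarrow> nat" where
  "score D C r = (if D then weight s C r else 1)"

text \<open>In the initial state, with profit 0 and weight 1, the last conjunct says that all
  scanned candidates have profit 0, which is the stopping case of \<open>select\<close>.\<close>

definition scanned :: "bool \<Rightarrow> nat set \<Rightarrow> nat set \<Rightarrow> nat \<Rightarrow> memory \<Rightarrow> bool" where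
  "scanned D C V k \<sigma> \<longleftrightarrow>
     (\<sigma> 18 0 = 0 \<and> \<sigma> 19 0 = 1 \<or>
      \<sigma> 18 0 > 0 \<and> \<sigma> 20 0 \<in> V \<and> \<sigma> 18 0 = p (\<sigma> 20 0) \<and> \<sigma> 19 0 = score D C (\<sigma> 20 0)) \<and>
     (\<forall>i\<in>V. i < k \<longrightarrow> p i * \<sigma> 19 0 \<le> \<sigma> 18 0 * score D C i)"

definition config :: "nat set \<Rightarrow> memory \<Rightarrow> bool" where
  "config C \<sigma> \<longleftrightarrow> env \<sigma> \<and> (\<forall>r<m. \<sigma> 13 r = (if r \<in> C then 1 else 0)) \<and>
     (\<forall>j\<in>{1..d}. \<sigma> 14 j = load C j)"

lemma scanned_skip:
  assumes "scanned D C V k \<sigma>" "k \<in> V \<Longrightarrow> p k * \<sigma> 19 0 \<le> \<sigma> 18 0 * score D C k"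
  shows "scanned D C V (Suc k) \<sigma>"
  using assms by (auto simp: scanned_def less_Suc_eq)

text \<open>Transitivity of cross products fails through weight 0 in the middle; here the strict
  inequality forces the old weight to be positive, so it can be cancelled.\<close>

lemma scanned_update:
  assumes sc: "scanned D C V k \<sigma>" and k: "k \<in> V" "p k * \<sigma> 19 0 > \<sigma> 18 0 * score D C k"
    and \<tau>: "\<tau> 18 0 = p k" "\<tau> 19 0 = score D C k" "\<tau> 20 0 = k"
  shows "scanned D C V (Suc k) \<tau>"
proof -
  have pk: "p k > 0" using k(2) by (cases "p k") auto
  have w: "\<sigma> 19 0 > 0" using k(2) by (cases "\<sigma> 19 0") auto
  have "p i * score D C k \<le> p k * score D C i" if i: "i \<in> V" "i < k" for i
  proof -
    have 1: "p i * \<sigma> 19 0 \<le> \<sigma> 18 0 * score D C i" using sc i by (simp add: scanned_def)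
    have "(p i * score D C k) * \<sigma> 19 0 = (p i * \<sigma> 19 0) * score D C k" by (simp only: ac_simps)
    also have "\<dots> \<le> (\<sigma> 18 0 * score D C i) * score D C k" using 1 by (rule mult_right_mono) simp
    also have "\<dots> = (\<sigma> 18 0 * score D C k) * score D C i" by (simp only: ac_simps)
    also have "\<dots> \<le> (p k * \<sigma> 19 0) * score D C i" using k(2) by (intro mult_right_mono) auto
    also have "\<dots> = (p k * score D C i) * \<sigma> 19 0" by (simp only: ac_simps)
    finally show ?thesis using w by simp
  qed
  then show ?thesis using pk k(1) \<tau> by (auto simp: scanned_def less_Suc_eq)
qed

lemma weight_partial_less:
  assumes r: "r < m" and i: "i \<le> Suc d"
  shows "(\<Sum>j\<in>{1..<i}. (if 4 * load C j > B j then s else 1) * (c r j * (scale div B j))) < 2 ^ \<beta>"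
proof -
  have "(if 4 * load C j > B j then s else 1) * (c r j * (scale div B j)) \<le> 2 ^ \<nu> * (2 ^ \<nu> * 2 ^ \<nu>)"
    if "j \<in> {1..<i}" for j
  proof (intro mult_mono)
    show "(if 4 * load C j > B j then s else 1) \<le> 2 ^ \<nu>" using small(2) by (simp add: less_imp_le)
    show "c r j \<le> 2 ^ \<nu>" using cost_less[OF r, of j] that i by (simp add: less_imp_le)
    show "scale div B j \<le> 2 ^ \<nu>" using small(4) by (meson div_le_dividend le_less_trans less_imp_le)
  qed auto
  then have "(\<Sum>j\<in>{1..<i}. (if 4 * load C j > B j then s else 1) * (c r j * (scale div B j)))
      \<le> card {1..<i} * (2 ^ \<nu> * (2 ^ \<nu> * 2 ^ \<nu>))"
    using sum_bounded_above[of "{1..<i}" "\<lambda>j. (if 4 * load C j > B j then s else 1) * (c r j * (scale div B j))"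
        "2 ^ \<nu> * (2 ^ \<nu> * 2 ^ \<nu>)"] by (simp only: of_nat_id)
  also have "\<dots> < 2 ^ \<nu> * (2 ^ \<nu> * (2 ^ \<nu> * 2 ^ \<nu>))"
    using i small(1) by (intro mult_strict_right_mono) auto
  also have "\<dots> = 2 ^ (4 * \<nu>)" by (simp flip: power_add)
  finally show ?thesis by (rule pow_less) simp
qed

lemma cost_partial_less:
  assumes r: "r < m" and i: "i \<le> Suc d"
  shows "(\<Sum>j\<in>{1..<i}. c r j) < 2 ^ \<beta>"
proof -
  have "(\<Sum>j\<in>{1..<i}. c r j) \<le> card {1..<i} * 2 ^ \<nu>"
    using sum_bounded_above[of "{1..<i}" "c r" "2 ^ \<nu>"] cost_less[OF r] i by (auto simp: less_imp_le)
  also have "\<dots> < 2 ^ \<nu> * 2 ^ \<nu>" using i small(1) by (intro mult_strict_right_mono) auto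
  also have "\<dots> = 2 ^ (2 * \<nu>)" by (simp flip: power_add add: mult_2)
  finally show ?thesis by (rule pow_less) simp
qed

lemma runs_item:
  assumes cfg: "config C \<sigma>" and D: "\<sigma> 12 0 = (if D then 1 else 0)"
    and u: "\<forall>j\<in>{1..d}. \<sigma> 17 j = u j" and r: "\<sigma> 21 0 = r" "r < m"
    and sc: "scanned D C (cand u (admissible D) C) r \<sigma>" and V: "V = cand u (admissible D) C"
  shows "runs (2 ^ \<beta>) (item_prog d s) \<sigma> (7 * d + 12) (scanned D C V (Suc r))"
proof -
  let ?w = "\<lambda>j. (if 4 * load C j > B j then s else 1) * (c r j * (scale div B j))"
  define \<phi> where "\<phi> i \<longleftrightarrow> r \<notin> C \<and> (\<forall>j\<in>{1..<i}. c r j \<le> u j \<and> load C j + c r j \<le> B j)" for i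
  define w where "w i = (\<Sum>j\<in>{1..<i}. ?w j)" for i
  define z where "z i = (\<Sum>j\<in>{1..<i}. c r j)" for i
  have Suc_simps: "\<phi> (Suc i) \<longleftrightarrow> \<phi> i \<and> c r i \<le> u i \<and> load C i + c r i \<le> B i"
    "w (Suc i) = w i + ?w i" "z (Suc i) = z i + c r i" if "i \<in> {1..d}" for i
    using that by (auto simp: \<phi>_def w_def z_def less_Suc_eq sum.atLeastLessThan_Suc)
  have less: "w i < 2 ^ \<beta>" "z i < 2 ^ \<beta>" if "i \<le> Suc d" for i
    unfolding w_def z_def using weight_partial_less cost_partial_less r(2) that by blast+
  let ?I = "\<lambda>i \<sigma>'. \<sigma>' 22 0 = (if \<phi> i then 1 else 0) \<and> \<sigma>' 23 0 = w i \<and> \<sigma>' 24 0 = z i"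
  define loop where "loop = For dim_reg (Const (d + 1))
       (cost_reg ::= cost_at d (Var row_reg) ;;
        fits_reg ::= Mul (Var fits_reg) (Sub (Const 1)
          (Add (Sub (Var cost_reg) (Read threshold_arr (Var dim_reg)))
               (Sub (Add (Read load_arr (Var dim_reg)) (Var cost_reg)) budget_at))) ;;
        volume_reg ::= Add (Var volume_reg) (Var cost_reg) ;;
        If (Sub (Mul (Const 4) (Read load_arr (Var dim_reg))) budget_at)
         (weight_reg ::= Add (Var weight_reg) (Mul (Const s) (Mul (Var cost_reg) (Div (Var scale_reg) budget_at))))
         (weight_reg ::= Add (Var weight_reg) (Mul (Var cost_reg) (Div (Var scale_reg) budget_at))))"
  have loop: "runs (2 ^ \<beta>) loop \<tau> (7 * d + 1) (?I (d + 1))"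
    if \<tau>: "?I 1 \<tau>" "\<tau> 4 0 = 1" "\<And>a. a \<notin> {4, 22, 23, 24} \<Longrightarrow> \<tau> a = \<sigma> a" for \<tau>
    unfolding loop_def
  proof (rule runs_For[where T = 5 and N = "d + 1" and I = ?I], goal_cases)
    case (5 i \<sigma>')
    have i: "i \<in> {1..d}" using 5 \<tau>(2) by auto
    have fr: "\<sigma>' a = \<sigma> a" if "a \<notin> {4, 22, 23, 24, 26}" for a using 5(5)[of a] \<tau>(3)[of a] that by simp
    have [simp]: "\<sigma>' 0 = A" "\<sigma>' 3 0 = scale" "\<sigma>' 4 0 = i" "\<sigma>' 21 0 = r" "\<sigma>' 14 i = load C i" "\<sigma>' 17 i = u i"
      using cfg fr 5 r u i by (auto simp: config_def env_def)
    have [simp]: "A (Suc i) = B i" "A (row_cell d r (Suc i)) = c r i"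
      using A_budget[OF i] A_cost[OF r(2) i] by simp_all
    have lt: "w i + ?w i < 2 ^ \<beta>" "z i + c r i < 2 ^ \<beta>"
      using less[of "Suc i"] i by (simp_all only: Suc_simps) auto
    have ind: "Suc 0 - (c r i - u i + (load C i + c r i - B i)) =
        (if c r i \<le> u i \<and> load C i + c r i \<le> B i then 1 else 0)" by auto
    show ?case
      using 5(4) lt Suc_simps[OF i] by (cases "B i < 4 * load C i") (simp_all add: ind)
  next
    case (7 \<sigma>')
    then show ?case by simp
  qed (use \<tau> d_pos in auto)
  let ?pick = "If (Mul (Var fits_reg)
            (Sub (Mul (profit_at d (Var row_reg)) (Var pick_weight_reg)) (Mul (Var pick_profit_reg) (Var weight_reg))))
       (pick_profit_reg ::= profit_at d (Var row_reg) ;;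
        pick_weight_reg ::= Var weight_reg ;;
        pick_reg ::= Var row_reg)
       Skip"
  define tail where "tail =
     (If (Var density_reg)
       (If (Sub (Var top_reg) (Const 1)) Skip
         (fits_reg ::= Mul (Var fits_reg) (Sub (Const 1) (Sub (Var volume_reg) (Const s)))))
       (weight_reg ::= Const 1) ;;
      ?pick)"
  have tail: "runs (2 ^ \<beta>) tail \<tau> 7 (scanned D C V (Suc r))"
    if I: "?I (d + 1) \<tau>" and fr: "\<And>a. a \<notin> {4, 22, 23, 24, 26} \<Longrightarrow> \<tau> a = \<sigma> a" for \<tau>
  proof -
    have [simp]: "\<tau> 0 = A" "\<tau> 12 0 = (if D then 1 else 0)" "\<tau> 2 0 = W" "\<tau> 21 0 = r"
      using cfg fr D r by (auto simp: config_def env_def)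
    have [simp]: "A (row_cell d r (Suc 0)) = p r" using A_profit[OF r(2)] by simp
    have range: "{1..<Suc d} = {1..d}" by auto
    have t: "\<tau> 22 0 = (if \<phi> (Suc d) then 1 else 0)" "\<tau> 23 0 = weight s C r" "\<tau> 24 0 = (\<Sum>j\<in>{1..d}. c r j)"
      using I unfolding w_def z_def weight_def range[symmetric] by simp_all
    have rV: "r \<in> V \<longleftrightarrow> \<phi> (Suc d) \<and> admissible D r"
      unfolding \<phi>_def range using r(2) by (auto simp: V cand_def)
    have wl: "weight s C r < 2 ^ \<beta>"
      using less(1)[of "Suc d"] unfolding w_def range weight_def by simp
    have pl: "p r < 2 ^ \<beta>" "r < 2 ^ \<beta>" using profit_less[OF r(2)] pow_less1 r(2) const_less(3) by (auto intro: less_trans)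
    \<comment> \<open>All branches before the final comparison differ only in how they prepare
      registers 22 and 23, so the comparison is verified once for all of them.\<close>
    have fin: "runs (2 ^ \<beta>) ?pick \<tau>' 4 (scanned D C V (Suc r))"
      if \<tau>': "\<tau>' 22 0 = (if r \<in> V then 1 else 0)" "\<tau>' 23 0 = score D C r" "\<tau>' 0 = A" "\<tau>' 21 0 = r"
        "\<tau>' 18 = \<sigma> 18" "\<tau>' 19 = \<sigma> 19" "\<tau>' 20 = \<sigma> 20" for \<tau>'
    proof -
      have sc': "scanned D C V r \<tau>'" using sc \<tau>' by (simp add: scanned_def V)
      have sl: "score D C r < 2 ^ \<beta>" using wl by (simp add: score_def)
      show ?thesis
      proof (cases "r \<in> V \<and> p r * \<tau>' 19 0 > \<tau>' 18 0 * score D C r")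
        case True
        then have "scanned D C V (Suc r) (\<tau>'(18 := (\<tau>' 18)(0 := p r),
            19 := (\<tau>' 19)(0 := score D C r), 20 := (\<tau>' 20)(0 := r)))"
          by (intro scanned_update[OF sc']) auto
        then show ?thesis using True \<tau>'(1-4) pl sl by simp
      next
        case False
        then have "scanned D C V (Suc r) \<tau>'"
          by (intro scanned_skip[OF sc']) auto
        then show ?thesis using False \<tau>'(1-4) by (cases "r \<in> V") simp_all
      qed
    qed
    have fr': "\<tau> 18 = \<sigma> 18" "\<tau> 19 = \<sigma> 19" "\<tau> 20 = \<sigma> 20" using fr by simp_all
    show ?thesis
      unfolding tail_def
    proof (rule runs_Seq_If, goal_cases)
      case 2
      then have D: D by (simp split: if_splits)
      show ?case
      proof (rule runs_Seq_If, goal_cases)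
        case 2
        then have "r \<in> V \<longleftrightarrow> \<phi> (Suc d)" using rV D by (auto simp: admissible_def)
        then have "runs (2 ^ \<beta>) ?pick \<tau> 4 (scanned D C V (Suc r))"
          using t D fr' by (intro fin) (simp_all add: score_def)
        then show ?case
          by (intro runs_Seq[where n = 1 and n' = 4 and R = "\<lambda>\<sigma>'. \<sigma>' = \<tau>"]) auto
      next
        case 3
        then have rV': "r \<in> V \<longleftrightarrow> \<phi> (Suc d) \<and> (\<Sum>j\<in>{1..d}. c r j) \<le> s" using rV D by (auto simp: admissible_def)
        show ?case
          unfolding runs_Seq_Write
        proof (intro conjI)
          show "1 \<le> (7::nat) - 1 - 1" by simp
          show "eval_expr (Mul (Var fits_reg) (Sub (Const 1) (Sub (Var volume_reg) (Const s)))) \<tau> < 2 ^ \<beta>"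
            using t(1) le_less_trans[OF diff_le_self const_less(2)] by simp
          show "runs (2 ^ \<beta>) ?pick (\<tau>(22 := (\<tau> 22)(eval_expr (Const 0) \<tau> := eval_expr (Mul (Var fits_reg) (Sub (Const 1) (Sub (Var volume_reg) (Const s)))) \<tau>)))
             (7 - 1 - 1 - 1) (scanned D C V (Suc r))"
            using t D fr' rV' by (intro runs_weaken[OF fin]) (auto simp: score_def)
        qed
      qed simp
    next
      case 3
      then have D: "\<not> D" by (simp split: if_splits)
      have "r \<in> V \<longleftrightarrow> \<phi> (Suc d)" using rV D by (auto simp: admissible_def)
      then show ?case
        unfolding runs_Seq_Write
        using t D fr' by (intro conjI runs_weaken[OF fin]) (auto simp: score_def)
    qed simp
  qed
  have chosen: "\<sigma> 13 r = (if r \<in> C then 1 else 0)" using cfg r by (simp add: config_def)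
  have main: "runs (2 ^ \<beta>) (loop ;; tail) \<tau>' (7 * d + 12 - 1 - 1 - 1 - 1) (scanned D C V (Suc r))"
    if \<tau>: "?I 1 \<tau>'" "\<tau>' 4 0 = 1" "\<And>a. a \<notin> {4, 22, 23, 24} \<Longrightarrow> \<tau>' a = \<sigma> a" for \<tau>'
  proof (rule runs_Seq[OF loop[OF \<tau>] tail])
    show "7 * d + 1 + 7 \<le> 7 * d + 12 - 1 - 1 - 1 - 1" by simp
    fix \<tau>'' a assume "\<And>a. a \<notin> writes loop \<Longrightarrow> \<tau>'' a = \<tau>' a" "a \<notin> {4, 22, 23, 24, 26 :: nat}"
    then show "\<tau>'' a = \<sigma> a" using \<tau>(3)[of a] by (simp add: loop_def)
  qed auto
  have "runs (2 ^ \<beta>) (fits_reg ::= Sub (Const 1) (Read chosen_arr (Var row_reg)) ;;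
      weight_reg ::= Const 0 ;; volume_reg ::= Const 0 ;; dim_reg ::= Const 1 ;; loop ;; tail)
     \<sigma> (7 * d + 12) (scanned D C V (Suc r))"
    unfolding runs_Seq_Write
    by (intro conjI main) (use chosen r in \<open>auto simp: \<phi>_def w_def z_def\<close>)
  then show ?thesis by (simp only: item_prog_def loop_def tail_def)
qed

lemma config_frame:
  assumes "config C \<sigma>" "\<And>a. a \<in> {0, 2, 3, 5, 6, 7, 8, 13, 14} \<Longrightarrow> \<tau> a = \<sigma> a"
  shows "config C \<tau>"
proof -
  have "env \<tau>" by (rule env_frame[of \<sigma>]) (use assms in \<open>auto simp: config_def\<close>)
  then show ?thesis using assms unfolding config_def by simp
qed

lemma scanned_frame:
  assumes "scanned D C V k \<sigma>" "\<tau> 18 = \<sigma> 18" "\<tau> 19 = \<sigma> 19" "\<tau> 20 = \<sigma> 20"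
  shows "scanned D C V k \<tau>"
  using assms unfolding scanned_def by simp

lemma runs_scan:
  assumes cfg: "config C \<sigma>" and D: "\<sigma> 12 0 = (if D then 1 else 0)"
    and u: "\<forall>j\<in>{1..d}. \<sigma> 17 j = u j" and V: "V = cand u (admissible D) C"
  shows "runs (2 ^ \<beta>) (scan_prog d s) \<sigma> (m * (7 * d + 14) + 4) (scanned D C V m)"
  unfolding scan_prog_def runs_Seq_Write
proof (intro conjI, goal_cases)
  case 7
  show ?case
  proof (rule runs_For[where T = "7 * d + 12" and N = m and I = "scanned D C V"], goal_cases)
    case (5 i \<sigma>')
    have fr: "\<sigma>' a = \<sigma> a" if "a \<in> {0, 2, 3, 5, 6, 7, 8, 12, 13, 14, 17}" for a
      using 5(5)[of a] that by (auto simp: item_prog_def)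
    have "runs (2 ^ \<beta>) (item_prog d s) \<sigma>' (7 * d + 12) (scanned D C V (Suc i))"
    proof (rule runs_item[OF _ _ _ _ _ _ V])
      show "config C \<sigma>'" by (rule config_frame[OF cfg]) (use fr in auto)
      show "scanned D C (cand u (admissible D) C) i \<sigma>'" using 5 V by simp
    qed (use D u fr 5 in auto)
    then show ?case by (rule runs_weaken) (auto elim!: scanned_frame)
  next
    case (6 i \<sigma>')
    then have "\<sigma>' 0 = \<sigma> 0" by (simp add: item_prog_def)
    then show ?case using cfg A_count by (simp add: config_def env_def)
  qed (auto simp: scanned_def item_prog_def)
qed auto

lemma sum_profit_less: "C \<subseteq> {..<m} \<Longrightarrow> sum p C < 2 ^ \<beta>"
proof -
  assume C: "C \<subseteq> {..<m}"
  have "sum p C \<le> sum p {..<m}" using C by (intro sum_mono2) auto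
  also have "\<dots> \<le> (\<Sum>i<m. 2 ^ \<nu>)" using profit_less by (intro sum_mono) (simp add: less_imp_le)
  also have "\<dots> = m * 2 ^ \<nu>" by simp
  also have "\<dots> < 2 ^ \<nu> * 2 ^ \<nu>" using small(3) by simp
  also have "\<dots> = 2 ^ (2 * \<nu>)" by (simp flip: power_add add: mult_2)
  finally show ?thesis by (rule pow_less) simp
qed

lemma runs_add:
  assumes cfg: "config C \<sigma>" and sc: "scanned D C V m \<sigma>" and V: "V = cand u (admissible D) C"
    and P: "\<sigma> 15 0 = sum p C" and C: "C \<subseteq> {..<m}"
  shows "runs (2 ^ \<beta>) (add_prog d) \<sigma> (3 * d + 5)
    (\<lambda>\<sigma>'. \<exists>C'. select p V (score D C) C C' \<and> config C' \<sigma>' \<and> \<sigma>' 15 0 = sum p C')"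
proof (cases "\<sigma> 18 0 = 0")
  case True
  have "\<forall>i\<in>V. p i = 0"
  proof
    fix i assume "i \<in> V"
    moreover from this have "i < m" by (auto simp: V cand_def)
    ultimately show "p i = 0" using sc True by (auto simp: scanned_def)
  qed
  then have "select p V (score D C) C C" by (simp add: select_def)
  then show ?thesis using True cfg P by (auto simp: add_prog_def)
next
  case False
  define b where "b = \<sigma> 20 0"
  have b: "b \<in> V" "\<sigma> 18 0 = p b" "p b > 0" "\<forall>i\<in>V. p i * score D C b \<le> p b * score D C i"
    using sc False by (auto simp: scanned_def b_def V cand_def)
  define C' where "C' = insert b C"
  have bm: "b < m" "b \<notin> C" using b(1) by (auto simp: V cand_def)
  have finC: "finite C" using C finite_subset by blast
  have C'm: "C' \<subseteq> {..<m}" using C bm by (auto simp: C'_def)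
  have sel: "select p V (score D C) C C'" using b by (auto simp: select_def C'_def)
  have sum': "sum p C' = sum p C + p b" using bm finC by (simp add: C'_def)
  have load': "load C' j = load C j + c b j" for j
    unfolding C'_def by (rule load_insert[OF finC bm(2)])
  have load_less: "load C j + c b j < 2 ^ \<beta>" if j: "j \<in> {1..d}" for j
  proof -
    have "load C j + c b j \<le> B j" using b(1) j by (auto simp: V cand_def)
    then show ?thesis using budget_less[OF j] pow_less1 by (meson le_less_trans)
  qed
  have "runs (2 ^ \<beta>) (For dim_reg (Const (d + 1))
        (Write load_arr (Var dim_reg) (Add (Read load_arr (Var dim_reg)) (cost_at d (Var pick_reg)))))
      \<tau> (3 * d + 1) (\<lambda>\<sigma>'. config C' \<sigma>' \<and> \<sigma>' 15 0 = sum p C')"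
    if \<tau>: "\<tau> 13 = (\<sigma> 13)(b := 1)" "\<tau> 15 0 = sum p C'" "\<tau> 4 0 = 1"
      "\<And>a. a \<notin> {13, 15, 4} \<Longrightarrow> \<tau> a = \<sigma> a" for \<tau>
  proof (rule runs_For[where T = 1 and N = "d + 1"
        and I = "\<lambda>i \<sigma>'. \<forall>j\<in>{1..d}. \<sigma>' 14 j = (if j < i then load C' j else load C j)"], goal_cases)
    case 1
    then show ?case using \<tau> cfg by (simp add: config_def)
  next
    case (5 i \<sigma>')
    have i: "i \<in> {1..d}" using 5 \<tau> by auto
    have [simp]: "\<sigma>' 0 = A" "\<sigma>' 20 0 = b" "\<sigma>' 4 0 = i"
      using 5(3) 5(5)[of 0] 5(5)[of 20] \<tau>(4)[of 0] \<tau>(4)[of 20] cfg by (auto simp: config_def env_def b_def)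
    have [simp]: "A (row_cell d b (Suc i)) = c b i" using A_cost[OF bm(1) i] by simp
    have "\<sigma>' 14 i = load C i" using 5(4) i by simp
    then show ?case using load_less[OF i] load'[of i] 5(4)
      by (auto simp: less_Suc_eq)
  next
    case (7 \<sigma>')
    have fr: "\<sigma>' a = \<tau> a" if "a \<notin> {4, 14}" for a using 7(3)[of a] that by simp
    have "env \<sigma>'" by (rule env_frame[of \<sigma>]) (use cfg fr \<tau>(4) in \<open>auto simp: config_def\<close>)
    moreover have "\<sigma>' 13 r = (if r \<in> C' then 1 else 0)" if "r < m" for r
      using fr[of 13] \<tau>(1) cfg that by (simp add: config_def C'_def)
    moreover have "\<sigma>' 14 j = load C' j" if "j \<in> {1..d}" for j
      using 7(2) that by simp
    ultimately show ?case using fr[of 15] \<tau>(2) by (simp add: config_def)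
  qed (use \<tau> in auto)
  from this[of "\<sigma>(13 := (\<sigma> 13)(b := 1), 15 := (\<sigma> 15)(0 := sum p C'), 4 := (\<sigma> 4)(0 := 1))"]
  have loop: "runs (2 ^ \<beta>) (For dim_reg (Const (d + 1))
        (Write load_arr (Var dim_reg) (Add (Read load_arr (Var dim_reg)) (cost_at d (Var pick_reg)))))
      (\<sigma>(13 := (\<sigma> 13)(b := 1), 15 := (\<sigma> 15)(0 := sum p C'), 4 := (\<sigma> 4)(0 := 1)))
      (3 * d + 1) (\<lambda>\<sigma>'. config C' \<sigma>' \<and> \<sigma>' 15 0 = sum p C')"
    by simp
  have "runs (2 ^ \<beta>) (add_prog d) \<sigma> (3 * d + 5) (\<lambda>\<sigma>'. config C' \<sigma>' \<and> \<sigma>' 15 0 = sum p C')"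
    unfolding add_prog_def runs_If runs_Seq_Write
    using False sum_profit_less[OF C'm] b(2) P sum'
      loop by (simp add: b_def)
  then show ?thesis by (rule runs_weaken) (use sel in auto)
qed

definition round_threshold :: "bool \<Rightarrow> nat \<Rightarrow> nat \<Rightarrow> nat \<Rightarrow> nat" where
  "round_threshold D N k j =
     (if D then if W > 1 then B j div 4 else B j else guess q (Suc levels) N k j)"

abbreviation "attempt D N \<equiv> greedy p (\<lambda>k. cand (round_threshold D N k) (admissible D)) (score D)"

lemma attempt_feasible: "attempt D N k C \<Longrightarrow> feasible C"
  by (rule greedy_feasible[where u = "round_threshold D N" and Q = "admissible D"]) auto

text \<open>Before round \<open>k\<close> register 11 holds \<open>N\<close> without its first
  \<open>k * d\<close> digits, and the round strips \<open>d\<close> more; the density attempt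
  ignores the digits.\<close>

lemma runs_round:
  assumes cfg: "config C \<sigma>" and D: "\<sigma> 12 0 = (if D then 1 else 0)"
    and X: "\<not> D \<Longrightarrow> \<sigma> 11 0 = N div base ^ (k * d)" "N < 2 ^ \<beta>"
    and C: "attempt D N k C" and P: "\<sigma> 15 0 = sum p C"
  shows "runs (2 ^ \<beta>) (thresholds_prog d ;; scan_prog d s ;; add_prog d) \<sigma> (m * (7 * d + 14) + 10 * d + 11)
    (\<lambda>\<sigma>'. \<exists>C'. attempt D N (Suc k) C' \<and> config C' \<sigma>' \<and> \<sigma>' 15 0 = sum p C' \<and>
      \<sigma>' 12 0 = (if D then 1 else 0) \<and> (\<not> D \<longrightarrow> \<sigma>' 11 0 = N div base ^ (Suc k * d)))"
proof -
  let ?u = "round_threshold D N k"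
  let ?V = "cand ?u (admissible D) C"
  have Cm: "C \<subseteq> {..<m}" using attempt_feasible[OF C] by (simp add: feasible_def)
  have Xl: "N div base ^ (k * d) < 2 ^ \<beta>" using X(2) by (meson div_le_dividend le_less_trans)
  have env: "env \<sigma>" using cfg by (simp add: config_def)
  have u: "?u j = (if D then if W > 1 then B j div 4 else B j
      else threshold q (Suc levels) (B j) (N div base ^ (k * d) div base ^ (j - 1) mod base))" for j
    by (simp add: round_threshold_def guess_def base_def power_add div_mult2_eq)
  have Suc_k: "N div base ^ (k * d) div base ^ d = N div base ^ (Suc k * d)"
    by (simp add: power_add div_mult2_eq[symmetric] mult.commute)
  show ?thesis
  proof (rule runs_Seq[OF runs_thresholds[OF env D X(1) Xl u]])
    fix \<sigma>1
    assume 1: "(\<forall>j\<in>{1..d}. \<sigma>1 17 j = ?u j) \<and> (\<not> D \<longrightarrow> \<sigma>1 11 0 = N div base ^ (k * d) div base ^ d)"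
      "\<And>a. a \<notin> writes (thresholds_prog d) \<Longrightarrow> \<sigma>1 a = \<sigma> a"
    have fr1: "\<sigma>1 a = \<sigma> a" if "a \<notin> {4, 11, 17, 27}" for a
      using 1(2)[of a] that by (auto simp: thresholds_prog_def)
    have cfg1: "config C \<sigma>1" by (rule config_frame[OF cfg]) (use fr1 in auto)
    show "runs (2 ^ \<beta>) (scan_prog d s ;; add_prog d) \<sigma>1 (m * (7 * d + 14) + 4 + (3 * d + 5))
      (\<lambda>\<sigma>'. \<exists>C'. attempt D N (Suc k) C' \<and> config C' \<sigma>' \<and> \<sigma>' 15 0 = sum p C' \<and>
        \<sigma>' 12 0 = (if D then 1 else 0) \<and> (\<not> D \<longrightarrow> \<sigma>' 11 0 = N div base ^ (Suc k * d)))"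
    proof (rule runs_Seq[OF runs_scan[OF cfg1 _ _ refl]])
      fix \<sigma>2
      assume 2: "scanned D C ?V m \<sigma>2" "\<And>a. a \<notin> writes (scan_prog d s) \<Longrightarrow> \<sigma>2 a = \<sigma>1 a"
      have fr2: "\<sigma>2 a = \<sigma>1 a" if "a \<notin> {4, 18, 19, 20, 21, 22, 23, 24, 26}" for a
        using 2(2)[of a] that by (auto simp: scan_prog_def item_prog_def)
      have cfg2: "config C \<sigma>2" by (rule config_frame[OF cfg1]) (use fr2 in auto)
      have P2: "\<sigma>2 15 0 = sum p C" using P fr1 fr2 by simp
      show "runs (2 ^ \<beta>) (add_prog d) \<sigma>2 (3 * d + 5)
        (\<lambda>\<sigma>'. \<exists>C'. attempt D N (Suc k) C' \<and> config C' \<sigma>' \<and> \<sigma>' 15 0 = sum p C' \<and>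
          \<sigma>' 12 0 = (if D then 1 else 0) \<and> (\<not> D \<longrightarrow> \<sigma>' 11 0 = N div base ^ (Suc k * d)))"
      proof (rule runs_weaken[OF runs_add[OF cfg2 2(1) refl P2 Cm] order_refl])
        fix \<sigma>3
        assume 3: "\<exists>C'. select p ?V (score D C) C C' \<and> config C' \<sigma>3 \<and> \<sigma>3 15 0 = sum p C'"
          "\<And>a. a \<notin> writes (add_prog d) \<Longrightarrow> \<sigma>3 a = \<sigma>2 a"
        have "\<sigma>3 11 = \<sigma>1 11" "\<sigma>3 12 = \<sigma> 12"
          using 3(2)[of 11] 3(2)[of 12] fr2 fr1 by (simp_all add: add_prog_def)
        then show "\<exists>C'. attempt D N (Suc k) C' \<and> config C' \<sigma>3 \<and> \<sigma>3 15 0 = sum p C' \<and>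
          \<sigma>3 12 0 = (if D then 1 else 0) \<and> (\<not> D \<longrightarrow> \<sigma>3 11 0 = N div base ^ (Suc k * d))"
          using 3(1) greedy_Suc[OF C] 1(1) D Suc_k by auto
      qed
    qed (use 1 fr1 D in auto)
  qed auto
qed

definition attempt_steps :: nat where
  "attempt_steps = m * (m * (7 * d + 14) + 10 * d + 13) + 3 * m + 3 * d + 10"

lemma runs_attempt:
  assumes env: "env \<sigma>" and N: "\<sigma> 10 0 = N" "N \<le> guesses" and D: "D \<longleftrightarrow> \<not> N < guesses"
  shows "runs (2 ^ \<beta>) (attempt_prog d s) \<sigma> attempt_steps
    (\<lambda>\<sigma>'. \<exists>C. attempt D N m C \<and> config C \<sigma>' \<and> \<sigma>' 15 0 = sum p C)"
proof -
  have Nl: "N < 2 ^ \<beta>" using N(2) large(2) by linarith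
  \<comment> \<open>Truncated subtraction yields the flag: it is 1 exactly for the last attempt,
    \<open>N = guesses\<close>.\<close>
  have dens: "N + 1 - guesses = (if D then 1 else 0)" using N(2) D by auto
  define clear1 where "clear1 = For row_reg count_expr (Write chosen_arr (Var row_reg) (Const 0))"
  define clear2 where "clear2 = For dim_reg (Const (d + 1)) (Write load_arr (Var dim_reg) (Const 0))"
  define rounds where "rounds = For round_reg count_expr (thresholds_prog d ;; scan_prog d s ;; add_prog d)"
  have clear1: "runs (2 ^ \<beta>) clear1 \<tau> (3 * m + 1) (\<lambda>\<sigma>'. \<forall>r<m. \<sigma>' 13 r = 0)"
    if "env \<tau>" "\<tau> 21 0 = 0" for \<tau>
    unfolding clear1_def
  proof (rule runs_For[where T = 1 and N = m and I = "\<lambda>i \<sigma>'. \<forall>r<i. \<sigma>' 13 r = 0"], goal_cases)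
    case (6 i \<sigma>')
    then show ?case using that A_count by (simp add: env_def)
  qed (use that in \<open>auto simp: less_Suc_eq\<close>)
  have clear2: "runs (2 ^ \<beta>) clear2 \<tau> (3 * d + 1) (\<lambda>\<sigma>'. \<forall>j\<in>{1..d}. \<sigma>' 14 j = 0)"
    if "\<tau> 4 0 = 1" for \<tau>
    unfolding clear2_def
    by (rule runs_For[where T = 1 and N = "d + 1" and I = "\<lambda>i \<sigma>'. \<forall>j\<in>{1..<i}. \<sigma>' 14 j = 0"])
      (use that in \<open>auto simp: less_Suc_eq\<close>)
  let ?Q = "\<lambda>k \<sigma>'. \<exists>C. attempt D N k C \<and> config C \<sigma>' \<and> \<sigma>' 15 0 = sum p C \<and>
      \<sigma>' 12 0 = (if D then 1 else 0) \<and> (\<not> D \<longrightarrow> \<sigma>' 11 0 = N div base ^ (k * d))"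
  have rounds: "runs (2 ^ \<beta>) rounds \<tau> (m * (m * (7 * d + 14) + 10 * d + 13) + 1)
      (\<lambda>\<sigma>'. \<exists>C. attempt D N m C \<and> config C \<sigma>' \<and> \<sigma>' 15 0 = sum p C)"
    if \<tau>: "config {} \<tau>" "\<tau> 15 0 = 0" "\<tau> 12 0 = (if D then 1 else 0)" "\<tau> 11 0 = N" "\<tau> 16 0 = 0" for \<tau>
    unfolding rounds_def
  proof (rule runs_For[where T = "m * (7 * d + 14) + 10 * d + 11" and N = m and I = ?Q], goal_cases)
    case 1
    then show ?case using \<tau> greedy_0 by (auto intro!: exI[of _ "{}"])
  next
    case (5 k \<sigma>')
    then obtain C where C: "attempt D N k C" "config C \<sigma>'" "\<sigma>' 15 0 = sum p C"
      "\<sigma>' 12 0 = (if D then 1 else 0)" "\<not> D \<Longrightarrow> \<sigma>' 11 0 = N div base ^ (k * d)" by blast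
    show ?case
    proof (rule runs_weaken[OF runs_round[OF C(2,4,5) Nl C(1,3)] order_refl])
      fix \<sigma>'' assume "?Q (Suc k) \<sigma>''"
      then obtain C' where C': "attempt D N (Suc k) C'" "config C' \<sigma>''" "\<sigma>'' 15 0 = sum p C'"
        "\<sigma>'' 12 0 = (if D then 1 else 0)" "\<not> D \<longrightarrow> \<sigma>'' 11 0 = N div base ^ (Suc k * d)" by blast
      have "config C' (\<sigma>''(16 := (\<sigma>'' 16)(0 := Suc k)))" by (rule config_frame[OF C'(2)]) auto
      then show "?Q (Suc k) (\<sigma>''(16 := (\<sigma>'' 16)(0 := Suc k)))"
        using C'(1,3-5) by (intro exI[of _ C']) simp
    qed
  next
    case (6 k \<sigma>')
    then show ?case using A_count by (auto simp: config_def env_def)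
  next
    case 4
    show ?case by (simp add: thresholds_prog_def scan_prog_def add_prog_def item_prog_def)
  next
    case (7 \<sigma>')
    then show ?case by blast
  next
    case 8
    have "m * (7 * d + 14) + 10 * d + 11 + 2 = m * (7 * d + 14) + 10 * d + 13" by simp
    then show ?case using \<tau>(5) by simp
  qed (use \<tau> in simp_all)
  have part3: "runs (2 ^ \<beta>) (profit_reg ::= Const 0 ;; round_reg ::= Const 0 ;; rounds) \<tau>
      (m * (m * (7 * d + 14) + 10 * d + 13) + 3)
      (\<lambda>\<sigma>'. \<exists>C. attempt D N m C \<and> config C \<sigma>' \<and> \<sigma>' 15 0 = sum p C)"
    if \<tau>: "config {} \<tau>" "\<tau> 12 0 = (if D then 1 else 0)" "\<tau> 11 0 = N" for \<tau>
    unfolding runs_Seq_Write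
  proof (intro conjI, goal_cases)
    case 5
    show ?case
      by (rule runs_weaken[OF rounds]) (use \<tau> in \<open>auto intro: config_frame[OF \<tau>(1)]\<close>)
  qed auto
  have part2: "runs (2 ^ \<beta>) (dim_reg ::= Const 1 ;; clear2 ;;
        profit_reg ::= Const 0 ;; round_reg ::= Const 0 ;; rounds) \<tau>
      (m * (m * (7 * d + 14) + 10 * d + 13) + 3 * d + 5)
      (\<lambda>\<sigma>'. \<exists>C. attempt D N m C \<and> config C \<sigma>' \<and> \<sigma>' 15 0 = sum p C)"
    if \<tau>: "env \<tau>" "\<forall>r<m. \<tau> 13 r = 0" "\<tau> 12 0 = (if D then 1 else 0)" "\<tau> 11 0 = N" for \<tau>
    unfolding runs_Seq_Write
  proof (intro conjI, goal_cases)
    case 3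
    show ?case
    proof (rule runs_Seq[OF clear2 part3])
      fix \<sigma>' assume l: "\<forall>j\<in>{1..d}. \<sigma>' 14 j = 0"
        and "\<And>a. a \<notin> writes clear2 \<Longrightarrow> \<sigma>' a = (\<tau>(4 := (\<tau> 4)(eval_expr (Const 0) \<tau> := eval_expr (Const 1) \<tau>))) a"
      then have fr: "\<sigma>' a = \<tau> a" if "a \<notin> {4, 14}" for a using that by (simp add: clear2_def)
      have "env \<sigma>'" by (rule env_frame[OF \<tau>(1)]) (use fr in auto)
      then show "config {} \<sigma>'" using l fr[of 13] \<tau>(2) by (simp add: config_def load_def)
      show "\<sigma>' 12 0 = (if D then 1 else 0)" "\<sigma>' 11 0 = N" using fr \<tau> by simp_all
    qed auto
  qed auto
  have "runs (2 ^ \<beta>) (digits_reg ::= Var guess_reg ;;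
      density_reg ::= Sub (Add (Var guess_reg) (Const 1)) (Var guesses_reg) ;;
      row_reg ::= Const 0 ;; clear1 ;; dim_reg ::= Const 1 ;; clear2 ;;
        profit_reg ::= Const 0 ;; round_reg ::= Const 0 ;; rounds) \<sigma> attempt_steps
      (\<lambda>\<sigma>'. \<exists>C. attempt D N m C \<and> config C \<sigma>' \<and> \<sigma>' 15 0 = sum p C)"
  proof -
    have main: "runs (2 ^ \<beta>) (clear1 ;; dim_reg ::= Const 1 ;; clear2 ;;
        profit_reg ::= Const 0 ;; round_reg ::= Const 0 ;; rounds) \<tau> (attempt_steps - 3)
      (\<lambda>\<sigma>'. \<exists>C. attempt D N m C \<and> config C \<sigma>' \<and> \<sigma>' 15 0 = sum p C)"
      if \<tau>: "env \<tau>" "\<tau> 12 0 = (if D then 1 else 0)" "\<tau> 11 0 = N" "\<tau> 21 0 = 0" for \<tau>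
    proof (rule runs_Seq[OF clear1[OF \<tau>(1,4)] part2])
      fix \<sigma>' assume "\<And>a. a \<notin> writes clear1 \<Longrightarrow> \<sigma>' a = \<tau> a"
      then have fr: "\<sigma>' a = \<tau> a" if "a \<notin> {13, 21}" for a using that by (simp add: clear1_def)
      show "env \<sigma>'" by (rule env_frame[OF \<tau>(1)]) (use fr in auto)
      show "\<sigma>' 12 0 = (if D then 1 else 0)" "\<sigma>' 11 0 = N" using fr \<tau> by simp_all
    qed (auto simp: attempt_steps_def)
    have n: "attempt_steps \<ge> 3" by (simp add: attempt_steps_def)
    have [simp]: "\<sigma> 8 0 = guesses" using env by (simp add: env_def)
    have "runs (2 ^ \<beta>) (clear1 ;; dim_reg ::= Const 1 ;; clear2 ;;
        profit_reg ::= Const 0 ;; round_reg ::= Const 0 ;; rounds)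
        (\<sigma>(11 := (\<sigma> 11)(0 := N), 12 := (\<sigma> 12)(0 := if D then 1 else 0), 21 := (\<sigma> 21)(0 := 0))) (attempt_steps - 3)
      (\<lambda>\<sigma>'. \<exists>C. attempt D N m C \<and> config C \<sigma>' \<and> \<sigma>' 15 0 = sum p C)"
      by (rule main) (auto intro: env_frame[OF env])
    then show ?thesis using n N(1) Nl dens by (simp add: numeral_3_eq_3, intro conjI; linarith)
  qed
  then show ?thesis by (simp only: attempt_prog_def clear1_def clear2_def rounds_def)
qed

lemma runs_record:
  assumes cfg: "config C \<sigma>" and P: "\<sigma> 15 0 = sum p C" and C: "C \<subseteq> {..<m}"
    and ident_less: "\<And>r. r < m \<Longrightarrow> ident r < 2 ^ \<beta>"
  shows "runs (2 ^ \<beta>) (record_prog d) \<sigma> (5 * m + 5)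
    (\<lambda>\<sigma>'. if sum p C > \<sigma> 25 0 then \<sigma>' 25 0 = sum p C \<and> output_items \<sigma>' = ident ` C
       else \<sigma>' 25 = \<sigma> 25 \<and> \<sigma>' 1 = \<sigma> 1)"
proof (cases "sum p C > \<sigma> 25 0")
  case False
  then show ?thesis using P by (simp add: record_prog_def)
next
  case True
  have loop: "runs (2 ^ \<beta>) (For row_reg count_expr
        (If (Read chosen_arr (Var row_reg))
          (output_arr ::= Add (Var output_arr) (Const 1) ;;
           Write output_arr (Var output_arr) (ident_at d (Var row_reg)))
          Skip)) \<tau> (5 * m + 1) (\<lambda>\<sigma>'. \<sigma>' 25 0 = sum p C \<and> output_items \<sigma>' = ident ` C)"
    if \<tau>: "\<tau> 25 0 = sum p C" "\<tau> 1 0 = 0" "\<tau> 21 0 = 0" "\<And>a. a \<notin> {1, 21, 25} \<Longrightarrow> \<tau> a = \<sigma> a" for \<tau>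
  proof (rule runs_For[where T = 3 and N = m
        and I = "\<lambda>i \<sigma>'. output_items \<sigma>' = ident ` (C \<inter> {..<i}) \<and> \<sigma>' 1 0 \<le> i"], goal_cases)
    case (5 i \<sigma>')
    have [simp]: "\<sigma>' 0 = A" "\<sigma>' 13 i = (if i \<in> C then 1 else 0)" "\<sigma>' 21 0 = i"
      using 5(2,3) 5(5)[of 0] 5(5)[of 13] \<tau>(4)[of 0] \<tau>(4)[of 13] cfg
      by (auto simp: config_def env_def)
    have [simp]: "A (row_cell d i 0) = ident i" using A_ident 5 by simp
    show ?case
    proof (cases "i \<in> C")
      case True
      have k: "Suc (\<sigma>' 1 0) < 2 ^ \<beta>" using 5 const_less(3) by linarith
      \<comment> \<open>The new name goes to the cell after the last entry, so neither the counter
        in cell 0 nor earlier entries are overwritten.\<close>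
      have "{Suc 0..Suc (\<sigma>' 1 0)} \<inter> {x. x \<noteq> Suc (\<sigma>' 1 0)} = {Suc 0..\<sigma>' 1 0}" by auto
      moreover have "C \<inter> {..<Suc i} = insert i (C \<inter> {..<i})" using True by auto
      ultimately show ?thesis using 5(2,4) True k ident_less[of i]
        by (simp add: output_items_def fun_upd_image)
    next
      case False
      then have "C \<inter> {..<Suc i} = C \<inter> {..<i}" by (auto simp: less_Suc_eq)
      then show ?thesis using 5(4) False by (simp add: output_items_def)
    qed
  next
    case (6 i \<sigma>')
    then have "\<sigma>' 0 = A" using \<tau>(4)[of 0] cfg by (simp add: config_def env_def)
    then show ?case using A_count by simp
  next
    case (7 \<sigma>')
    have "C \<inter> {..<m} = C" using C by auto
    then show ?case using 7 \<tau>(1) by simp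
  qed (use \<tau> in \<open>auto simp: output_items_def\<close>)
  have "runs (2 ^ \<beta>) (record_prog d) \<sigma> (5 * m + 5) (\<lambda>\<sigma>'. \<sigma>' 25 0 = sum p C \<and> output_items \<sigma>' = ident ` C)"
    unfolding record_prog_def runs_If runs_Seq_Write
    using True P sum_profit_less[OF C]
      loop[of "\<sigma>(25 := (\<sigma> 25)(0 := sum p C), 1 := (\<sigma> 1)(0 := 0), 21 := (\<sigma> 21)(0 := 0))"]
    by simp
  then show ?thesis using True by simp
qed

end

section \<open>Verification of the preprocessing and of the whole program\<close>

context packing begin

text \<open>Zero budgets count as factor 1, so intermediate products divide the final one and never
  exceed it.\<close>

lemma scale_partial_le:
  assumes "i \<le> Suc d"
  shows "(\<Prod>j\<in>{1..<i}. if B j = 0 then 1 else B j) \<le> scale"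
proof -
  have "(\<Prod>j\<in>{1..<i}. if B j = 0 then 1 else B j) dvd scale"
    unfolding scale_def using assms by (intro prod_dvd_prod_subset) auto
  then show ?thesis using scale_pos by (rule dvd_imp_le)
qed

lemma top_budget_eq: "d \<ge> 1 \<Longrightarrow> top_budget = Max (insert 0 (B ` {1..d}))"
  unfolding top_budget_def by (subst Max_insert) auto

end

context machine begin

lemma runs_init:
  assumes \<sigma>: "\<sigma> 0 = A"
  shows "runs (2 ^ \<beta>) (init_prog d) \<sigma> (6 * d + 4) (\<lambda>\<sigma>'. \<sigma>' 2 0 = W \<and> \<sigma>' 3 0 = scale)"
proof -
  let ?b = "\<lambda>j. if B j = 0 then 1 else B j"
  define mx where "mx i = Max (insert 0 (B ` {1..<i}))" for i
  define pr where "pr i = (\<Prod>j\<in>{1..<i}. ?b j)" for i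
  have range: "{1..<Suc d} = {1..d}" by auto
  have Suc_simps: "mx (Suc i) = max (mx i) (B i)" "pr (Suc i) = pr i * ?b i" if "i \<in> {1..d}" for i
  proof -
    have "{1..<Suc i} = insert i {1..<i}" using that by auto
    then have "insert 0 (B ` {1..<Suc i}) = insert (B i) (insert 0 (B ` {1..<i}))" by auto
    then show "mx (Suc i) = max (mx i) (B i)" unfolding mx_def by (simp add: max.commute)
    show "pr (Suc i) = pr i * ?b i" using that by (simp add: pr_def prod.atLeastLessThan_Suc)
  qed
  have pr_less: "pr i < 2 ^ \<beta>" if "i \<le> Suc d" for i
    unfolding pr_def using scale_partial_le[OF that] small(4) pow_less1 by (meson le_less_trans)
  have main: "runs (2 ^ \<beta>) (For dim_reg (Const (d + 1))
       (If budget_at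
         (scale_reg ::= Mul (Var scale_reg) budget_at ;;
          If (Sub budget_at (Var top_reg)) (top_reg ::= budget_at) Skip)
         Skip)) \<tau> (6 * d + 1) (\<lambda>\<sigma>'. \<sigma>' 2 0 = W \<and> \<sigma>' 3 0 = scale)"
    if \<tau>: "\<tau> 2 0 = 0" "\<tau> 3 0 = 1" "\<tau> 4 0 = 1" "\<tau> 0 = A" for \<tau>
  proof (rule runs_For[where T = 4 and N = "d + 1" and I = "\<lambda>i \<sigma>'. \<sigma>' 2 0 = mx i \<and> \<sigma>' 3 0 = pr i"], goal_cases)
    case 1
    then show ?case using \<tau> by (simp add: mx_def pr_def)
  next
    case (5 i \<sigma>')
    have i: "i \<in> {1..d}" using 5 \<tau> by auto
    have [simp]: "\<sigma>' 0 = A" using 5(5)[of 0] \<tau> by simp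
    have [simp]: "A (Suc i) = B i" using A_budget[OF i] by simp
    have Bi: "B i < 2 ^ \<beta>" using budget_less[OF i] pow_less1 by blast
    have pri: "pr i * ?b i < 2 ^ \<beta>" using pr_less[of "Suc i"] Suc_simps(2)[OF i] i by simp
    show ?case
      using 5(3,4) Bi pri Suc_simps[OF i] by (cases "B i = 0") (auto simp: max_def)
  next
    case (7 \<sigma>')
    have "mx (Suc d) = W" unfolding mx_def range using top_budget_eq d_pos by simp
    moreover have "pr (Suc d) = scale" unfolding pr_def range scale_def by simp
    ultimately show ?case using 7 by simp
  qed (use \<tau> in auto)
  show ?thesis
    unfolding init_prog_def runs_Seq_Write
    using main[of "\<sigma>(2 := (\<sigma> 2)(0 := 0), 3 := (\<sigma> 3)(0 := 1), 4 := (\<sigma> 4)(0 := 1))"] \<sigma>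
    by simp
qed

lemma runs_grid:
  assumes \<sigma>: "\<sigma> 2 0 = W"
  shows "runs (2 ^ \<beta>) (grid_prog d) \<sigma> (3 * levels + 5)
    (\<lambda>\<sigma>'. (\<forall>k\<le>levels. \<sigma>' 5 k = grid q k) \<and> \<sigma>' 6 0 = Suc levels \<and> \<sigma>' 7 0 = base)"
proof -
  let ?body = "(Write grid_arr (Add (Var levels_reg) (Const 1))
          (Add (Add (Read grid_arr (Var levels_reg)) (Const 1))
            (Div (Read grid_arr (Var levels_reg)) (Const (6 * d + 1)))) ;;
        levels_reg ::= Add (Var levels_reg) (Const 1))"
  have levels_less: "Suc levels < 2 ^ \<beta>" "base < 2 ^ \<beta>" using large(3) by (simp_all add: base_def)
  have loop: "runs (2 ^ \<beta>) (While (Sub (Var top_reg) (Read grid_arr (Var levels_reg))) ?body) \<tau>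
      (3 * levels + 1) (\<lambda>\<sigma>'. \<sigma>' 6 0 = levels \<and> (\<forall>k\<le>levels. \<sigma>' 5 k = grid q k))"
    if \<tau>: "\<tau> 6 0 = 0" "\<tau> 5 0 = 0" "\<tau> 2 0 = W" for \<tau>
  proof (rule runs_While[where T = 2 and l = 0 and N = levels
        and I = "\<lambda>i \<sigma>'. \<sigma>' 6 0 = i \<and> (\<forall>k\<le>i. \<sigma>' 5 k = grid q k)"], goal_cases)
    case (3 i \<sigma>')
    have lt: "grid q i < W" using grid_less_top 3(2) .
    have W: "\<sigma>' 2 0 = W" using 3(4)[of 2] \<tau> by simp
    have "grid q (Suc i) < 2 ^ \<beta>" by (rule grid_less) (use 3(2) in simp)
    moreover have "Suc i < 2 ^ \<beta>" using 3(2) levels_less by simp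
    moreover have "\<sigma>' 6 0 = i" "\<sigma>' 5 i = grid q i" using 3(3) by simp_all
    ultimately show ?case using lt W 3(3) by (auto simp: le_Suc_eq)
  next
    case (4 \<sigma>')
    then show ?case using top_le_grid 4(2)[of 2] \<tau> by simp
  qed (use \<tau> in auto)
  have tail: "runs (2 ^ \<beta>) (While (Sub (Var top_reg) (Read grid_arr (Var levels_reg))) ?body ;;
      levels_reg ::= Add (Var levels_reg) (Const 1) ;; base_reg ::= Mul (Const 2) (Var levels_reg)) \<tau>
      (3 + 3 * levels) (\<lambda>\<sigma>'. (\<forall>k\<le>levels. \<sigma>' 5 k = grid q k) \<and> \<sigma>' 6 0 = Suc levels \<and> \<sigma>' 7 0 = base)"
    if \<tau>: "\<tau> 6 0 = 0" "\<tau> 5 0 = 0" "\<tau> 2 0 = W" for \<tau>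
    by (rule runs_Seq[OF loop[of \<tau>, OF \<tau>], where n' = 2])
      (use levels_less in \<open>auto simp: base_def\<close>)
  show ?thesis
    unfolding grid_prog_def runs_Seq_Write
    using tail[of "\<sigma>(6 := (\<sigma> 6)(0 := 0), 5 := (\<sigma> 5)(0 := 0))"] \<sigma>
    by simp
qed

lemma runs_guesses:
  assumes \<sigma>: "\<sigma> 2 0 = W" "\<sigma> 7 0 = base"
  shows "runs (2 ^ \<beta>) (guesses_prog d) \<sigma> (9 * d * d + 4) (\<lambda>\<sigma>'. \<sigma>' 8 0 = guesses)"
proof -
  have e: "3 * d * d < 2 ^ \<beta>"
  proof -
    have "3 * d * d \<le> (6 * d + 6) * (6 * d + 6)" by (intro mult_mono) auto
    also have "\<dots> < 2 ^ \<nu> * 2 ^ \<nu>" using small(1) by (intro mult_strict_mono) auto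
    also have "\<dots> = 2 ^ (2 * \<nu>)" by (simp flip: power_add add: mult_2)
    finally show ?thesis by (rule pow_less) simp
  qed
  have loop: "runs (2 ^ \<beta>) (For exponent_reg (Const (3 * d * d)) (guesses_reg ::= Mul (Var guesses_reg) (Var base_reg)))
      \<tau> (9 * d * d + 1) (\<lambda>\<sigma>'. \<sigma>' 8 0 = guesses)"
    if \<tau>: "\<tau> 8 0 = 1" "\<tau> 9 0 = 0" "\<tau> 7 0 = base" and W: "\<not> W \<le> 1" for \<tau>
  proof (rule runs_For[where T = 1 and N = "3 * d * d" and I = "\<lambda>i \<sigma>'. \<sigma>' 8 0 = base ^ i"], goal_cases)
    case (5 i \<sigma>')
    have "base ^ Suc i \<le> base ^ (3 * d * d)"
      using 5(2) base_pos by (intro power_increasing) auto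
    also have "\<dots> = guesses" using W by (simp add: guesses_def base_def)
    finally have "base ^ i * base < 2 ^ \<beta>" using large(2) by (simp add: mult.commute)
    then show ?case using 5(4) 5(5)[of 7] \<tau>(3) by (simp add: mult.commute)
  next
    case (7 \<sigma>')
    then show ?case using W by (simp add: guesses_def base_def)
  qed (use \<tau> e in auto)
  show ?thesis
  proof (cases "W \<le> 1")
    case True
    then show ?thesis using \<sigma> by (simp add: guesses_prog_def guesses_def)
  next
    case False
    then show ?thesis
      using loop[of "\<sigma>(8 := (\<sigma> 8)(0 := 1), 9 := (\<sigma> 9)(0 := 0))"] \<sigma>
      by (simp add: guesses_prog_def)
  qed
qed

text \<open>Greedy runs are fixed only up to ties, so each attempt is recorded existentially,
  together with the fact that its profit does not exceed the stored best one.\<close>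

definition found :: "nat \<Rightarrow> memory \<Rightarrow> bool" where
  "found k \<sigma> \<longleftrightarrow> env \<sigma> \<and>
     (\<exists>C. feasible C \<and> sum p C = \<sigma> 25 0 \<and> output_items \<sigma> = ident ` C) \<and>
     (\<forall>N<k. \<exists>C. attempt (\<not> N < guesses) N m C \<and> sum p C \<le> \<sigma> 25 0)"

definition total_steps :: nat where
  "total_steps = (guesses + 1) * (attempt_steps + 5 * m + 7) + 6 * d + 3 * levels + 9 * d * d + 16"

lemma runs_knapsack:
  assumes \<sigma>: "\<sigma> 0 = A" "\<sigma> 1 0 = 0" and ident_less: "\<And>r. r < m \<Longrightarrow> ident r < 2 ^ \<beta>"
  shows "runs (2 ^ \<beta>) (knapsack_prog d s) \<sigma> total_steps (found (guesses + 1))"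
proof -
  have body: "runs (2 ^ \<beta>) (attempt_prog d s ;; record_prog d) \<tau> (attempt_steps + 5 * m + 5)
      (\<lambda>\<tau>'. found (Suc N) \<tau>')"
    if \<tau>: "found N \<tau>" "\<tau> 10 0 = N" "N \<le> guesses" for \<tau> N
  proof -
    have env: "env \<tau>" using \<tau>(1) by (simp add: found_def)
    obtain C0 where C0: "feasible C0" "sum p C0 = \<tau> 25 0" "output_items \<tau> = ident ` C0"
      using \<tau>(1) by (auto simp: found_def)
    show ?thesis
    proof (rule runs_Seq[OF runs_attempt[OF env \<tau>(2,3) refl], where n' = "5 * m + 5"])
      fix \<tau>1
      assume "\<exists>C. attempt (\<not> N < guesses) N m C \<and> config C \<tau>1 \<and> \<tau>1 15 0 = sum p C"
        and fr: "\<And>a. a \<notin> writes (attempt_prog d s) \<Longrightarrow> \<tau>1 a = \<tau> a"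
      then obtain C where C: "attempt (\<not> N < guesses) N m C" "config C \<tau>1" "\<tau>1 15 0 = sum p C" by blast
      have feas: "feasible C" by (rule attempt_feasible[OF C(1)])
      have Cm: "C \<subseteq> {..<m}" using feas by (simp add: feasible_def)
      have fr1: "\<tau>1 25 = \<tau> 25" "\<tau>1 1 = \<tau> 1"
        using fr[of 25] fr[of 1]
        by (simp_all add: attempt_prog_def thresholds_prog_def scan_prog_def add_prog_def item_prog_def)
      show "runs (2 ^ \<beta>) (record_prog d) \<tau>1 (5 * m + 5) (\<lambda>\<tau>'. found (Suc N) \<tau>')"
      proof (rule runs_weaken[OF runs_record[OF C(2,3) Cm ident_less] order_refl])
        fix \<tau>2
        assume r: "if \<tau>1 25 0 < sum p C then \<tau>2 25 0 = sum p C \<and> output_items \<tau>2 = ident ` C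
            else \<tau>2 25 = \<tau>1 25 \<and> \<tau>2 1 = \<tau>1 1"
          and fr2: "\<And>a. a \<notin> writes (record_prog d) \<Longrightarrow> \<tau>2 a = \<tau>1 a"
        have "env \<tau>2"
          by (rule env_frame[of \<tau>1]) (use C(2) fr2 in \<open>auto simp: config_def record_prog_def\<close>)
        moreover have "\<exists>C. feasible C \<and> sum p C = \<tau>2 25 0 \<and> output_items \<tau>2 = ident ` C"
        proof (cases "\<tau>1 25 0 < sum p C")
          case True
          then show ?thesis using r feas by (intro exI[of _ C]) simp
        next
          case False
          then have "\<tau>2 25 = \<tau> 25" "output_items \<tau>2 = output_items \<tau>"
            using r fr1 by (simp_all add: output_items_def)
          then show ?thesis using C0 by (intro exI[of _ C0]) simp
        qed
        moreover have mono: "\<tau> 25 0 \<le> \<tau>2 25 0" "sum p C \<le> \<tau>2 25 0"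
          using r fr1 by (auto split: if_splits)
        have "\<exists>C. attempt (\<not> N' < guesses) N' m C \<and> sum p C \<le> \<tau>2 25 0" if "N' < Suc N" for N'
        proof (cases "N' = N")
          case True
          then show ?thesis using C(1) mono(2) by blast
        next
          case False
          then have "N' < N" using that by simp
          then obtain C' where "attempt (\<not> N' < guesses) N' m C'" "sum p C' \<le> \<tau> 25 0"
            using \<tau>(1) by (auto simp: found_def)
          then show ?thesis using mono(1) by (intro exI[of _ C'] conjI) auto
        qed
        ultimately show "found (Suc N) \<tau>2" unfolding found_def by blast
      qed
    qed simp
  qed
  have loop: "runs (2 ^ \<beta>) (For guess_reg (Add (Var guesses_reg) (Const 1)) (attempt_prog d s ;; record_prog d)) \<tau>
      ((guesses + 1) * (attempt_steps + 5 * m + 7) + 1) (found (guesses + 1))"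
    if \<tau>: "found 0 \<tau>" "\<tau> 10 0 = 0" for \<tau>
  proof (rule runs_For[where T = "attempt_steps + 5 * m + 5" and N = "guesses + 1" and I = found], goal_cases)
    case (5 N \<sigma>')
    have "found (Suc N) (\<sigma>''(10 := (\<sigma>'' 10)(0 := Suc N)))" if f: "found (Suc N) \<sigma>''" for \<sigma>''
    proof -
      have "env (\<sigma>''(10 := (\<sigma>'' 10)(0 := Suc N)))"
        by (rule env_frame[of \<sigma>'']) (use f in \<open>auto simp: found_def\<close>)
      then show ?thesis using f by (simp add: found_def output_items_def)
    qed
    then show ?case
      by (intro runs_weaken[OF body[OF 5(4,3)]]) (use 5(2) in auto)
  next
    case (6 N \<sigma>')
    then show ?case by (simp add: found_def env_def)
  next
    case 4
    show ?case by (simp add: attempt_prog_def record_prog_def thresholds_prog_def scan_prog_def add_prog_def item_prog_def)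
  next
    case 8
    then show ?case using \<tau>(2) by simp
  qed (use \<tau> large(2) in simp_all)
  let ?loop = "For guess_reg (Add (Var guesses_reg) (Const 1)) (attempt_prog d s ;; record_prog d)"
  have part3: "runs (2 ^ \<beta>) (best_reg ::= Const 0 ;; guess_reg ::= Const 0 ;; ?loop) \<tau>
      ((guesses + 1) * (attempt_steps + 5 * m + 7) + 3) (found (guesses + 1))"
    if \<tau>: "env \<tau>" "\<tau> 1 0 = 0" for \<tau>
  proof -
    have "env (\<tau>(25 := (\<tau> 25)(0 := 0), 10 := (\<tau> 10)(0 := 0)))"
      by (rule env_frame[OF \<tau>(1)]) auto
    then have "found 0 (\<tau>(25 := (\<tau> 25)(0 := 0), 10 := (\<tau> 10)(0 := 0)))"
      using \<tau>(2) by (auto simp: found_def output_items_def feasible_def load_def intro!: exI[of _ "{}"])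
    from loop[OF this] show ?thesis unfolding runs_Seq_Write by simp
  qed
  have "runs (2 ^ \<beta>) (init_prog d ;; grid_prog d ;; guesses_prog d ;;
      best_reg ::= Const 0 ;; guess_reg ::= Const 0 ;; ?loop) \<sigma> total_steps (found (guesses + 1))"
  proof (rule runs_Seq[OF runs_init[where \<sigma> = \<sigma>, OF \<sigma>(1)], rotated])
    fix \<sigma>1
    assume 1: "\<sigma>1 2 0 = W \<and> \<sigma>1 3 0 = scale" "\<And>a. a \<notin> writes (init_prog d) \<Longrightarrow> \<sigma>1 a = \<sigma> a"
    have fr1: "\<sigma>1 0 = \<sigma> 0" "\<sigma>1 1 = \<sigma> 1" using 1(2) by (simp_all add: init_prog_def)
    show "runs (2 ^ \<beta>) (grid_prog d ;; guesses_prog d ;;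
      best_reg ::= Const 0 ;; guess_reg ::= Const 0 ;; ?loop) \<sigma>1
      ((guesses + 1) * (attempt_steps + 5 * m + 7) + 3 + (9 * d * d + 4) + (3 * levels + 5)) (found (guesses + 1))"
    proof (rule runs_Seq[OF runs_grid, rotated])
      fix \<sigma>2
      assume 2: "(\<forall>k\<le>levels. \<sigma>2 5 k = grid q k) \<and> \<sigma>2 6 0 = Suc levels \<and> \<sigma>2 7 0 = base"
        "\<And>a. a \<notin> writes (grid_prog d) \<Longrightarrow> \<sigma>2 a = \<sigma>1 a"
      have fr2: "\<sigma>2 a = \<sigma>1 a" if "a \<notin> {5, 6, 7}" for a using 2(2)[of a] that by (simp add: grid_prog_def)
      show "runs (2 ^ \<beta>) (guesses_prog d ;; best_reg ::= Const 0 ;; guess_reg ::= Const 0 ;; ?loop) \<sigma>2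
        ((guesses + 1) * (attempt_steps + 5 * m + 7) + 3 + (9 * d * d + 4)) (found (guesses + 1))"
      proof (rule runs_Seq[OF runs_guesses part3])
        fix \<sigma>3
        assume 3: "\<sigma>3 8 0 = guesses" "\<And>a. a \<notin> writes (guesses_prog d) \<Longrightarrow> \<sigma>3 a = \<sigma>2 a"
        have fr3: "\<sigma>3 a = \<sigma>2 a" if "a \<notin> {8, 9}" for a using 3(2)[of a] that by (simp add: guesses_prog_def)
        show "env \<sigma>3" using 1(1) 2(1) 3(1) fr1 fr2 fr3 \<sigma> by (simp add: env_def)
        show "\<sigma>3 1 0 = 0" using fr1 fr2 fr3 \<sigma> by simp
      qed (use 1 2 fr2 in auto)
    qed (use 1 in auto)
  qed (simp add: total_steps_def)
  then show ?thesis by (simp only: knapsack_prog_def)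
qed

text \<open>Specialising the flag identifies the attempts with the runs analysed before: number
  \<open>guesses\<close> is the density greedy run, all smaller numbers are guesses.\<close>

lemma found_approximates:
  assumes f: "found (guesses + 1) \<sigma>" and S: "feasible S" and s: "s \<ge> 1" "d < (s + 1) * (s + 1)"
  shows "sum p S \<le> 25 * s * \<sigma> 25 0"
proof -
  have att: "\<exists>C. attempt (\<not> N < guesses) N m C \<and> sum p C \<le> \<sigma> 25 0" if "N \<le> guesses" for N
  proof -
    have "N < guesses + 1" using that by simp
    then show ?thesis using f unfolding found_def by blast
  qed
  have score: "score True = weight s" "score False = (\<lambda>_ _. 1)"
    by (auto simp: score_def fun_eq_iff)
  have thr: "round_threshold False N = guess q (Suc levels) N" for N
    by (auto simp: round_threshold_def fun_eq_iff)
  have admissibleF: "admissible False = (\<lambda>_. True)" by (auto simp: admissible_def)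
  obtain C where C: "attempt True guesses m C" "sum p C \<le> \<sigma> 25 0" using att[of guesses] by auto
  show ?thesis
  proof (cases "W \<le> 1")
    case True
    have thr1: "round_threshold True N k = B" for N k using True by (auto simp: round_threshold_def fun_eq_iff)
    have admissibleT: "admissible True = (\<lambda>i. (\<Sum>j\<in>{1..d}. c i j) \<le> s)" using True by (auto simp: admissible_def fun_eq_iff)
    have "guesses = 1" using True by (simp add: guesses_def)
    then obtain C' where C': "attempt False 0 m C'" "sum p C' \<le> \<sigma> 25 0" using att[of 0] by auto
    show ?thesis
    proof (rule approximation_unit_budgets[OF S _ s _ C(2) _ C'(2)])
      show "B j \<le> 1" if "j \<in> {1..d}" for j using budget_le_top[OF that] True by simp
      show "greedy p (\<lambda>_. cand B (\<lambda>i. (\<Sum>j\<in>{1..d}. c i j) \<le> s)) (weight s) m C"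
        using C(1) unfolding thr1 admissibleT score .
      show "greedy p (\<lambda>k. cand (guess q (Suc levels) 0 k) (\<lambda>_. True)) (\<lambda>_ _. 1) m C'"
        using C'(1) unfolding thr admissibleF score .
    qed simp
  next
    case False
    have thr1: "round_threshold True N k = (\<lambda>j. B j div 4)" for N k
      using False by (auto simp: round_threshold_def fun_eq_iff)
    have admissibleT: "admissible True = (\<lambda>_. True)" using False by (auto simp: admissible_def fun_eq_iff)
    show ?thesis
    proof (rule approximation_large_budgets[OF S _ refl s _ C(2)])
      show "B j \<le> grid q levels" if "j \<in> {1..d}" for j
        using budget_le_top[OF that] top_le_grid by simp
      show "greedy p (\<lambda>_. cand (\<lambda>j. B j div 4) (\<lambda>_. True)) (weight s) m C"
        using C(1) unfolding thr1 admissibleT score .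
      fix N assume "N < (2 * Suc levels) ^ (3 * d * d)"
      then have N: "N < guesses" using False by (simp add: guesses_def)
      then show "\<exists>C. greedy p (\<lambda>k. cand (guess q (Suc levels) N k) (\<lambda>_. True)) (\<lambda>_ _. 1) m C \<and> sum p C \<le> \<sigma> 25 0"
        using att[of N] unfolding thr admissibleF score by (auto simp: thr admissibleF score)
    qed
  qed
qed

end

section \<open>Running time and approximation ratio\<close>

text \<open>Each of \<open>q\<close> steps adds at least \<open>1 + grid q k div q\<close>, and
  \<open>q\<close> times this exceeds \<open>grid q k\<close>.\<close>

lemma grid_double: "2 * grid q k + 1 \<le> grid q (k + q)" if "q > 0"
proof -
  have "grid q k + i * (1 + grid q k div q) \<le> grid q (k + i)" for i
  proof (induction i)
    case (Suc i)
    have "grid q k \<le> grid q (k + i)" using grid_strict_mono[of q] by (simp add: strict_mono_less_eq)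
    then have "grid q k div q \<le> grid q (k + i) div q" by (rule div_le_mono)
    then show ?case using Suc by simp
  qed simp
  from this[of q] have "grid q k + (q + q * (grid q k div q)) \<le> grid q (k + q)"
    by (simp add: algebra_simps)
  moreover have "grid q k < q + q * (grid q k div q)"
    using dividend_less_times_div[OF that, of "grid q k"] by simp
  ultimately show ?thesis by linarith
qed

lemma grid_exponential: "q > 0 \<Longrightarrow> 2 ^ t \<le> grid q (q * t) + 1"
proof (induction t)
  case (Suc t)
  have "2 * grid q (q * t) + 1 \<le> grid q (q * Suc t)"
    using grid_double[OF Suc.prems, of "q * t"] by (simp add: add.commute)
  then show ?case using Suc by simp
qed simp

text \<open>The grid doubles every \<open>6 * d + 1\<close> steps, so it passes \<open>W\<close>
  after \<open>O(d log W)\<close> points.\<close>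

lemma (in packing) levels_le: "levels \<le> (6 * d + 1) * floorlog 2 top_budget"
proof -
  have "top_budget < 2 ^ floorlog 2 top_budget"
    by (rule floorlog_leD) auto
  then have "top_budget \<le> grid (6 * d + 1) ((6 * d + 1) * floorlog 2 top_budget)"
    using grid_exponential[of "6 * d + 1" "floorlog 2 top_budget"] by simp
  then show ?thesis unfolding levels_def by (rule Least_le)
qed

lemma nth_concat_uniform:
  assumes "\<And>y. y \<in> set ys \<Longrightarrow> length y = l" "r < length ys" "k < l"
  shows "r * l + k < length (concat ys) \<and> concat ys ! (r * l + k) = ys ! r ! k"
  using assms
proof (induction ys arbitrary: r)
  case (Cons y ys)
  show ?case
  proof (cases r)
    case 0
    then show ?thesis using Cons.prems by (simp add: nth_append)
  next
    case (Suc r')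
    then show ?thesis using Cons.IH[of r'] Cons.prems by (simp add: nth_append)
  qed
qed simp

definition item_row :: "knapsack \<Rightarrow> nat \<Rightarrow> nat" where
  "item_row I r = sorted_list_of_set (items I) ! r"

abbreviation (input) "n_items I \<equiv> card (items I)"

lemma item_row_bij:
  assumes "finite (items I)"
  shows "bij_betw (item_row I) {..<n_items I} (items I)"
  using bij_betw_nth[of "sorted_list_of_set (items I)" "{..<n_items I}" "items I"] assms
  by (simp add: item_row_def[abs_def])

section \<open>Translation between instances, rows and the encoded input\<close>

context
  fixes d :: nat and I :: knapsack
  assumes fin: "finite (items I)" and d: "d \<ge> 1"
begin

interpretation packing d "n_items I" "\<lambda>r. profit I (item_row I r)" "\<lambda>r. cost I (item_row I r)" "budget I" .

lemma feasible_imp_solution: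
  assumes "feasible C"
  shows "solution d I (item_row I ` C)" "total_profit I (item_row I ` C) = (\<Sum>r\<in>C. profit I (item_row I r))"
proof -
  have C: "C \<subseteq> {..<n_items I}" using assms by (simp add: feasible_def)
  then have inj: "inj_on (item_row I) C"
    using item_row_bij[OF fin] by (meson bij_betw_imp_inj_on inj_on_subset)
  have "item_row I ` C \<subseteq> items I" using item_row_bij[OF fin] C by (auto simp: bij_betw_def)
  moreover have "total_cost I j (item_row I ` C) = load C j" for j
    by (simp add: total_cost_def load_def sum.reindex[OF inj])
  ultimately show "solution d I (item_row I ` C)"
    using assms by (simp add: solution_def feasible_def)
  show "total_profit I (item_row I ` C) = (\<Sum>r\<in>C. profit I (item_row I r))"
    by (simp add: total_profit_def sum.reindex[OF inj])
qed

lemma solution_imp_feasible: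
  assumes "solution d I S"
  obtains C where "feasible C" "S = item_row I ` C"
proof -
  define C where "C = {r \<in> {..<n_items I}. item_row I r \<in> S}"
  have inj: "inj_on (item_row I) C"
    using item_row_bij[OF fin] unfolding C_def by (auto simp: bij_betw_def intro: inj_on_subset)
  have "S \<subseteq> item_row I ` {..<n_items I}"
    using assms item_row_bij[OF fin] by (simp add: bij_betw_def solution_def)
  then have S: "S = item_row I ` C" unfolding C_def by auto
  have "total_cost I j S = load C j" for j
    unfolding S by (simp add: total_cost_def load_def sum.reindex[OF inj])
  then have "feasible C" using assms by (auto simp: feasible_def solution_def C_def)
  then show ?thesis using S that by blast
qed

lemma OPT_le:
  assumes "\<And>C. feasible C \<Longrightarrow> (\<Sum>r\<in>C. profit I (item_row I r)) \<le> b"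
  shows "OPT d I \<le> b"
proof -
  have "finite {S. solution d I S}"
    by (rule finite_subset[of _ "Pow (items I)"]) (use fin in \<open>auto simp: solution_def\<close>)
  then have f: "finite {total_profit I S |S. solution d I S}"
    by (simp add: setcompr_eq_image)
  have "solution d I {}" by (simp add: solution_def total_cost_def)
  then have ne: "{total_profit I S |S. solution d I S} \<noteq> {}" by blast
  have "total_profit I S \<le> b" if S: "solution d I S" for S
  proof -
    obtain C where C: "feasible C" "S = item_row I ` C" using solution_imp_feasible[OF S] by blast
    then show ?thesis using feasible_imp_solution(2)[OF C(1)] assms by simp
  qed
  then show ?thesis unfolding OPT_def using Max_in[OF f ne] by auto
qed

lemma size_pos: "size_nat x \<ge> 1"
  by (simp add: size_nat_def)

lemma less_pow_size: "x < 2 ^ size_nat x"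
proof -
  have "x < 2 ^ floorlog 2 x" by (rule floorlog_leD) auto
  also have "\<dots> \<le> 2 ^ size_nat x" unfolding size_nat_def by (intro power_increasing) auto
  finally show ?thesis .
qed

lemma size_le_encoding: "x \<in> set (encode d I) \<Longrightarrow> size_nat x \<le> encoding_size d I"
  unfolding encoding_size_def by (intro member_le_sum_list) auto

lemma encode_eq: "encode d I = [d, n_items I] @ map (budget I) [1..<d+1] @
    concat (map (\<lambda>r. [item_row I r, profit I (item_row I r)] @ map (cost I (item_row I r)) [1..<d+1]) [0..<n_items I])"
proof -
  have "sorted_list_of_set (items I) = map (item_row I) [0..<n_items I]"
    by (rule nth_equalityI) (simp_all add: item_row_def)
  then show ?thesis by (simp add: encode_def comp_def)
qed

lemma length_encode: "length (encode d I) = d + 2 + n_items I * (d + 2)"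
  by (simp add: encode_eq length_concat comp_def sum_list_triv)

text \<open>Every number of the encoding has size at least 1 and the leading \<open>d\<close> at
  least 2; the surplus gives \<open>n >= 4\<close>, by which constants are later absorbed into
  powers of \<open>n\<close>.\<close>

lemma encoding_ge: "d + n_items I + 3 \<le> encoding_size d I"
proof -
  have "d + n_items I + 2 \<le> length (encode d I)" unfolding length_encode by simp
  moreover have "encoding_size d I = size_nat d + (\<Sum>x\<leftarrow>tl (encode d I). size_nat x)"
    by (simp add: encoding_size_def encode_def)
  moreover have "2 \<le> size_nat d"
    using floorlog_geI[where b = 2 and w = 1 and x = d] d by (simp add: size_nat_def)
  moreover have "length (tl (encode d I)) \<le> (\<Sum>x\<leftarrow>tl (encode d I). size_nat x)"
    using sum_list_mono[of "tl (encode d I)" "\<lambda>_. 1" size_nat] size_pos by (simp add: sum_list_triv)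
  ultimately show ?thesis by simp
qed

abbreviation (input) "input_row \<equiv> input_memory d I 0"

lemma input_budget:
  assumes "j \<in> {1..d}"
  shows "input_row (j + 1) = budget I j"
proof -
  obtain i where i: "j = Suc i" "i < d" using assms by (cases j) auto
  have "j + 1 < length (encode d I)" using assms by (simp add: length_encode)
  then show ?thesis using i by (simp add: input_memory_def encode_eq nth_append del: upt_Suc)
qed

lemma input_item:
  assumes "r < n_items I" "k < d + 2"
  shows "input_row (row_cell d r k) =
    ([item_row I r, profit I (item_row I r)] @ map (cost I (item_row I r)) [1..<d+1]) ! k"
proof -
  let ?ys = "map (\<lambda>r. [item_row I r, profit I (item_row I r)] @ map (cost I (item_row I r)) [1..<d+1]) [0..<n_items I]"
  let ?h = "[d, n_items I] @ map (budget I) [1..<d+1]"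
  have enc: "encode d I = ?h @ concat ?ys" using encode_eq by simp
  have c: "r * (d + 2) + k < length (concat ?ys) \<and> concat ?ys ! (r * (d + 2) + k) = ?ys ! r ! k"
    by (rule nth_concat_uniform) (use assms in auto)
  have cell: "row_cell d r k = length ?h + (r * (d + 2) + k)" by (simp add: row_cell_def)
  have "row_cell d r k < length (encode d I)" unfolding enc cell length_append using c by linarith
  then have "input_row (row_cell d r k) = (?h @ concat ?ys) ! (length ?h + (r * (d + 2) + k))"
    unfolding input_memory_def enc[symmetric] cell[symmetric] by simp
  also have "\<dots> = concat ?ys ! (r * (d + 2) + k)" by (rule nth_append_length_plus)
  finally show ?thesis using c assms(1) by simp
qed

lemma input_less: "input_row k < 2 ^ encoding_size d I"
proof (cases "k < length (encode d I)")
  case True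
  let ?x = "encode d I ! k"
  have "?x < 2 ^ size_nat ?x" by (rule less_pow_size)
  also have "\<dots> \<le> 2 ^ encoding_size d I"
    using size_le_encoding[of ?x] True by (intro power_increasing) auto
  finally show ?thesis using True by (simp add: input_memory_def)
qed (simp add: input_memory_def)

text \<open>A product is no longer than its factors written side by side, so integer weights keep
  polynomial length.\<close>

lemma scale_le: "scale \<le> 2 ^ encoding_size d I"
proof -
  have "scale \<le> (\<Prod>j\<in>{1..d}. 2 ^ size_nat (budget I j))"
    unfolding scale_def using less_pow_size by (intro prod_mono) (auto simp: less_imp_le)
  also have "\<dots> = 2 ^ (\<Sum>j\<in>{1..d}. size_nat (budget I j))" by (simp add: power_sum)
  also have "\<dots> \<le> 2 ^ encoding_size d I"
  proof (intro power_increasing)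
    have "(\<Sum>j\<in>{1..d}. size_nat (budget I j)) = (\<Sum>x\<leftarrow>map (budget I) [1..<d+1]. size_nat x)"
      by (simp add: interv_sum_list_conv_sum_set_nat atLeastLessThanSuc_atLeastAtMost comp_def del: upt_Suc)
    also have "\<dots> \<le> encoding_size d I" by (simp add: encoding_size_def encode_def del: upt_Suc)
    finally show "(\<Sum>j\<in>{1..d}. size_nat (budget I j)) \<le> encoding_size d I" .
  qed simp
  finally show ?thesis .
qed

section \<open>Bounds in terms of the encoding size\<close>

abbreviation (input) "n \<equiv> encoding_size d I"

lemma n_ge: "n \<ge> 4"
  using encoding_ge d by simp

lemma max_budget_eq: "max_budget d I = top_budget"
  by (simp add: max_budget_def top_budget_def)

lemma floorlog_top_le: "floorlog 2 top_budget \<le> n"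
proof -
  have "top_budget \<in> budget I ` {1..d}" unfolding top_budget_def using d by (intro Max_in) auto
  then have "top_budget \<in> set (encode d I)" by (auto simp: encode_def)
  then show ?thesis using size_le_encoding by (fastforce simp: size_nat_def)
qed

lemma base_le: "2 * Suc levels \<le> 16 * n ^ 2"
proof -
  have "levels \<le> (6 * d + 1) * floorlog 2 top_budget" by (rule levels_le)
  also have "\<dots> \<le> (7 * n) * n" using encoding_ge d floorlog_top_le by (intro mult_mono) auto
  finally have "2 * Suc levels \<le> 14 * n ^ 2 + 2" by (simp add: power2_eq_square)
  moreover have "1 \<le> n ^ 2" using n_ge by simp
  ultimately show ?thesis by linarith
qed

lemma d_le: "d \<le> n" and m_le: "n_items I \<le> n"
  using encoding_ge by simp_all

text \<open>The number of guesses may be huge, but its length is polynomial: at most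
  \<open>3 * n * n\<close> digits, each below \<open>2 ^ (16 * n ^ 2)\<close> by the crude
  \<open>x < 2 ^ x\<close>.\<close>

lemma guesses_less: "guesses + 1 < 2 ^ (100 * n ^ 4)" and base_less: "2 * Suc levels < 2 ^ (100 * n ^ 4)"
proof -
  have n4: "1 \<le> n ^ 4" "n ^ 2 \<le> n ^ 4" using n_ge by (auto intro: power_increasing)
  have "2 * Suc levels < 2 ^ (2 * Suc levels)" by (rule less_exp)
  also have "\<dots> \<le> 2 ^ (100 * n ^ 4)"
    using base_le n4 by (intro power_increasing) auto
  finally show "2 * Suc levels < 2 ^ (100 * n ^ 4)" .
  have "guesses \<le> 2 ^ (16 * n ^ 2 * (3 * n * n))"
  proof (cases "top_budget \<le> 1")
    case False
    have "guesses = (2 * Suc levels) ^ (3 * d * d)" using False by (simp add: guesses_def)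
    also have "\<dots> \<le> (2 ^ (2 * Suc levels)) ^ (3 * d * d)"
      by (intro power_mono less_imp_le less_exp) simp
    also have "\<dots> = 2 ^ (2 * Suc levels * (3 * d * d))" by (simp only: power_mult)
    also have "\<dots> \<le> 2 ^ (16 * n ^ 2 * (3 * n * n))"
    proof (intro power_increasing)
      have "3 * d * d \<le> 3 * n * n" using d_le by (intro mult_mono) auto
      then show "2 * Suc levels * (3 * d * d) \<le> 16 * n ^ 2 * (3 * n * n)"
        by (rule mult_le_mono[OF base_le])
    qed simp
    finally show ?thesis .
  qed (simp add: guesses_def)
  also have "16 * n ^ 2 * (3 * n * n) = 48 * n ^ 4" by (simp add: power2_eq_square power4_eq_xxxx)
  finally have "guesses + 1 \<le> 2 ^ (48 * n ^ 4) + 1" by simp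
  also have "\<dots> < 2 ^ Suc (48 * n ^ 4)"
  proof -
    have "(2::nat) ^ 1 \<le> 2 ^ (48 * n ^ 4)" using n4 by (intro power_increasing) auto
    then show ?thesis by simp
  qed
  also have "\<dots> \<le> 2 ^ (100 * n ^ 4)" using n4 by (intro power_increasing) auto
  finally show "guesses + 1 < 2 ^ (100 * n ^ 4)" .
qed

text \<open>The 4 extra bits give the factor 16 needed for \<open>6 * d + 6\<close>;
  \<open>100 * n ^ 4\<close> covers the \<open>48 * n ^ 4 + 1\<close> bits of the guess
  counter.\<close>

lemma machine_input:
  assumes "s \<le> d"
  shows "machine d (n_items I) (\<lambda>r. profit I (item_row I r)) (\<lambda>r. cost I (item_row I r)) (budget I)
    s (n + 4) (100 * n ^ 4) input_row (item_row I)"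
proof
  have n1: "n < 2 ^ n" by (rule less_exp)
  have pow: "2 ^ (n + 4) = 16 * (2::nat) ^ n" by (simp add: power_add)
  show "1 \<le> d" by (fact d)
  show "input_row 1 = n_items I" by (simp add: input_memory_def encode_def)
  show "input_row (j + 1) = budget I j" if "j \<in> {1..d}" for j by (rule input_budget[OF that])
  show "input_row (row_cell d r 0) = item_row I r" if "r < n_items I" for r
    using input_item[OF that, of 0] by simp
  show "input_row (row_cell d r 1) = profit I (item_row I r)" if "r < n_items I" for r
    using input_item[OF that, of 1] by simp
  show "input_row (row_cell d r (j + 1)) = cost I (item_row I r) j" if rj: "r < n_items I" "j \<in> {1..d}" for r j
  proof -
    obtain i where "j = Suc i" "i < d" using rj(2) by (cases j) auto
    then show ?thesis using input_item[OF rj(1), of "j + 1"] by (simp del: upt_Suc)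
  qed
  show "input_row k < 2 ^ (n + 4)" for k using input_less[of k] unfolding pow by linarith
  show "6 * d + 6 < 2 ^ (n + 4)" "s < 2 ^ (n + 4)" "n_items I < 2 ^ (n + 4)"
    unfolding pow using n1 encoding_ge assms by linarith+
  have "(0::nat) < 2 ^ n" by simp
  then show "scale < 2 ^ (n + 4)" unfolding pow using scale_le by linarith
  have "n ^ 1 \<le> n ^ 4" using n_ge by (intro power_increasing) auto
  then show "4 * (n + 4) + 4 \<le> 100 * n ^ 4" using n_ge by simp
  show "guesses + 1 < 2 ^ (100 * n ^ 4)" "2 * Suc levels < 2 ^ (100 * n ^ 4)"
    by (fact guesses_less base_less)+
qed

lemma run_time_le:
  assumes "s \<le> d"
  shows "machine.total_steps d (n_items I) (budget I) * (500 * (100 * n ^ 4)) \<le> guesses * n ^ 20"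
proof -
  interpret machine d "n_items I" "\<lambda>r. profit I (item_row I r)" "\<lambda>r. cost I (item_row I r)" "budget I"
    s "n + 4" "100 * n ^ 4" input_row "item_row I"
    by (rule machine_input[OF assms])
  have p: "1 \<le> n ^ 3" "n \<le> n ^ 3" "n ^ 2 \<le> n ^ 3"
    using n_ge power_increasing[of 1 3 n] power_increasing[of 2 3 n] by auto
  have g1: "guesses \<ge> 1" by (simp add: guesses_def)
  have "attempt_steps \<le> n * (n * (7 * n + 14) + 10 * n + 13) + 3 * n + 3 * n + 10"
    unfolding attempt_steps_def using d_le m_le by (intro add_mono mult_mono) auto
  also have "\<dots> = 7 * n ^ 3 + 24 * n ^ 2 + 19 * n + 10"
    by (simp add: power2_eq_square power3_eq_cube algebra_simps)
  finally have a: "attempt_steps + 5 * n_items I + 7 \<le> 72 * n ^ 3" using p m_le by linarith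
  have l: "3 * levels \<le> 24 * n ^ 3"
  proof -
    have "levels \<le> 8 * n ^ 2" using base_le by simp
    then have "3 * levels \<le> 24 * n ^ 2" by simp
    also have "\<dots> \<le> 24 * n ^ 3" using p(3) by simp
    finally show ?thesis .
  qed
  have dd: "9 * d * d \<le> 9 * n ^ 3"
  proof -
    have "9 * d * d \<le> 9 * n * n" using d_le by (intro mult_mono) auto
    then show ?thesis using p by (simp add: power2_eq_square)
  qed
  have "total_steps \<le> (guesses + 1) * (72 * n ^ 3) + 55 * n ^ 3"
    unfolding total_steps_def using mult_left_mono[OF a, of "guesses + 1"] l dd p d_le by linarith
  also have "\<dots> \<le> guesses * (199 * n ^ 3)" using g1 by (cases guesses) (auto simp: algebra_simps)
  finally have "total_steps * (500 * (100 * n ^ 4)) \<le> guesses * (199 * n ^ 3) * (500 * (100 * n ^ 4))"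
    by (rule mult_right_mono) simp
  also have "\<dots> = guesses * (9950000 * n ^ 7)" by (simp flip: power_add)
  \<comment> \<open>All constants together stay below \<open>4 ^ 13\<close>, which is at most
    \<open>n ^ 13\<close>.\<close>
  also have "\<dots> \<le> guesses * (4 ^ 13 * n ^ 7)" by (intro mult_left_mono mult_right_mono) auto
  also have "\<dots> \<le> guesses * (n ^ 13 * n ^ 7)"
    using n_ge by (intro mult_left_mono mult_right_mono power_mono) auto
  also have "\<dots> = guesses * n ^ 20" by (simp flip: power_add)
  finally show ?thesis .
qed

text \<open>The product of the number of guesses and a polynomial becomes a sum by
  \<open>2 * a * b <= a ^ 2 + b ^ 2\<close>. If \<open>d * log W\<close> is at least 2, it absorbs
  constants into the exponent; in the two remaining cases it may be 0 or 1, and the polynomial term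
  has to suffice alone.\<close>

lemma guesses_bound:
  "real (guesses * n ^ 20) \<le> (real d * log 2 (real top_budget)) ^ (40 * d\<^sup>2) + real n ^ 40"
proof -
  let ?x = "real d * log 2 (real top_budget)"
  have n1: "real n \<ge> 1" using n_ge by simp
  consider "top_budget \<le> 1" | "d = 1" | "\<not> top_budget \<le> 1" "d \<ge> 2" using d by linarith
  then show ?thesis
  proof cases
    case 1
    \<comment> \<open>This covers \<open>W = 0\<close> as well, where the logarithm is 0 by
      convention.\<close>
    have "log 2 (real top_budget) = 0" using 1 by (cases top_budget) (auto simp: log_def)
    then have "?x ^ (40 * d\<^sup>2) \<ge> 0" by simp
    moreover have "real (guesses * n ^ 20) \<le> real n ^ 40"
      using 1 n1 by (simp add: guesses_def power_increasing)
    ultimately show ?thesis by linarith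
  next
    case 2
    have "?x ^ (40 * d\<^sup>2) \<ge> 0" using 2 by (simp add: zero_le_even_power)
    moreover have "guesses * n ^ 20 \<le> n ^ 40"
    proof -
      \<comment> \<open>For \<open>d = 1\<close> a guess has only three digits, so there are at most
        \<open>n ^ 12\<close> guesses.\<close>
      have b: "2 * Suc levels \<le> n ^ 4"
      proof -
        have "16 * n ^ 2 \<le> n ^ 2 * n ^ 2"
          using power_mono[of 4 n 2] n_ge by (intro mult_right_mono) auto
        also have "\<dots> = n ^ 4" by (simp flip: power_add)
        finally show ?thesis using base_le by linarith
      qed
      have "guesses \<le> (2 * Suc levels) ^ (3 * d * d)" by (simp add: guesses_def)
      also have "\<dots> = (2 * Suc levels) ^ 3" by (simp only: 2 mult_1_right)
      also have "\<dots> \<le> (n ^ 4) ^ 3" using b by (rule power_mono) simp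
      also have "\<dots> = n ^ 12" by (simp flip: power_mult)
      finally have "guesses * n ^ 20 \<le> n ^ 12 * n ^ 20" by (rule mult_right_mono) simp
      also have "\<dots> = n ^ 32" by (simp flip: power_add)
      also have "\<dots> \<le> n ^ 40" using n_ge by (intro power_increasing) auto
      finally show ?thesis .
    qed
    then have "real (guesses * n ^ 20) \<le> real n ^ 40" by (metis of_nat_le_iff of_nat_power)
    ultimately show ?thesis by linarith
  next
    case 3
    have lg: "log 2 (real top_budget) \<ge> 1" using 3 by (simp add: le_log_iff)
    have x2: "?x \<ge> 2" using mult_mono[of 2 "real d" 1 "log 2 (real top_budget)"] lg 3 by simp
    have "real (floorlog 2 top_budget) \<le> log 2 (real top_budget) + 1"
      using 3 lg by (simp add: floorlog_def)
    then have fl: "real (floorlog 2 top_budget) \<le> 2 * log 2 (real top_budget)" using lg by linarith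
    have "real levels \<le> real ((6 * d + 1) * floorlog 2 top_budget)"
      using levels_le by (rule of_nat_mono)
    also have "\<dots> \<le> (7 * real d) * (2 * log 2 (real top_budget))"
      unfolding of_nat_mult using fl d by (intro mult_mono) auto
    finally have "real (2 * Suc levels) \<le> 28 * ?x + 2" by simp
    \<comment> \<open>The constant is a power of 2 on purpose: \<open>32 = 2 ^ 5\<close> is at most
      the fifth power of \<open>d * log W\<close>.\<close>
    also have "\<dots> \<le> 32 * ?x" using x2 by linarith
    also have "\<dots> \<le> ?x ^ 5 * ?x" using power_mono[OF x2, of 5] x2 by (intro mult_right_mono) auto
    also have "\<dots> = ?x ^ 6" by (simp flip: power_Suc2)
    finally have "real (2 * Suc levels) ^ (3 * d * d) \<le> (?x ^ 6) ^ (3 * d * d)"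
      by (intro power_mono) auto
    also have "\<dots> = ?x ^ (18 * d\<^sup>2)" by (simp add: power2_eq_square flip: power_mult)
    finally have g: "real guesses \<le> ?x ^ (18 * d\<^sup>2)"
      using 3 by (simp add: guesses_def)
    have "real guesses ^ 2 \<le> (?x ^ (18 * d\<^sup>2)) ^ 2" using g by (intro power_mono) auto
    also have "\<dots> = ?x ^ (36 * d\<^sup>2)" by (simp flip: power_mult)
    also have "\<dots> \<le> ?x ^ (40 * d\<^sup>2)" using x2 by (intro power_increasing) auto
    finally have g2: "real guesses ^ 2 \<le> ?x ^ (40 * d\<^sup>2)" .
    have "2 * (real guesses * real n ^ 20) \<le> real guesses ^ 2 + (real n ^ 20) ^ 2"
      using sum_squares_bound[of "real guesses" "real n ^ 20"] by simp
    also have "(real n ^ 20) ^ 2 = real n ^ 40" by (simp flip: power_mult)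
    finally have "2 * (real guesses * real n ^ 20) \<le> ?x ^ (40 * d\<^sup>2) + real n ^ 40" using g2 by linarith
    moreover have "0 \<le> real guesses * real n ^ 20" by simp
    ultimately show ?thesis unfolding of_nat_mult of_nat_power by linarith
  qed
qed

lemma knapsack_prog_correct:
  assumes s: "s \<ge> 1" "s * s \<le> d" "d < (s + 1) * (s + 1)"
  obtains t \<sigma> where "exec (knapsack_prog d s) (input_memory d I) t \<sigma>"
    "solution d I (output_items \<sigma>)" "OPT d I \<le> 25 * s * total_profit I (output_items \<sigma>)"
    "real t \<le> (real d * log 2 (real (max_budget d I))) ^ (40 * d\<^sup>2) + real n ^ 40"
proof -
  have sd: "s \<le> d" using s(1,2) by (metis le_trans mult.right_neutral mult_le_mono2)
  interpret machine d "n_items I" "\<lambda>r. profit I (item_row I r)" "\<lambda>r. cost I (item_row I r)" "budget I"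
    s "n + 4" "100 * n ^ 4" input_row "item_row I"
    by (rule machine_input[OF sd])
  let ?\<beta> = "100 * n ^ 4"
  have b: "(1::nat) \<le> ?\<beta>" using n_ge by simp
  have ident_less: "item_row I r < 2 ^ ?\<beta>" if "r < n_items I" for r
    using A_ident[OF that] cell_less by metis
  have "runs (2 ^ ?\<beta>) (knapsack_prog d s) (input_memory d I) total_steps (found (guesses + 1))"
    by (rule runs_knapsack) (use ident_less in \<open>auto simp: input_memory_def\<close>)
  then obtain k \<sigma> where k: "steps (2 ^ ?\<beta>) (knapsack_prog d s) (input_memory d I) k \<sigma>"
    "k \<le> total_steps" "found (guesses + 1) \<sigma>" by (auto simp: runs_def)
  have bd: "bounded (2 ^ ?\<beta>) (input_memory d I)"
    unfolding bounded_def
  proof (intro allI)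
    fix a i show "input_memory d I a i < 2 ^ ?\<beta>"
      by (cases "a = 0") (use cell_less in \<open>simp_all add: input_memory_def\<close>)
  qed
  have ok: "prog_ok (2 ^ ?\<beta>) 500 (knapsack_prog d s)"
  proof (rule knapsack_prog_ok)
    have "d + 6 < 2 ^ (n + 4)" "6 * d + 1 < 2 ^ (n + 4)" using small(1) d by linarith+
    then show "d + 6 < 2 ^ ?\<beta>" "6 * d + 1 < 2 ^ ?\<beta>" using pow_less1 by blast+
    show "s < 2 ^ ?\<beta>" using small(2) pow_less1 by blast
    have "3 * d * d \<le> 3 * n * n" using d_le by (intro mult_mono) auto
    also have "\<dots> \<le> 100 * n ^ 4"
      using power_increasing[of 2 4 n] n_ge by (simp add: power2_eq_square)
    also have "\<dots> < 2 ^ ?\<beta>" by (rule less_exp)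
    finally show "3 * d * d < 2 ^ ?\<beta>" .
  qed
  obtain t where t: "exec (knapsack_prog d s) (input_memory d I) t \<sigma>" "t \<le> k * (500 * ?\<beta>)"
    using steps_exec[OF k(1) bd ok b] by auto
  have "k * (500 * ?\<beta>) \<le> total_steps * (500 * ?\<beta>)" using k(2) by (rule mult_right_mono) simp
  also have "\<dots> \<le> guesses * n ^ 20" by (rule run_time_le[OF sd])
  finally have "t \<le> guesses * n ^ 20" using t(2) by (rule order_trans[rotated])
  then have "real t \<le> real (guesses * n ^ 20)" by (rule of_nat_mono)
  also have "\<dots> \<le> (real d * log 2 (real top_budget)) ^ (40 * d\<^sup>2) + real n ^ 40" by (rule guesses_bound)
  finally have time: "real t \<le> (real d * log 2 (real (max_budget d I))) ^ (40 * d\<^sup>2) + real n ^ 40"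
    by (simp only: max_budget_eq)
  obtain C where C: "feasible C" "(\<Sum>r\<in>C. profit I (item_row I r)) = \<sigma> 25 0" "output_items \<sigma> = item_row I ` C"
    using k(3) by (auto simp: found_def)
  have "solution d I (output_items \<sigma>)" "total_profit I (output_items \<sigma>) = \<sigma> 25 0"
    using feasible_imp_solution[OF C(1)] C by simp_all
  moreover have "OPT d I \<le> 25 * s * \<sigma> 25 0"
    by (rule OPT_le) (rule found_approximates[OF k(3) _ s(1,3)])
  ultimately show ?thesis using that t(1) time by simp
qed

end

theorem theorem1p6:
  "\<exists>(\<gamma>::real) (C::nat). \<gamma> > 0 \<and>
     (\<forall>d::nat. d \<ge> 1 \<longrightarrow>
       (\<exists>P. approximation_algorithm d (\<gamma> / sqrt (real d)) P \<and>
            runs_in_time d P (\<lambda>I.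
              (real d * log 2 (real (max_budget d I))) ^ (C * d\<^sup>2)
                + real (encoding_size d I) ^ C)))"
proof (intro exI[of _ "1 / 25 :: real"] exI[of _ "40 :: nat"] conjI allI impI)
  show "(0::real) < 1 / 25" by simp
  fix d :: nat assume d: "d \<ge> 1"
  \<comment> \<open>The rounded-down root is an integer price: the upper bound by the root turns the
    factor \<open>25 * s\<close> into the claimed ratio, and \<open>d < (s + 1) * (s + 1)\<close> is
    what the combinatorial estimates require.\<close>
  define s where "s = nat \<lfloor>sqrt (real d)\<rfloor>"
  have s_le: "real s \<le> sqrt (real d)" unfolding s_def by simp
  have s_gt: "sqrt (real d) < real s + 1" unfolding s_def by linarith
  have "real (s * s) \<le> real d"
    using mult_mono[OF s_le s_le] by simp
  then have 1: "s * s \<le> d" by (simp only: of_nat_le_iff)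
  have "real d < (real s + 1) * (real s + 1)"
    using mult_strict_mono[OF s_gt s_gt] d by simp
  also have "\<dots> = real ((s + 1) * (s + 1))" by (simp add: algebra_simps)
  finally have 2: "d < (s + 1) * (s + 1)" by (simp only: of_nat_less_iff)
  have 3: "s \<ge> 1" using 2 d by (cases s) auto
  show "\<exists>P. approximation_algorithm d (1 / 25 / sqrt (real d)) P \<and>
      runs_in_time d P (\<lambda>I. (real d * log 2 (real (max_budget d I))) ^ (40 * d\<^sup>2) + real (encoding_size d I) ^ 40)"
  proof (intro exI[of _ "knapsack_prog d s"] conjI)
    show "approximation_algorithm d (1 / 25 / sqrt (real d)) (knapsack_prog d s)"
      unfolding approximation_algorithm_def
    proof (intro allI impI)
      fix I :: knapsack assume fin: "finite (items I)"
      obtain t \<sigma> where e: "exec (knapsack_prog d s) (input_memory d I) t \<sigma>"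
        "solution d I (output_items \<sigma>)" "OPT d I \<le> 25 * s * total_profit I (output_items \<sigma>)"
        by (rule knapsack_prog_correct[OF fin d 3 1 2])
      have "real (OPT d I) \<le> real (25 * s * total_profit I (output_items \<sigma>))" using e(3) by (rule of_nat_mono)
      also have "\<dots> \<le> 25 * sqrt (real d) * real (total_profit I (output_items \<sigma>))"
        using s_le by (simp add: mult_right_mono)
      finally have "1 / 25 / sqrt (real d) * real (OPT d I) \<le> real (total_profit I (output_items \<sigma>))"
        using d by (simp add: field_simps)
      then show "\<exists>t \<sigma>. exec (knapsack_prog d s) (input_memory d I) t \<sigma> \<and> solution d I (output_items \<sigma>) \<and>
          1 / 25 / sqrt (real d) * real (OPT d I) \<le> real (total_profit I (output_items \<sigma>))"
        using e(1,2) by blast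
    qed
    show "runs_in_time d (knapsack_prog d s)
        (\<lambda>I. (real d * log 2 (real (max_budget d I))) ^ (40 * d\<^sup>2) + real (encoding_size d I) ^ 40)"
      unfolding runs_in_time_def
    proof (intro allI impI)
      fix I :: knapsack assume fin: "finite (items I)"
      obtain t \<sigma> where "exec (knapsack_prog d s) (input_memory d I) t \<sigma>"
        "real t \<le> (real d * log 2 (real (max_budget d I))) ^ (40 * d\<^sup>2) + real (encoding_size d I) ^ 40"
        by (rule knapsack_prog_correct[OF fin d 3 1 2])
      then show "\<exists>t \<sigma>. exec (knapsack_prog d s) (input_memory d I) t \<sigma> \<and>
          real t \<le> (real d * log 2 (real (max_budget d I))) ^ (40 * d\<^sup>2) + real (encoding_size d I) ^ 40"
        by (intro exI conjI)
    qed
  qed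
qed

end
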